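(* Let $\ell,s,r$ be positive integers with $s$ and $\ell$ coprime and $r$ even, and let $a,b>0$. Let $f_1:\mathbb{C}^2\to\mathbb{C}$ be the polynomial in $u,v,\overline{v}$ associated with $(s,r,\ell,a,b)$ as defined in the context, let $\deg(f_1)$ denote its total degree in $u,v,\overline{v}$, and for $(u,v)\in\mathbb{C}^2\setminus\{(0,0)\}$ put $\rho=\sqrt{|u|^2+|v|^2}$ and $$F(u,v)=\rho^{\,s+\deg(f_1)}\,f_1\left(\frac{u}{\rho^2},\frac{v}{\rho}\right).$$ Then, after multiplying $F$ by an appropriate non-negative integer power of $\rho$ if necessary (and extending by continuity to the origin), $F$ is a polynomial map $\mathbb{R}^4\to\mathbb{R}^2$ in the real variables $x_1=\operatorname{Re}u$, $x_2=\operatorname{Im}u$, $x_3=\operatorname{Re}v$, $x_4=\operatorname{Im}v$. This polynomial map has a weakly isolated singularity at $0\in\mathbb{R}^4$, and there is $\epsilon>0$ such that for every $0<\rho_0<\epsilon$ the intersection of its zero set with the three-sphere $S^3_{\rho_0}$ of radius $\rho_0$ centred at the origin is a link ambient isotopic (after rescaling $S^3_{\rho_0}$ to the unit sphere) to the lemniscate link $L(s,r,\ell)$.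
   Context: For $j=1,\dots,s$ and $h\in[0,2\pi]$ put $$Z_j(h)=a\cos\left(\frac{rh+2\pi(j-1)}{s}\right)+\mathrm{i}\,\frac{b}{\ell}\sin\left(\frac{\ell\,(rh+2\pi(j-1))}{s}\right),\qquad p(u,h)=\prod_{j=1}^s\bigl(u-Z_j(h)\bigr).$$ The function $p$ can be written uniquely as a polynomial in $u$ whose coefficients are Laurent polynomials in $\mathrm{e}^{\mathrm{i}h}$. The polynomial $f_1(u,v)$ in the variables $u,v,\overline{v}$ is obtained from it by replacing $\mathrm{e}^{\mathrm{i}kh}$ by $v^k$ for $k\ge0$ and by $\overline{v}^{\,|k|}$ for $k<0$. The lemniscate link $L(s,r,\ell)$ (with $b>0$) is the closure of the braid with the $s$ strands $(X_j(h),Y_j(h),h)$, $0\le h\le2\pi$, $X_j=\operatorname{Re}Z_j$, $Y_j=\operatorname{Im}Z_j$. Explicitly it is the link $$\bigcup_{j=1}^s\{(\cos(h)(R+X_j(h)),\ \sin(h)(R+X_j(h)),\ Y_j(h)) : h\in[0,2\pi]\}\subset\mathbb{R}^3$$ with $R>0$ large enough that $R+X_j(h)>0$ for all $j,h$, regarded as a link in the unit sphere $S^3\subset\mathbb{C}^2$ via the stereographic identification $u=\frac{\varrho^2-1+2\mathrm{i}z}{\varrho^2+1}$, $v=\frac{2(x+\mathrm{i}y)}{\varrho^2+1}$, $\varrho^2=x^2+y^2+z^2$. A point of $\mathbb{R}^4$ is a singular point of a polynomial map $g:\mathbb{R}^4\to\mathbb{R}^2$ if the Jacobian of $g$ does not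 have full rank there. A singular point $x$ with $g(x)=0$ is weakly isolated if some neighbourhood of $x$ contains no other singular point of $g$ lying in $g^{-1}(0)$. *)

theory Defs
  imports
    "HOL-Analysis.Analysis"
    "HOL-Library.Poly_Mapping"
    "HOL-Computational_Algebra.Polynomial"
begin

section \<open>The polynomial \<open>f\<^sub>1\<close>\<close>

definition Z :: "nat \<Rightarrow> nat \<Rightarrow> nat \<Rightarrow> real \<Rightarrow> real \<Rightarrow> nat \<Rightarrow> real \<Rightarrow> complex" where
  "Z s r l a b j h =
     Complex (a * cos ((real r * h + 2 * pi * (real j - 1)) / real s))
             (b / real l * sin (real l * (real r * h + 2 * pi * (real j - 1)) / real s))"

definition braid_poly :: "nat \<Rightarrow> nat \<Rightarrow> nat \<Rightarrow> real \<Rightarrow> real \<Rightarrow> complex \<Rightarrow> real \<Rightarrow> complex" where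
  "braid_poly s r l a b u h = (\<Prod>j = 1..s. u - Z s r l a b j h)"

text \<open>A Laurent polynomial \<open>\<Sum>k. c\<^sub>k w^k\<close> is its finitely supported coefficient
  function \<open>int \<Rightarrow>\<^sub>0 complex\<close>.\<close>

type_synonym laurent_poly = "int \<Rightarrow>\<^sub>0 complex"

definition laurent_eval :: "laurent_poly \<Rightarrow> complex \<Rightarrow> complex" where
  "laurent_eval q w = (\<Sum>k\<in>Poly_Mapping.keys q. Poly_Mapping.lookup q k * w powi k)"

text \<open>The description operator is well defined: for positive \<open>s\<close> such a polynomial exists, because
  \<open>h \<mapsto> h + 2 * pi\<close> permutes the \<open>Z s r l a b j\<close>, and a polynomial in \<open>u\<close> with Laurent polynomial
  coefficients is determined by its values on \<open>\<complex>\<close> times the unit circle.\<close>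

definition braid_laurent :: "nat \<Rightarrow> nat \<Rightarrow> nat \<Rightarrow> real \<Rightarrow> real \<Rightarrow> laurent_poly poly" where
  "braid_laurent s r l a b =
     (THE P. \<forall>u. \<forall>h\<in>{0..2 * pi}.
        poly (map_poly (\<lambda>q. laurent_eval q (cis h)) P) u = braid_poly s r l a b u h)"

text \<open>Polynomials in \<open>u\<close>, \<open>v\<close> and the conjugate of \<open>v\<close>, regarded as three independent
  variables; \<open>(i, m, n)\<close> stands for the monomial \<open>u^i * v^m * (cnj v)^n\<close>.\<close>

type_synonym mixed_poly = "(nat \<times> nat \<times> nat) \<Rightarrow>\<^sub>0 complex"

definition mixed_eval :: "mixed_poly \<Rightarrow> complex \<Rightarrow> complex \<Rightarrow> complex" where
  "mixed_eval f u v =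
     (\<Sum>(i, m, n)\<in>Poly_Mapping.keys f. Poly_Mapping.lookup f (i, m, n) * u ^ i * v ^ m * cnj v ^ n)"

definition total_deg :: "mixed_poly \<Rightarrow> nat" where
  "total_deg f = Max ((\<lambda>(i, m, n). i + m + n) ` Poly_Mapping.keys f)"

definition f1 :: "nat \<Rightarrow> nat \<Rightarrow> nat \<Rightarrow> real \<Rightarrow> real \<Rightarrow> mixed_poly" where
  "f1 s r l a b =
     (let P = braid_laurent s r l a b in
      \<Sum>i\<le>Polynomial.degree P. \<Sum>k\<in>Poly_Mapping.keys (coeff P i).
        Poly_Mapping.single (if 0 \<le> k then (i, nat k, 0) else (i, 0, nat \<bar>k\<bar>))
                            (Poly_Mapping.lookup (coeff P i) k))"

section \<open>The function \<open>F\<close>\<close>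

definition rho :: "complex \<Rightarrow> complex \<Rightarrow> real" where
  "rho u v = sqrt ((cmod u)\<^sup>2 + (cmod v)\<^sup>2)"

definition F :: "nat \<Rightarrow> nat \<Rightarrow> nat \<Rightarrow> real \<Rightarrow> real \<Rightarrow> complex \<Rightarrow> complex \<Rightarrow> complex" where
  "F s r l a b u v =
     of_real (rho u v ^ (s + total_deg (f1 s r l a b))) *
     mixed_eval (f1 s r l a b) (u / of_real ((rho u v)\<^sup>2)) (v / of_real (rho u v))"

definition u_of :: "real ^ 4 \<Rightarrow> complex" where "u_of x = Complex (x $ 1) (x $ 2)"
definition v_of :: "real ^ 4 \<Rightarrow> complex" where "v_of x = Complex (x $ 3) (x $ 4)"

definition real4_of :: "complex \<Rightarrow> complex \<Rightarrow> real ^ 4" where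
  "real4_of u v = vector [Re u, Im u, Re v, Im v]"

definition real2_of :: "complex \<Rightarrow> real ^ 2" where
  "real2_of w = vector [Re w, Im w]"

text \<open>\<open>G\<close> is \<open>\<rho>^N * F\<close> as a map on all of \<open>\<real>^4\<close>. If \<open>G\<close> is continuous, then \<open>G 0\<close> is
  necessarily the limit of \<open>\<rho>^N * F\<close>, i.e. \<open>G\<close> is the extension by continuity.\<close>

definition extends_F ::
    "nat \<Rightarrow> nat \<Rightarrow> nat \<Rightarrow> real \<Rightarrow> real \<Rightarrow> nat \<Rightarrow> (real ^ 4 \<Rightarrow> real ^ 2) \<Rightarrow> bool" where
  "extends_F s r l a b N G \<longleftrightarrow>
     (\<forall>x. x \<noteq> 0 \<longrightarrow>
        G x = real2_of (of_real (rho (u_of x) (v_of x) ^ N) * F s r l a b (u_of x) (v_of x)))"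

lemma vector_4 [simp]:
  "(vector [w, x, y, z] :: 'a::zero ^ 4) $ 1 = w"
  "(vector [w, x, y, z] :: 'a::zero ^ 4) $ 2 = x"
  "(vector [w, x, y, z] :: 'a::zero ^ 4) $ 3 = y"
  "(vector [w, x, y, z] :: 'a::zero ^ 4) $ 4 = z"
  unfolding vector_def by simp_all

lemma u_of_real4_of [simp]: "u_of (real4_of u v) = u"
  and v_of_real4_of [simp]: "v_of (real4_of u v) = v"
  by (simp_all add: u_of_def v_of_def real4_of_def)

lemma rho_eq_norm: "rho (u_of x) (v_of x) = norm x"
  by (simp add: rho_def u_of_def v_of_def cmod_def norm_vec_def L2_set_def sum_4)

section \<open>Singularities\<close>

text \<open>Intended for differentiable (here: polynomial) maps, for which \<open>jacobian\<close> is the matrix of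
  the derivative.\<close>

definition singular_point :: "(real ^ 4 \<Rightarrow> real ^ 2) \<Rightarrow> real ^ 4 \<Rightarrow> bool" where
  "singular_point g x \<longleftrightarrow> rank (jacobian g (at x)) < 2"

definition weakly_isolated_singularity :: "(real ^ 4 \<Rightarrow> real ^ 2) \<Rightarrow> real ^ 4 \<Rightarrow> bool" where
  "weakly_isolated_singularity g x \<longleftrightarrow>
     singular_point g x \<and> g x = 0 \<and>
     (\<exists>U. open U \<and> x \<in> U \<and> (\<forall>y\<in>U. y \<noteq> x \<and> g y = 0 \<longrightarrow> \<not> singular_point g y))"

section \<open>Links\<close>

text \<open>Links and ambient isotopies are unoriented and topological. Tameness is not part of the
  definition of a link: it is inherited from the smooth lemniscate link along an ambient isotopy.\<close>

definition is_link :: "(real ^ 4) set \<Rightarrow> bool" where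
  "is_link K \<longleftrightarrow>
     (\<exists>\<C>. finite \<C> \<and> \<C> \<noteq> {} \<and> pairwise disjnt \<C> \<and>
          (\<forall>C\<in>\<C>. C homeomorphic sphere (0 :: complex) 1) \<and> K = \<Union>\<C>)"

definition ambient_isotopic_in :: "'a::topological_space set \<Rightarrow> 'a set \<Rightarrow> 'a set \<Rightarrow> bool" where
  "ambient_isotopic_in S K L \<longleftrightarrow>
     K \<subseteq> S \<and> L \<subseteq> S \<and>
     (\<exists>H :: real \<times> 'a \<Rightarrow> 'a.
        continuous_on ({0..1} \<times> S) H \<and>
        (\<forall>t\<in>{0..1}. \<exists>g. homeomorphism S S (\<lambda>x. H (t, x)) g) \<and>
        (\<forall>x\<in>S. H (0, x) = x) \<and>
        (\<lambda>x. H (1, x)) ` K = L)"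

text \<open>The closure of the braid in \<open>\<real>^3\<close>; \<open>R\<close> is the radius of the core circle of the
  solid torus containing it.\<close>

definition lemniscate_link_R3 :: "nat \<Rightarrow> nat \<Rightarrow> nat \<Rightarrow> real \<Rightarrow> real \<Rightarrow> real \<Rightarrow> (real ^ 3) set" where
  "lemniscate_link_R3 s r l a b R =
     (\<Union>j\<in>{1..s}. (\<lambda>h. vector [cos h * (R + Re (Z s r l a b j h)),
                                sin h * (R + Re (Z s r l a b j h)),
                                Im (Z s r l a b j h)]) ` {0..2 * pi})"

definition inv_stereographic :: "real ^ 3 \<Rightarrow> real ^ 4" where
  "inv_stereographic p =
     (let q = (norm p)\<^sup>2 in
      real4_of (Complex (q - 1) (2 * p $ 3) / of_real (q + 1))
               (of_real 2 * Complex (p $ 1) (p $ 2) / of_real (q + 1)))"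

lemma norm_inv_stereographic: "norm (inv_stereographic p) = 1"
proof -
  define q where "q = (norm p)\<^sup>2"
  have q: "q = (p $ 1)\<^sup>2 + (p $ 2)\<^sup>2 + (p $ 3)\<^sup>2"
    unfolding q_def norm_vec_def L2_set_def by (simp add: sum_3)
  have pos: "q + 1 > 0"
    unfolding q by (intro add_nonneg_pos add_nonneg_nonneg) simp_all
  have u: "(cmod (Complex (q - 1) (2 * p $ 3) / of_real (q + 1)))\<^sup>2 =
           ((q - 1)\<^sup>2 + (2 * p $ 3)\<^sup>2) / (q + 1)\<^sup>2"
    unfolding norm_divide power_divide norm_of_real cmod_power2 power2_abs complex.sel ..
  have v: "(cmod (of_real 2 * Complex (p $ 1) (p $ 2) / of_real (q + 1)))\<^sup>2 =
           4 * ((p $ 1)\<^sup>2 + (p $ 2)\<^sup>2) / (q + 1)\<^sup>2"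
    unfolding norm_divide norm_mult power_divide power_mult_distrib norm_of_real cmod_power2
      power2_abs complex.sel
    by simp
  have "(q - 1)\<^sup>2 + (2 * p $ 3)\<^sup>2 + 4 * ((p $ 1)\<^sup>2 + (p $ 2)\<^sup>2) =
        (q - 1)\<^sup>2 + 4 * q"
    unfolding q by (simp add: power_mult_distrib)
  also have "\<dots> = (q + 1)\<^sup>2"
    by (simp add: power2_sum power2_diff)
  finally have "((q - 1)\<^sup>2 + (2 * p $ 3)\<^sup>2) / (q + 1)\<^sup>2 +
      4 * ((p $ 1)\<^sup>2 + (p $ 2)\<^sup>2) / (q + 1)\<^sup>2 = 1"
    unfolding add_divide_distrib [symmetric] using pos by simp
  then have "rho (u_of (inv_stereographic p)) (v_of (inv_stereographic p)) = 1"
    by (simp only: inv_stereographic_def Let_def q_def [symmetric] u_of_real4_of v_of_real4_of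
        rho_def u v real_sqrt_one)
  then show ?thesis
    by (simp only: rho_eq_norm)
qed

definition lemniscate_link :: "nat \<Rightarrow> nat \<Rightarrow> nat \<Rightarrow> real \<Rightarrow> real \<Rightarrow> real \<Rightarrow> (real ^ 4) set" where
  "lemniscate_link s r l a b R = inv_stereographic ` lemniscate_link_R3 s r l a b R"

definition admissible_radius :: "nat \<Rightarrow> nat \<Rightarrow> nat \<Rightarrow> real \<Rightarrow> real \<Rightarrow> real \<Rightarrow> bool" where
  "admissible_radius s r l a b R \<longleftrightarrow>
     R > 0 \<and> (\<forall>j\<in>{1..s}. \<forall>h\<in>{0..2 * pi}. R + Re (Z s r l a b j h) > 0)"

end

theory Submission
  imports Defs
begin

text \<open>Write \<open>u = \<rho>\<^sup>2 u'\<close> and \<open>v = \<rho> v'\<close>. On the sphere of radius \<open>\<rho>\<close> the zeros of \<open>F\<close> are the zeros \<open>(u', v')\<close> of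
\<open>f\<^sub>1\<close> on the ellipsoid \<open>\<rho>\<^sup>2 |u'|\<^sup>2 + |v'|\<^sup>2 = 1\<close>. Since \<open>f\<^sub>1\<close> is monic in \<open>u\<close>, its zeros with \<open>|v'| \<le> 1\<close> have
bounded \<open>u'\<close>, so \<open>|v'|\<close> tends to 1 as \<open>\<rho>\<close> tends to 0. Over \<open>|v'| = 1\<close> the polynomial is
\<open>\<Prod>j. u' - Z\<^sub>j(h)\<close>, whose roots are simple: if \<open>cos\<close> agrees at two distinct parameters over
the same \<open>h\<close> then they are opposite, and coprimality of \<open>s\<close> and \<open>l\<close> separates the values of the second
coordinate. Hence for small \<open>\<rho>\<close> the zero set is a closed braid whose strands \<open>u'\<close> are close to the \<open>Z\<^sub>j\<close>,
every zero is simple in the \<open>u'\<close>-direction, and after rescaling to the unit sphere the strands of the link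
become \<open>\<rho> u'\<close>.

All strands are handled at once. With \<open>t = exp(i(rh + 2\<pi>(j-1))/s)\<close> and \<open>w = exp(ih)\<close> the point
\<open>(w, t)\<close> runs through the curve \<open>t\<^sup>s = w\<^sup>r\<close> on the torus and \<open>Z\<^sub>j(h)\<close> depends on \<open>t\<close> alone, so a braid is a
complex function on that curve which is injective on each fibre over \<open>w\<close>. The monodromy of the strands is part of
the curve.

The proof has four parts. \<open>ambient_isotopic_braid_path\<close>: closed braids joined by a path of
braids are ambient isotopic; nearby braids are connected by pushing with bump functions, and
connectedness of the parameter interval does the rest. \<open>is_link_closed_braid\<close>: the torus curve is a
disjoint union of \<open>gcd s r\<close> circles. \<open>braid_laurent\<close> and the lemmas on \<open>f1\<close> after it: the shape
of \<open>f\<^sub>1\<close>; its exponents of \<open>v\<close> and its conjugate are multiples of \<open>r\<close>, hence even, which makes \<open>F\<close> a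
polynomial up to one factor \<open>\<rho>\<close> and makes \<open>f\<^sub>1\<close> on the ellipsoid a perturbation of order \<open>\<rho>\<^sup>2\<close>.
\<open>exists_zero_strands\<close>: the perturbed strands, from the contraction principle.

The lemniscate link itself is the closed braid of \<open>C(R + Z\<^sub>j)\<close>, where \<open>C\<close> maps the right half-plane to
the unit disc. Moving \<open>R + Z\<^sub>j\<close> linearly to \<open>1 + \<rho> Z\<^sub>j\<close> and then \<open>C(1 + \<rho> Z\<^sub>j)\<close>, which is
\<open>\<rho> Z\<^sub>j + O(\<rho>\<^sup>2)\<close>, linearly to \<open>\<rho> u'\<close> is a path of braids.\<close>


section \<open>Ambient isotopy is symmetric and transitive\<close>
lemma ambient_isotopic_in_sym:
  fixes S :: "'a::topological_space set"
  assumes "ambient_isotopic_in S K L" shows "ambient_isotopic_in S L K"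
proof -
  obtain H :: "real \<times> 'a \<Rightarrow> 'a" where KL: "K \<subseteq> S" "L \<subseteq> S" and H: "continuous_on ({0..1} \<times> S) H"
    and hom: "\<And>t. t \<in> {0..1} \<Longrightarrow> \<exists>g. homeomorphism S S (\<lambda>x. H (t, x)) g"
    and H0: "\<And>x. x \<in> S \<Longrightarrow> H (0, x) = x" and H1: "(\<lambda>x. H (1, x)) ` K = L"
    using assms unfolding ambient_isotopic_in_def by blast
  obtain g where g: "homeomorphism S S (\<lambda>x. H (1, x)) g"
    using hom[of 1] by auto
  have gS: "g ` S = S" and contg: "continuous_on S g"
    using g by (auto simp: homeomorphism_def)
  have gH: "g (H (1, x)) = x" "H (1, g x) = x" if "x \<in> S" for x
    using g that by (auto simp: homeomorphism_def)
  define H' where "H' = (\<lambda>(t::real, x). H (1 - t, g x))"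
  have "continuous_on ({0..1} \<times> S) (H \<circ> (\<lambda>(t, x). (1 - t, g x)))"
  proof (rule continuous_on_compose)
    have "continuous_on ({0..1} \<times> S) (\<lambda>p. g (snd p))"
      by (rule continuous_on_compose2[OF contg]) (auto intro: continuous_intros)
    then show "continuous_on ({0..1::real} \<times> S) (\<lambda>(t, x). (1 - t, g x))"
      unfolding case_prod_unfold by (auto intro!: continuous_intros)
    show "continuous_on ((\<lambda>(t::real, x). (1 - t, g x)) ` ({0..1} \<times> S)) H"
      by (rule continuous_on_subset[OF H]) (use gS in auto)
  qed
  then have "continuous_on ({0..1} \<times> S) H'"
    by (simp add: H'_def o_def case_prod_unfold)
  moreover have "\<exists>k. homeomorphism S S (\<lambda>x. H' (t, x)) k" if t: "t \<in> {0..1}" for t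
  proof -
    obtain k where "homeomorphism S S (\<lambda>x. H (1 - t, x)) k"
      using hom[of "1 - t"] t by auto
    from homeomorphism_compose[OF homeomorphism_symD[OF g] this]
    show ?thesis by (auto simp: H'_def o_def)
  qed
  moreover have "H' (0, x) = x" if "x \<in> S" for x
    using gH(2)[OF that] by (simp add: H'_def)
  moreover have "(\<lambda>x. H' (1, x)) ` L = K"
  proof -
    have *: "H' (1, H (1, x)) = x" if "x \<in> K" for x
    proof -
      have "x \<in> S" using that KL by auto
      then show ?thesis by (simp add: H'_def gH H0)
    qed
    then show ?thesis unfolding H1[symmetric] image_image by simp
  qed
  ultimately show ?thesis
    unfolding ambient_isotopic_in_def using KL by blast
qed

lemma ambient_isotopic_in_trans:
  fixes S :: "'a::topological_space set"
  assumes "ambient_isotopic_in S K L" "ambient_isotopic_in S L M"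
  shows "ambient_isotopic_in S K M"
proof -
  obtain H :: "real \<times> 'a \<Rightarrow> 'a" where KL: "K \<subseteq> S" "L \<subseteq> S" and H: "continuous_on ({0..1} \<times> S) H"
    and hom: "\<And>t. t \<in> {0..1} \<Longrightarrow> \<exists>g. homeomorphism S S (\<lambda>x. H (t, x)) g"
    and H0: "\<And>x. x \<in> S \<Longrightarrow> H (0, x) = x" and H1: "(\<lambda>x. H (1, x)) ` K = L"
    using assms(1) unfolding ambient_isotopic_in_def by blast
  obtain J :: "real \<times> 'a \<Rightarrow> 'a" where M: "M \<subseteq> S" and J: "continuous_on ({0..1} \<times> S) J"
    and homJ: "\<And>t. t \<in> {0..1} \<Longrightarrow> \<exists>g. homeomorphism S S (\<lambda>x. J (t, x)) g"
    and J0: "\<And>x. x \<in> S \<Longrightarrow> J (0, x) = x" and J1: "(\<lambda>x. J (1, x)) ` L = M"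
    using assms(2) unfolding ambient_isotopic_in_def by blast
  have HS: "H (t, x) \<in> S" if "t \<in> {0..1}" "x \<in> S" for t x
    using hom[OF that(1)] that(2) by (auto simp: homeomorphism_def)
  \<comment> \<open>Composing the two isotopies at equal times avoids concatenation.\<close>
  define H' where "H' = (\<lambda>(t::real, x). J (t, H (t, x)))"
  have "continuous_on ({0..1} \<times> S) (J \<circ> (\<lambda>p. (fst p, H p)))"
  proof (rule continuous_on_compose)
    show "continuous_on ({0..1} \<times> S) (\<lambda>p. (fst p, H p))"
      by (intro continuous_intros H)
    show "continuous_on ((\<lambda>p. (fst p, H p)) ` ({0..1} \<times> S)) J"
      by (rule continuous_on_subset[OF J]) (use HS in auto)
  qed
  then have "continuous_on ({0..1} \<times> S) H'"
    by (simp add: H'_def o_def case_prod_unfold)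
  moreover have "\<exists>k. homeomorphism S S (\<lambda>x. H' (t, x)) k" if t: "t \<in> {0..1}" for t
  proof -
    obtain k k' where "homeomorphism S S (\<lambda>x. H (t, x)) k" "homeomorphism S S (\<lambda>x. J (t, x)) k'"
      using hom homJ t by meson
    from homeomorphism_compose[OF this]
    show ?thesis by (auto simp: H'_def o_def)
  qed
  moreover have "H' (0, x) = x" if "x \<in> S" for x
    using J0[OF that] H0[OF that] by (simp add: H'_def)
  moreover have "(\<lambda>x. H' (1, x)) ` K = M"
    unfolding J1[symmetric] H1[symmetric] image_image by (simp add: H'_def)
  ultimately show ?thesis
    unfolding ambient_isotopic_in_def using KL M by blast
qed

section \<open>The torus curve\<close>
definition fibre :: "nat \<Rightarrow> nat \<Rightarrow> complex \<Rightarrow> complex set" where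
  "fibre s r w = {t. cmod t = 1 \<and> t ^ s = w ^ r}"

definition torus_curve :: "nat \<Rightarrow> nat \<Rightarrow> (complex \<times> complex) set" where
  "torus_curve s r = {(w, t). cmod w = 1 \<and> t \<in> fibre s r w}"

lemma finite_fibre: "0 < s \<Longrightarrow> finite (fibre s r w)"
  unfolding fibre_def by (rule finite_subset[OF _ finite_nth_roots]) auto

lemma card_fibre:
  assumes "0 < s" "cmod w = 1" shows "card (fibre s r w) = s"
proof -
  have "fibre s r w = {t. t ^ s = w ^ r}"
  proof -
    have "cmod t = 1" if "t ^ s = w ^ r" for t
    proof -
      have "cmod t ^ s = 1" using that assms by (metis norm_power power_one)
      then show ?thesis using assms(1) power_eq_1_iff[of "cmod t" s] by simp
    qed
    then show ?thesis by (auto simp: fibre_def)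
  qed
  moreover have "w ^ r \<noteq> 0" using assms by auto
  ultimately show ?thesis using card_nth_roots[of "w ^ r" s] assms by auto
qed

lemma compact_torus_curve: "compact (torus_curve s r)"
proof -
  have "closed {p::complex \<times> complex. cmod (fst p) = 1 \<and> cmod (snd p) = 1 \<and> snd p ^ s = fst p ^ r}"
    by (intro closed_Collect_conj closed_Collect_eq continuous_intros)
  moreover have "torus_curve s r = sphere 0 1 \<times> sphere 0 1 \<inter>
      {p. cmod (fst p) = 1 \<and> cmod (snd p) = 1 \<and> snd p ^ s = fst p ^ r}"
    by (auto simp: torus_curve_def fibre_def)
  ultimately show ?thesis
    by (simp only:) (intro compact_Int_closed compact_Times compact_sphere)
qed

text \<open>Near \<open>w\<^sub>0\<close> the multivalued function \<open>w powr (r / s)\<close> has a continuous branch, and multiplying by its quotient moves one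
fibre to another. So a sum over the moving fibre becomes a sum over a fixed one, which is why such sums are continuous
although the points of a fibre cannot be labelled consistently around the circle.\<close>
lemma bij_betw_fibre_branch:
  fixes s r :: nat and w w\<^sub>0 :: complex
  assumes "0 < s" "cmod w\<^sub>0 = 1" "cmod w = 1"
  defines "m \<equiv> exp (of_nat r / of_nat s * Ln (w / w\<^sub>0))"
  shows "bij_betw (\<lambda>t. t * m) (fibre s r w\<^sub>0) (fibre s r w)"
proof -
  have z: "w / w\<^sub>0 \<noteq> 0" "cmod (w / w\<^sub>0) = 1" using assms by (auto simp: norm_divide)
  have "m ^ s = exp (of_nat r * Ln (w / w\<^sub>0))"
    unfolding m_def exp_of_nat_mult[symmetric] using \<open>0 < s\<close> by simp
  also have "\<dots> = (w / w\<^sub>0) ^ r" using z by (simp add: exp_of_nat_mult)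
  finally have ms: "m ^ s = (w / w\<^sub>0) ^ r" .
  then have "cmod m ^ s = 1" using z by (metis norm_power power_one)
  then have m1: "cmod m = 1" using assms(1) power_eq_1_iff[of "cmod m" s] by simp
  then have m0: "m \<noteq> 0" by auto
  show ?thesis
  proof (rule bij_betwI[where g = "\<lambda>t. t / m"])
    show "(\<lambda>t. t * m) \<in> fibre s r w\<^sub>0 \<rightarrow> fibre s r w"
      using assms m1 ms by (auto simp: fibre_def norm_mult power_mult_distrib power_divide)
    show "(\<lambda>t. t / m) \<in> fibre s r w \<rightarrow> fibre s r w\<^sub>0"
      using assms m1 ms z by (auto simp: fibre_def norm_divide power_divide)
  qed (use m0 in auto)
qed

lemma continuous_on_fibre_sum:
  fixes \<phi> :: "'a::metric_space \<times> (complex \<times> complex) \<Rightarrow> complex"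
  assumes s: "0 < s" and \<phi>: "continuous_on (Y \<times> torus_curve s r) \<phi>"
  shows "continuous_on (Y \<times> sphere 0 1) (\<lambda>(y, w). \<Sum>t\<in>fibre s r w. \<phi> (y, (w, t)))"
  unfolding continuous_on_def
proof
  fix p assume p: "p \<in> Y \<times> sphere (0::complex) 1"
  obtain y\<^sub>0 w\<^sub>0 where p_eq: "p = (y\<^sub>0, w\<^sub>0)" by force
  have y\<^sub>0: "y\<^sub>0 \<in> Y" and w\<^sub>0: "cmod w\<^sub>0 = 1" using p p_eq by auto
  then have w\<^sub>0n: "w\<^sub>0 \<noteq> 0" by auto
  define m where "m = (\<lambda>w. exp (of_nat r / of_nat s * Ln (w / w\<^sub>0)))"
  let ?A = "Y \<times> sphere (0::complex) 1"
  let ?F = "at p within ?A"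
  have lim: "((\<lambda>q. \<phi> (fst q, (snd q, t * m (snd q)))) \<longlongrightarrow> \<phi> (y\<^sub>0, (w\<^sub>0, t))) ?F" if t: "t \<in> fibre s r w\<^sub>0" for t
  proof (rule continuous_on_tendsto_compose[OF \<phi>])
    have snd: "((\<lambda>q. snd q) \<longlongrightarrow> w\<^sub>0) ?F"
      using tendsto_snd[OF tendsto_ident_at[of p ?A]] p_eq by simp
    have fst: "((\<lambda>q. fst q) \<longlongrightarrow> y\<^sub>0) ?F"
      using tendsto_fst[OF tendsto_ident_at[of p ?A]] p_eq by simp
    have "((\<lambda>q. m (snd q)) \<longlongrightarrow> exp (of_nat r / of_nat s * Ln (w\<^sub>0 / w\<^sub>0))) ?F"
      unfolding m_def by (intro tendsto_intros snd) (use w\<^sub>0n in auto)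
    then have "((\<lambda>q. m (snd q)) \<longlongrightarrow> 1) ?F" using w\<^sub>0n by simp
    from tendsto_Pair[OF fst tendsto_Pair[OF snd tendsto_mult[OF tendsto_const this]], of t]
    show "((\<lambda>q. (fst q, (snd q, t * m (snd q)))) \<longlongrightarrow> (y\<^sub>0, (w\<^sub>0, t))) ?F" by simp
    show "(y\<^sub>0, (w\<^sub>0, t)) \<in> Y \<times> torus_curve s r"
      using y\<^sub>0 w\<^sub>0 t by (auto simp: torus_curve_def)
    have "(fst q, (snd q, t * m (snd q))) \<in> Y \<times> torus_curve s r" if q: "q \<in> ?A" for q
    proof -
      have "t * m (snd q) \<in> fibre s r (snd q)"
        using bij_betw_apply[OF bij_betw_fibre_branch[OF s w\<^sub>0, of "snd q" r] t] q by (auto simp: m_def)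
      then show ?thesis using q by (auto simp: torus_curve_def)
    qed
    then show "\<forall>\<^sub>F q in ?F. (fst q, (snd q, t * m (snd q))) \<in> Y \<times> torus_curve s r"
      by (simp add: eventually_at_filter)
  qed
  have "((\<lambda>q. \<Sum>t\<in>fibre s r w\<^sub>0. \<phi> (fst q, (snd q, t * m (snd q)))) \<longlongrightarrow>
      (\<Sum>t\<in>fibre s r w\<^sub>0. \<phi> (y\<^sub>0, (w\<^sub>0, t)))) ?F"
    by (intro tendsto_sum lim)
  moreover have "(\<Sum>t\<in>fibre s r w\<^sub>0. \<phi> (fst q, (snd q, t * m (snd q)))) =
      (\<Sum>t\<in>fibre s r (snd q). \<phi> (fst q, (snd q, t)))" if "q \<in> ?A" for q
    using sum.reindex_bij_betw[OF bij_betw_fibre_branch[OF s w\<^sub>0, of "snd q" r],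
        of "\<lambda>t. \<phi> (fst q, (snd q, t))"] that by (auto simp: m_def)
  then have "\<forall>\<^sub>F q in ?F. (\<Sum>t\<in>fibre s r w\<^sub>0. \<phi> (fst q, (snd q, t * m (snd q)))) =
      (\<Sum>t\<in>fibre s r (snd q). \<phi> (fst q, (snd q, t)))"
    by (simp add: eventually_at_filter)
  ultimately have "((\<lambda>q. \<Sum>t\<in>fibre s r (snd q). \<phi> (fst q, (snd q, t))) \<longlongrightarrow>
      (\<Sum>t\<in>fibre s r w\<^sub>0. \<phi> (y\<^sub>0, (w\<^sub>0, t)))) ?F"
    by (rule Lim_transform_eventually)
  then show "((\<lambda>(y, w). \<Sum>t\<in>fibre s r w. \<phi> (y, (w, t))) \<longlongrightarrow>
      (case p of (y, w) \<Rightarrow> \<Sum>t\<in>fibre s r w. \<phi> (y, (w, t)))) ?F"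
    by (simp add: case_prod_unfold p_eq)
qed

section \<open>Closed braids in the three-sphere\<close>
text \<open>The complement of the circle \<open>v = 0\<close> in the unit sphere is an open solid torus, with coordinates \<open>u\<close> in the open
disc and \<open>w = v / |v|\<close>.\<close>
definition sphere_point :: "complex \<Rightarrow> complex \<Rightarrow> real ^ 4" where
  "sphere_point u w = real4_of u (w * of_real (sqrt (1 - (cmod u)\<^sup>2)))"

definition closed_braid :: "nat \<Rightarrow> nat \<Rightarrow> (complex \<times> complex \<Rightarrow> complex) \<Rightarrow> (real ^ 4) set" where
  "closed_braid s r c = (\<lambda>p. sphere_point (c p) (fst p)) ` torus_curve s r"

definition geometric_braid :: "nat \<Rightarrow> nat \<Rightarrow> (complex \<times> complex \<Rightarrow> complex) \<Rightarrow> bool" where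
  "geometric_braid s r c \<longleftrightarrow>
     continuous_on (torus_curve s r) c \<and>
     (\<forall>p\<in>torus_curve s r. cmod (c p) < 1) \<and>
     (\<forall>w t t'. (w, t) \<in> torus_curve s r \<longrightarrow> (w, t') \<in> torus_curve s r \<longrightarrow>
        c (w, t) = c (w, t') \<longrightarrow> t = t')"

lemma sphere_real4: "norm x = 1 \<longleftrightarrow> (cmod (u_of x))\<^sup>2 + (cmod (v_of x))\<^sup>2 = 1"
  using rho_eq_norm[of x] by (metis real_sqrt_eq_1_iff rho_def)

lemma real4_of_u_v [simp]: "real4_of (u_of x) (v_of x) = x"
  by (simp add: real4_of_def u_of_def v_of_def vec_eq_iff forall_4)

lemma continuous_on_u_of [continuous_intros]: "continuous_on A f \<Longrightarrow> continuous_on A (\<lambda>x. u_of (f x))"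
  unfolding u_of_def Complex_eq by (intro continuous_intros)

lemma continuous_on_v_of [continuous_intros]: "continuous_on A f \<Longrightarrow> continuous_on A (\<lambda>x. v_of (f x))"
  unfolding v_of_def Complex_eq by (intro continuous_intros)

lemma continuous_on_real4_of [continuous_intros]:
  assumes "continuous_on A f" "continuous_on A g"
  shows "continuous_on A (\<lambda>x. real4_of (f x) (g x))"
proof -
  have "real4_of u v = Re u *\<^sub>R axis 1 1 + Im u *\<^sub>R axis 2 1 + Re v *\<^sub>R axis 3 1 + Im v *\<^sub>R axis 4 1" for u v
    by (simp add: real4_of_def vec_eq_iff forall_4 axis_def)
  then show ?thesis using assms by (auto intro!: continuous_intros)
qed

lemma sphere_point_sphere:
  assumes "cmod u \<le> 1" "cmod w = 1 \<or> cmod u = 1" shows "sphere_point u w \<in> sphere 0 1"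
proof -
  have "(cmod u)\<^sup>2 \<le> 1" using assms by (simp add: power_le_one)
  then show ?thesis using assms
    by (auto simp: sphere_real4 sphere_point_def norm_mult power_mult_distrib)
qed

lemma sphere_point_sgn:
  assumes "x \<in> sphere 0 1" shows "sphere_point (u_of x) (sgn (v_of x)) = x"
proof -
  have "1 - (cmod (u_of x))\<^sup>2 = (cmod (v_of x))\<^sup>2" using assms by (simp add: sphere_real4)
  then have "sqrt (1 - (cmod (u_of x))\<^sup>2) = cmod (v_of x)" by simp
  then have "sgn (v_of x) * of_real (sqrt (1 - (cmod (u_of x))\<^sup>2)) = v_of x"
    by (cases "v_of x = 0") (simp_all add: sgn_div_norm scaleR_conv_of_real)
  then show ?thesis unfolding sphere_point_def by simp
qed

lemma u_of_sphere_point [simp]: "u_of (sphere_point u w) = u" by (simp add: sphere_point_def)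

lemma sgn_v_of_sphere_point:
  assumes "cmod u < 1" "cmod w = 1" shows "sgn (v_of (sphere_point u w)) = w"
proof -
  have "(cmod u)\<^sup>2 < 1" using assms by (simp add: power_less_one_iff)
  then show ?thesis using assms
    by (simp add: sphere_point_def sgn_mult sgn_of_real) (simp add: sgn_div_norm)
qed

lemma cmod_u_less_one_iff:
  assumes "x \<in> sphere 0 1" shows "cmod (u_of x) < 1 \<longleftrightarrow> v_of x \<noteq> 0" "cmod (u_of x) \<le> 1"
proof -
  have *: "(cmod (u_of x))\<^sup>2 = 1 - (cmod (v_of x))\<^sup>2" using assms by (simp add: sphere_real4)
  show "cmod (u_of x) \<le> 1" by (rule power2_le_imp_le) (use * in auto)
  have "cmod (u_of x) < 1 \<longleftrightarrow> (cmod (u_of x))\<^sup>2 < 1"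
    by (metis abs_norm_cancel abs_square_less_1)
  then show "cmod (u_of x) < 1 \<longleftrightarrow> v_of x \<noteq> 0" using * by auto
qed

lemma closed_braid_subset_sphere:
  assumes "\<And>p. p \<in> torus_curve s r \<Longrightarrow> cmod (c p) < 1"
  shows "closed_braid s r c \<subseteq> sphere 0 1"
proof
  fix x assume "x \<in> closed_braid s r c"
  then obtain p where p: "p \<in> torus_curve s r" "x = sphere_point (c p) (fst p)"
    unfolding closed_braid_def by blast
  have "cmod (fst p) = 1" using p(1) by (auto simp: torus_curve_def)
  then show "x \<in> sphere 0 1"
    unfolding p(2) using assms[OF p(1)] by (intro sphere_point_sphere) auto
qed

text \<open>Each point \<open>u\<close> over \<open>w\<close> is moved by the displacements of the strands, weighted by bump functions of
radius \<open>\<delta>\<close> around the strands. The bumps of different strands do not reach each other's centres, so the strand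
of the first braid lands on that of the second. The displacements are so small that the total has Lipschitz constant at
most one half; then the contraction principle makes each stage bijective. The bound \<open>1 - 2 * \<delta>\<close> keeps a collar of the circle \<open>v = 0\<close> fixed.\<close>
lemma ambient_isotopic_close_braids:
  assumes s: "0 < s" and c\<^sub>0: "continuous_on (torus_curve s r) c\<^sub>0"
    and c\<^sub>1: "continuous_on (torus_curve s r) c\<^sub>1"
    and \<delta>: "0 < \<delta>" and bd: "\<And>p. p \<in> torus_curve s r \<Longrightarrow> cmod (c\<^sub>0 p) \<le> 1 - 2 * \<delta>"
    and sep: "\<And>w t t'. (w, t) \<in> torus_curve s r \<Longrightarrow> (w, t') \<in> torus_curve s r \<Longrightarrow> t \<noteq> t' \<Longrightarrow>
        \<delta> \<le> cmod (c\<^sub>0 (w, t) - c\<^sub>0 (w, t'))"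
    and close: "\<And>p. p \<in> torus_curve s r \<Longrightarrow> cmod (c\<^sub>1 p - c\<^sub>0 p) \<le> \<delta> / (2 * real s)"
  shows "ambient_isotopic_in (sphere 0 1) (closed_braid s r c\<^sub>0) (closed_braid s r c\<^sub>1)"
proof -
  let ?T = "torus_curve s r" and ?S = "sphere (0 :: real ^ 4) 1"
  \<comment> \<open>bump function around a strand, total displacement at time one, and motion of the disc over \<open>w\<close>\<close>
  define \<beta> where "\<beta> = (\<lambda>u c. max 0 (1 - cmod (u - c) / \<delta>))"
  define \<psi> where "\<psi> = (\<lambda>w u. \<Sum>t\<in>fibre s r w. of_real (\<beta> u (c\<^sub>0 (w, t))) * (c\<^sub>1 (w, t) - c\<^sub>0 (w, t)))"
  define M where "M = (\<lambda>\<tau> w u. u + complex_of_real \<tau> * \<psi> w u)"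
  have T: "(w, t) \<in> ?T \<longleftrightarrow> t \<in> fibre s r w" if "cmod w = 1" for w t
    using that by (simp add: torus_curve_def)
  have \<beta>_lip: "\<bar>\<beta> u c - \<beta> u' c\<bar> \<le> cmod (u - u') / \<delta>" for u u' c
  proof -
    have "\<bar>\<beta> u c - \<beta> u' c\<bar> \<le> \<bar>cmod (u - c) / \<delta> - cmod (u' - c) / \<delta>\<bar>"
      unfolding \<beta>_def by linarith
    also have "\<dots> = \<bar>cmod (u - c) - cmod (u' - c)\<bar> / \<delta>"
      using \<delta> by (simp flip: diff_divide_distrib)
    also have "\<dots> \<le> cmod (u - u') / \<delta>"
      using \<delta> norm_triangle_ineq3[of "u - c" "u' - c"] by (intro divide_right_mono) auto
    finally show ?thesis .
  qed
  have \<beta>_01: "0 \<le> \<beta> u c" "\<beta> u c \<le> 1" for u c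
    using \<delta> by (auto simp: \<beta>_def)
  have \<psi>_lip: "cmod (\<psi> w u - \<psi> w u') \<le> cmod (u - u') / 2" if w: "cmod w = 1" for w u u'
  proof -
    have "cmod (\<psi> w u - \<psi> w u') \<le> (\<Sum>t\<in>fibre s r w.
        cmod (of_real (\<beta> u (c\<^sub>0 (w, t)) - \<beta> u' (c\<^sub>0 (w, t))) * (c\<^sub>1 (w, t) - c\<^sub>0 (w, t))))"
      unfolding \<psi>_def sum_subtractf[symmetric] left_diff_distrib[symmetric] of_real_diff[symmetric]
      by (rule norm_sum)
    also have "\<dots> \<le> (\<Sum>t\<in>fibre s r w. (cmod (u - u') / \<delta>) * (\<delta> / (2 * real s)))"
      unfolding norm_mult norm_of_real
      by (intro sum_mono mult_mono \<beta>_lip close) (use \<delta> T w in auto)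
    also have "\<dots> = cmod (u - u') / 2"
      using s \<delta> card_fibre[OF s w] by simp
    finally show ?thesis .
  qed
  have \<psi>_bd: "cmod (\<psi> w u) \<le> \<delta> / 2" if w: "cmod w = 1" for w u
  proof -
    have "cmod (\<psi> w u) \<le> (\<Sum>t\<in>fibre s r w. cmod (of_real (\<beta> u (c\<^sub>0 (w, t))) * (c\<^sub>1 (w, t) - c\<^sub>0 (w, t))))"
      unfolding \<psi>_def by (rule norm_sum)
    also have "\<dots> \<le> (\<Sum>t\<in>fibre s r w. 1 * (\<delta> / (2 * real s)))"
      unfolding norm_mult norm_of_real
      by (intro sum_mono mult_mono close) (use \<delta> T w \<beta>_01 in auto)
    also have "\<dots> = \<delta> / 2" using s card_fibre[OF s w] by simp
    finally show ?thesis .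
  qed
  have \<psi>_0: "\<psi> w u = 0" if "1 - \<delta> \<le> cmod u" and w: "cmod w = 1" for w u
  proof -
    have "\<beta> u (c\<^sub>0 (w, t)) = 0" if t: "t \<in> fibre s r w" for t
    proof -
      have "cmod (c\<^sub>0 (w, t)) \<le> 1 - 2 * \<delta>" using bd t T[OF w] by blast
      moreover have "cmod u \<le> cmod (u - c\<^sub>0 (w, t)) + cmod (c\<^sub>0 (w, t))"
        by (metis diff_add_cancel norm_triangle_ineq)
      ultimately have "\<delta> \<le> cmod (u - c\<^sub>0 (w, t))" using \<open>1 - \<delta> \<le> cmod u\<close> by linarith
      then show ?thesis using \<delta> by (simp add: \<beta>_def)
    qed
    then show ?thesis by (simp add: \<psi>_def)
  qed
  have \<psi>_c\<^sub>0: "\<psi> w (c\<^sub>0 (w, t)) = c\<^sub>1 (w, t) - c\<^sub>0 (w, t)" if p: "(w, t) \<in> ?T" for w t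
  proof -
    have w: "cmod w = 1" and t: "t \<in> fibre s r w" using p by (auto simp: torus_curve_def)
    have "\<beta> (c\<^sub>0 (w, t)) (c\<^sub>0 (w, t')) = (if t' = t then 1 else 0)" if t': "t' \<in> fibre s r w" for t'
      using sep[of w t t'] t t' T[OF w] \<delta> by (auto simp: \<beta>_def)
    then have "\<psi> w (c\<^sub>0 (w, t)) =
        (\<Sum>t'\<in>fibre s r w. if t' = t then c\<^sub>1 (w, t') - c\<^sub>0 (w, t') else 0)"
      unfolding \<psi>_def by (intro sum.cong) auto
    then show ?thesis using t finite_fibre[OF s] by simp
  qed
  have M_less: "cmod (M \<tau> w u) < 1" if "cmod u < 1" "cmod w = 1" "\<tau> \<in> {0..1}" for \<tau> w u
  proof (cases "1 - \<delta> \<le> cmod u")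
    case True
    then show ?thesis using \<psi>_0[OF True] that by (simp add: M_def)
  next
    case False
    have "cmod (M \<tau> w u) \<le> cmod u + \<bar>\<tau>\<bar> * cmod (\<psi> w u)"
      unfolding M_def by (metis norm_mult norm_of_real norm_triangle_ineq)
    also have "\<dots> \<le> cmod u + 1 * (\<delta> / 2)"
      by (intro add_left_mono mult_mono \<psi>_bd) (use that in auto)
    also have "\<dots> < 1" using False \<delta> by simp
    finally show ?thesis .
  qed
  have M_bij: "\<exists>!u. M \<tau> w u = y" if w: "cmod w = 1" and \<tau>: "\<tau> \<in> {0..1}" for \<tau> w y
  proof -
    have "\<exists>!u. y - complex_of_real \<tau> * \<psi> w u = u"
    proof (rule banach_fix_type[of "1/2"])
      show "\<forall>u u'. dist (y - complex_of_real \<tau> * \<psi> w u) (y - complex_of_real \<tau> * \<psi> w u') \<le> 1/2 * dist u u'"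
      proof (intro allI)
        fix u u'
        have "dist (y - complex_of_real \<tau> * \<psi> w u) (y - complex_of_real \<tau> * \<psi> w u') = 
            cmod (complex_of_real \<tau> * (\<psi> w u' - \<psi> w u))"
          by (simp add: dist_norm algebra_simps)
        also have "\<dots> = \<bar>\<tau>\<bar> * cmod (\<psi> w u' - \<psi> w u)" by (simp add: norm_mult)
        also have "\<dots> \<le> 1 * (cmod (u' - u) / 2)"
          by (intro mult_mono \<psi>_lip w) (use \<tau> in auto)
        finally show "dist (y - complex_of_real \<tau> * \<psi> w u) (y - complex_of_real \<tau> * \<psi> w u') \<le> 1/2 * dist u u'"
          by (simp add: dist_norm norm_minus_commute)
      qed
    qed auto
    moreover have "y - complex_of_real \<tau> * \<psi> w u = u \<longleftrightarrow> M \<tau> w u = y" for u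
      by (auto simp: M_def algebra_simps)
    ultimately show ?thesis by simp
  qed
  define H where "H = (\<lambda>(\<tau>, x). if v_of x = 0 then x else sphere_point (M \<tau> (sgn (v_of x)) (u_of x)) (sgn (v_of x)))"
  have H_far: "H (\<tau>, x) = x" if "x \<in> ?S" "1 - \<delta> \<le> cmod (u_of x)" for \<tau> x
  proof (cases "v_of x = 0")
    case False
    then have "\<psi> (sgn (v_of x)) (u_of x) = 0" using \<psi>_0 that by (simp add: norm_sgn)
    then show ?thesis using that sphere_point_sgn[of x] by (simp add: H_def M_def)
  qed (simp add: H_def)
  have H_sphere_point: "H (\<tau>, sphere_point u w) = sphere_point (M \<tau> w u) w" if "cmod u < 1" "cmod w = 1" for \<tau> u w
  proof -
    have "v_of (sphere_point u w) \<noteq> 0" 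
      using sgn_v_of_sphere_point[OF that] that by (metis norm_zero sgn_zero zero_neq_one)
    then show ?thesis using sgn_v_of_sphere_point[OF that] by (simp add: H_def)
  qed
  have M_1: "cmod u < 1" if "cmod (M \<tau> w u) < 1" "cmod w = 1" for \<tau> w u
  proof (rule ccontr)
    assume "\<not> cmod u < 1"
    then show False using \<psi>_0[of u w] \<delta> that by (auto simp: M_def)
  qed
  have H_S: "H (\<tau>, x) \<in> ?S" if \<tau>: "\<tau> \<in> {0..1}" and x: "x \<in> ?S" for \<tau> x
  proof (cases "v_of x = 0")
    case False
    then have "cmod (M \<tau> (sgn (v_of x)) (u_of x)) < 1"
      using M_less \<tau> cmod_u_less_one_iff[OF x] by (simp add: norm_sgn)
    then have "sphere_point (M \<tau> (sgn (v_of x)) (u_of x)) (sgn (v_of x)) \<in> ?S"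
      using False by (intro sphere_point_sphere) (auto simp: norm_sgn)
    then show ?thesis using False by (simp add: H_def)
  qed (use x in \<open>simp add: H_def\<close>)
  have cont: "continuous_on ({0..1} \<times> ?S) H"
  proof -
    \<comment> \<open>away from \<open>v = 0\<close> the formula is continuous, and near \<open>v = 0\<close> the motion is the identity\<close>
    let ?A = "{0..1::real} \<times> {x \<in> ?S. v_of x \<noteq> 0}"
    let ?B = "{0..1::real} \<times> {x \<in> ?S. 1 - \<delta> < cmod (u_of x)}"
    have AB: "{0..1} \<times> ?S = ?A \<union> ?B"
      using \<delta> by (auto simp: sphere_real4)
        (smt (verit) norm_ge_zero norm_zero one_power2 power2_eq_imp_eq power_zero_numeral)
    have "continuous_on ?A H"
    proof -
      have "continuous_on (UNIV \<times> torus_curve s r) (\<lambda>(y, p).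
          of_real (\<beta> y (c\<^sub>0 p)) * (c\<^sub>1 p - c\<^sub>0 p))"
      proof -
        have "continuous_on (UNIV \<times> torus_curve s r) (\<lambda>x. c\<^sub>0 (snd x))"
          "continuous_on (UNIV \<times> torus_curve s r) (\<lambda>x. c\<^sub>1 (snd x))"
          by (rule continuous_on_compose2[OF c\<^sub>0] continuous_on_compose2[OF c\<^sub>1]; auto intro: continuous_intros)+
        then show ?thesis
          unfolding case_prod_unfold \<beta>_def using \<delta> by (intro continuous_intros) auto
      qed
      from continuous_on_fibre_sum[OF s this]
      have "continuous_on (UNIV \<times> sphere 0 1) (\<lambda>q. \<psi> (snd q) (fst q))"
        by (simp add: \<psi>_def case_prod_unfold)
      moreover have "continuous_on ?A (\<lambda>q. (u_of (snd q), sgn (v_of (snd q))))"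
        by (intro continuous_intros) auto
      moreover have "(\<lambda>q. (u_of (snd q), sgn (v_of (snd q)))) ` ?A \<subseteq> UNIV \<times> sphere 0 1"
        by (auto simp: norm_sgn)
      ultimately have "continuous_on ?A ((\<lambda>q. \<psi> (snd q) (fst q)) \<circ> (\<lambda>q. (u_of (snd q), sgn (v_of (snd q)))))"
        by (intro continuous_on_compose) (auto elim: continuous_on_subset)
      then have \<psi>: "continuous_on ?A (\<lambda>q. \<psi> (sgn (v_of (snd q))) (u_of (snd q)))"
        by (simp add: o_def)
      have "continuous_on ?A (\<lambda>q. sphere_point (M (fst q) (sgn (v_of (snd q))) (u_of (snd q))) (sgn (v_of (snd q))))"
        unfolding sphere_point_def M_def by (intro continuous_intros \<psi>) auto
      then show ?thesis by (rule continuous_on_eq) (auto simp: H_def)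
    qed
    moreover have "continuous_on ?B H"
      by (rule continuous_on_eq[of _ snd]) (use H_far in \<open>auto intro: continuous_intros simp del: mem_sphere\<close>)
    moreover have "openin (top_of_set ({0..1} \<times> ?S)) ?A"
    proof -
      have "openin (top_of_set ({0..1::real} \<times> ?S)) (({0..1} \<times> ?S) \<inter> (\<lambda>q. v_of (snd q)) -` (- {0}))"
        by (auto intro!: continuous_openin_preimage_gen continuous_intros)
      also have "({0..1} \<times> ?S) \<inter> (\<lambda>q. v_of (snd q)) -` (- {0}) = ?A" by auto
      finally show ?thesis .
    qed
    moreover have "openin (top_of_set ({0..1} \<times> ?S)) ?B"
    proof -
      have "openin (top_of_set ({0..1::real} \<times> ?S)) (({0..1} \<times> ?S) \<inter> (\<lambda>q. cmod (u_of (snd q))) -` {1 - \<delta><..})"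
        by (auto intro!: continuous_openin_preimage_gen continuous_intros)
      also have "({0..1} \<times> ?S) \<inter> (\<lambda>q. cmod (u_of (snd q))) -` {1 - \<delta><..} = ?B" by auto
      finally show ?thesis .
    qed
    ultimately show ?thesis
      using continuous_on_Un_local_open[of ?A ?B H] unfolding AB by blast
  qed
  have hom: "\<exists>g. homeomorphism ?S ?S (\<lambda>x. H (\<tau>, x)) g" if \<tau>: "\<tau> \<in> {0..1}" for \<tau>
  proof (rule homeomorphism_compact)
    show "continuous_on ?S (\<lambda>x. H (\<tau>, x))"
    proof (rule continuous_on_compose2[OF cont, of ?S "\<lambda>x. (\<tau>, x)"])
      show "continuous_on ?S (\<lambda>x. (\<tau>, x))" by (intro continuous_intros)
    qed (use \<tau> in auto)
    have inj: "x = y" if x: "x \<in> ?S" and y: "y \<in> ?S" and eq: "H (\<tau>, x) = H (\<tau>, y)" for x y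
    proof -
      have small: "v_of (H (\<tau>, z)) \<noteq> 0 \<and> sgn (v_of (H (\<tau>, z))) = sgn (v_of z) \<and>
          u_of (H (\<tau>, z)) = M \<tau> (sgn (v_of z)) (u_of z)"
        if z: "z \<in> ?S" "v_of z \<noteq> 0" for z
      proof -
        have 1: "cmod (u_of z) < 1" "cmod (sgn (v_of z)) = 1"
          using z cmod_u_less_one_iff by (auto simp: norm_sgn)
        have "H (\<tau>, z) = sphere_point (M \<tau> (sgn (v_of z)) (u_of z)) (sgn (v_of z))"
          using z by (simp add: H_def)
        then show ?thesis using sgn_v_of_sphere_point[OF M_less[OF 1 \<tau>] 1(2)] z
          by (metis sgn_zero_iff u_of_sphere_point)
      qed
      show ?thesis
      proof (cases "v_of x = 0 \<or> v_of y = 0")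
        case True
        then show ?thesis using small[OF x] small[OF y] eq by (auto simp: H_def split: if_splits)
      next
        case False
        then have w: "sgn (v_of x) = sgn (v_of y)" and "M \<tau> (sgn (v_of x)) (u_of x) = M \<tau> (sgn (v_of y)) (u_of y)"
          using small[OF x] small[OF y] eq by auto
        then have "u_of x = u_of y"
          using M_bij[of "sgn (v_of x)" \<tau> "M \<tau> (sgn (v_of x)) (u_of x)"] False \<tau> by (auto simp: norm_sgn)
        then show ?thesis using w sphere_point_sgn[OF x] sphere_point_sgn[OF y] by metis
      qed
    qed
    then show "inj_on (\<lambda>x. H (\<tau>, x)) ?S" by (rule inj_onI)
    have "y \<in> (\<lambda>x. H (\<tau>, x)) ` ?S" if y: "y \<in> ?S" for y
    proof (cases "v_of y = 0")
      case True
      then have "H (\<tau>, y) = y" by (simp add: H_def)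
      then show ?thesis using y by (metis imageI)
    next
      case False
      then have w: "cmod (sgn (v_of y)) = 1" by (simp add: norm_sgn)
      obtain u where u: "M \<tau> (sgn (v_of y)) u = u_of y" using M_bij[OF w \<tau>] by metis
      have "cmod u < 1" using M_1[of \<tau> _ u] u w False cmod_u_less_one_iff[OF y] by metis
      then have "H (\<tau>, sphere_point u (sgn (v_of y))) = y" "sphere_point u (sgn (v_of y)) \<in> ?S"
        using H_sphere_point[OF _ w] sphere_point_sgn[OF y] u w sphere_point_sphere[of u "sgn (v_of y)"] by auto
      then show ?thesis by (metis imageI)
    qed
    then show "(\<lambda>x. H (\<tau>, x)) ` ?S = ?S" using H_S[OF \<tau>] by blast
  qed simp
  have c\<^sub>0_less: "cmod (c\<^sub>0 p) < 1" "cmod (fst p) = 1" if "p \<in> ?T" for p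
    using bd[OF that] \<delta> that by (auto simp: torus_curve_def)
  have M_c\<^sub>0: "M 1 (fst p) (c\<^sub>0 p) = c\<^sub>1 p" if "p \<in> ?T" for p
    using \<psi>_c\<^sub>0[of "fst p" "snd p"] that by (simp add: M_def)
  have c\<^sub>1_less: "cmod (c\<^sub>1 p) < 1" if "p \<in> ?T" for p
    using M_less[of "c\<^sub>0 p" "fst p" 1] M_c\<^sub>0 c\<^sub>0_less that by auto
  have "(\<lambda>x. H (1, x)) ` closed_braid s r c\<^sub>0 = closed_braid s r c\<^sub>1"
    unfolding closed_braid_def image_image
    by (intro image_cong refl) (simp add: H_sphere_point c\<^sub>0_less M_c\<^sub>0)
  moreover have "H (0, x) = x" if "x \<in> ?S" for x
    using sphere_point_sgn[OF that] by (simp add: H_def M_def)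
  moreover have "closed_braid s r c\<^sub>0 \<subseteq> ?S"
    by (rule closed_braid_subset_sphere[OF c\<^sub>0_less(1)])
  moreover have "closed_braid s r c\<^sub>1 \<subseteq> ?S"
    by (rule closed_braid_subset_sphere[OF c\<^sub>1_less])
  ultimately show ?thesis
    unfolding ambient_isotopic_in_def using cont hom by blast
qed

section \<open>Paths of braids\<close>
text \<open>The quotient of two points of a fibre is an \<open>s\<close>-th root of unity, and only finitely many of these exist. This turns
the inequality \<open>t \<noteq> t'\<close> into a closed condition, which the compactness argument below needs.\<close>
lemma fibre_separated:
  assumes s: "0 < s"
  obtains \<eta> where "0 < \<eta>"
    "\<And>w t t'. (w, t) \<in> torus_curve s r \<Longrightarrow> (w, t') \<in> torus_curve s r \<Longrightarrow> t \<noteq> t' \<Longrightarrow> \<eta> \<le> cmod (t - t')"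
proof -
  define A where "A = insert 1 ((\<lambda>z. cmod (z - 1)) ` ({z::complex. z ^ s = 1} - {1}))"
  have fin: "finite A" "A \<noteq> {}" unfolding A_def using s by auto
  show ?thesis
  proof
    show "0 < Min A" using fin by (subst Min_gr_iff) (auto simp: A_def)
    fix w t t' assume *: "(w, t) \<in> torus_curve s r" "(w, t') \<in> torus_curve s r" "t \<noteq> t'"
    then have t: "cmod t = 1" "cmod t' = 1" "t ^ s = t' ^ s" by (auto simp: torus_curve_def fibre_def)
    then have t'0: "t' \<noteq> 0" by auto
    then have "t / t' \<in> {z. z ^ s = 1} - {1}" using t * by (auto simp: power_divide)
    then have "cmod (t / t' - 1) \<in> A" by (auto simp: A_def)
    then have "Min A \<le> cmod (t / t' - 1)" using fin by simp
    also have "t / t' - 1 = (t - t') / t'" using t'0 by (simp add: field_simps)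
    finally show "Min A \<le> cmod (t - t')" using t by (simp add: norm_divide)
  qed
qed

lemma strands_separated:
  fixes c :: "complex \<times> complex \<Rightarrow> complex"
  assumes s: "0 < s" and cont: "continuous_on (torus_curve s r) c"
    and inj: "\<And>w t t'. (w, t) \<in> torus_curve s r \<Longrightarrow> (w, t') \<in> torus_curve s r \<Longrightarrow>
      c (w, t) = c (w, t') \<Longrightarrow> t = t'"
  obtains d where "0 < d"
    "\<And>w t t'. (w, t) \<in> torus_curve s r \<Longrightarrow> (w, t') \<in> torus_curve s r \<Longrightarrow> t \<noteq> t' \<Longrightarrow>
        d \<le> cmod (c (w, t) - c (w, t'))"
proof -
  let ?T = "torus_curve s r"
  obtain \<eta> where \<eta>: "0 < \<eta>" "\<And>w t t'. (w, t) \<in> ?T \<Longrightarrow> (w, t') \<in> ?T \<Longrightarrow> t \<noteq> t' \<Longrightarrow> \<eta> \<le> cmod (t - t')"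
    using fibre_separated[OF s] by metis
  define Q where "Q = (?T \<times> ?T) \<inter> {q. fst (fst q) = fst (snd q) \<and> \<eta> \<le> cmod (snd (fst q) - snd (snd q))}"
  have "closed {q::(complex \<times> complex) \<times> complex \<times> complex.
      fst (fst q) = fst (snd q) \<and> \<eta> \<le> cmod (snd (fst q) - snd (snd q))}"
    by (intro closed_Collect_conj closed_Collect_eq closed_Collect_le continuous_intros)
  then have "compact Q" unfolding Q_def
    by (intro compact_Int_closed compact_Times compact_torus_curve)
  moreover have "continuous_on Q (\<lambda>q. cmod (c (fst q) - c (snd q)))"
    by (intro continuous_intros continuous_on_compose2[OF cont]) (auto simp: Q_def)
  ultimately have "\<exists>d>0. \<forall>q\<in>Q. d \<le> cmod (c (fst q) - c (snd q))"
  proof (cases "Q = {}")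
    case True then show ?thesis by (intro exI[of _ 1]) auto
  next
    case False
    assume "compact Q" "continuous_on Q (\<lambda>q. cmod (c (fst q) - c (snd q)))"
    from continuous_attains_inf[OF this(1) False this(2)] obtain q where
      q: "q \<in> Q" "\<And>q'. q' \<in> Q \<Longrightarrow> cmod (c (fst q) - c (snd q)) \<le> cmod (c (fst q') - c (snd q'))" by blast
    obtain w t t' where q_eq: "q = ((w, t), (w, t'))" "(w, t) \<in> ?T" "(w, t') \<in> ?T" "\<eta> \<le> cmod (t - t')"
      using q(1) by (auto simp: Q_def)
    then have "c (w, t) \<noteq> c (w, t')" using inj[of w t t'] \<eta>(1) by auto
    then show ?thesis using q(2) q_eq by (intro exI[of _ "cmod (c (fst q) - c (snd q))"]) auto
  qed
  then obtain d where d: "0 < d" "\<And>q. q \<in> Q \<Longrightarrow> d \<le> cmod (c (fst q) - c (snd q))" by auto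
  show ?thesis
  proof
    show "d \<le> cmod (c (w, t) - c (w, t'))"
      if "(w, t) \<in> ?T" "(w, t') \<in> ?T" "t \<noteq> t'" for w t t'
      using d(2)[of "((w, t), (w, t'))"] \<eta>(2)[OF that] that by (auto simp: Q_def)
  qed fact
qed

lemma geometric_braid_separated:
  assumes s: "0 < s" and c: "geometric_braid s r c"
  obtains \<delta> where "0 < \<delta>" "\<And>p. p \<in> torus_curve s r \<Longrightarrow> cmod (c p) \<le> 1 - 2 * \<delta>"
    "\<And>w t t'. (w, t) \<in> torus_curve s r \<Longrightarrow> (w, t') \<in> torus_curve s r \<Longrightarrow> t \<noteq> t' \<Longrightarrow>
        \<delta> \<le> cmod (c (w, t) - c (w, t'))"
proof -
  let ?T = "torus_curve s r"
  have cont: "continuous_on ?T c" and less: "\<And>p. p \<in> ?T \<Longrightarrow> cmod (c p) < 1"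
    and inj: "\<And>w t t'. (w, t) \<in> ?T \<Longrightarrow> (w, t') \<in> ?T \<Longrightarrow> c (w, t) = c (w, t') \<Longrightarrow> t = t'"
    using c by (auto simp: geometric_braid_def)
  have "(1, 1) \<in> ?T" by (simp add: torus_curve_def fibre_def)
  then have ne: "?T \<noteq> {}" by auto
  obtain p\<^sub>0 where p\<^sub>0: "p\<^sub>0 \<in> ?T" "\<And>p. p \<in> ?T \<Longrightarrow> cmod (c p) \<le> cmod (c p\<^sub>0)"
    using continuous_attains_sup[OF compact_torus_curve ne continuous_on_norm[OF cont]] by auto
  obtain d where d: "0 < d"
    "\<And>w t t'. (w, t) \<in> ?T \<Longrightarrow> (w, t') \<in> ?T \<Longrightarrow> t \<noteq> t' \<Longrightarrow> d \<le> cmod (c (w, t) - c (w, t'))"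
    by (rule strands_separated[OF s cont]) (use inj in blast)+
  define \<delta> where "\<delta> = min d ((1 - cmod (c p\<^sub>0)) / 2)"
  have \<delta>: "\<delta> \<le> d" "2 * \<delta> \<le> 1 - cmod (c p\<^sub>0)" by (auto simp: \<delta>_def min_def)
  show ?thesis
  proof
    show "0 < \<delta>" using d(1) less[OF p\<^sub>0(1)] by (simp add: \<delta>_def)
    show "cmod (c p) \<le> 1 - 2 * \<delta>" if "p \<in> ?T" for p
      using p\<^sub>0(2)[OF that] \<delta> by linarith
    show "\<delta> \<le> cmod (c (w, t) - c (w, t'))"
      if "(w, t) \<in> ?T" "(w, t') \<in> ?T" "t \<noteq> t'" for w t t'
      using d(2)[OF that] \<delta> by linarith
  qed
qed

text \<open>Isotopy of the closed braids at two times is an equivalence relation on the parameter interval, and its classes are open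
by uniform continuity of the path and \<open>ambient_isotopic_close_braids\<close>; the interval is connected.\<close>
lemma ambient_isotopic_braid_path:
  assumes s: "0 < s" and cont: "continuous_on ({0..1} \<times> torus_curve s r) (\<lambda>(\<tau>, p). c \<tau> p)"
    and braid: "\<And>\<tau>. \<tau> \<in> {0..1} \<Longrightarrow> geometric_braid s r (c \<tau>)"
  shows "ambient_isotopic_in (sphere 0 1) (closed_braid s r (c (0::real))) (closed_braid s r (c 1))"
proof -
  let ?T = "torus_curve s r"
  have unif: "uniformly_continuous_on ({0..1} \<times> ?T) (\<lambda>(\<tau>, p). c \<tau> p)"
    by (intro compact_uniformly_continuous cont compact_Times compact_torus_curve) auto
  show ?thesis
  proof (rule connected_equivalence_relation[where S = "{0..1}" and
        R = "\<lambda>\<tau> \<sigma>. ambient_isotopic_in (sphere 0 1) (closed_braid s r (c \<tau>)) (closed_braid s r (c \<sigma>))"])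
    fix \<tau> :: real assume \<tau>: "\<tau> \<in> {0..1}"
    obtain \<delta> where \<delta>: "0 < \<delta>" "\<And>p. p \<in> ?T \<Longrightarrow> cmod (c \<tau> p) \<le> 1 - 2 * \<delta>"
      "\<And>w t t'. (w, t) \<in> ?T \<Longrightarrow> (w, t') \<in> ?T \<Longrightarrow> t \<noteq> t' \<Longrightarrow> \<delta> \<le> cmod (c \<tau> (w, t) - c \<tau> (w, t'))"
      using geometric_braid_separated[OF s braid[OF \<tau>]] by metis
    have "0 < \<delta> / (2 * real s)" using \<delta>(1) s by simp
    then obtain d where d: "0 < d" "\<And>x y. x \<in> {0..1} \<times> ?T \<Longrightarrow> y \<in> {0..1} \<times> ?T \<Longrightarrow> dist y x < d \<Longrightarrow>
        dist ((\<lambda>(\<tau>, p). c \<tau> p) y) ((\<lambda>(\<tau>, p). c \<tau> p) x) < \<delta> / (2 * real s)"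
      using unif unfolding uniformly_continuous_on_def by meson
    show "\<exists>U. openin (top_of_set {0..1}) U \<and> \<tau> \<in> U \<and>
      (\<forall>\<sigma>\<in>U. ambient_isotopic_in (sphere 0 1) (closed_braid s r (c \<tau>)) (closed_braid s r (c \<sigma>)))"
    proof (intro exI[of _ "{0..1} \<inter> ball \<tau> d"] conjI ballI)
      fix \<sigma> assume \<sigma>: "\<sigma> \<in> {0..1} \<inter> ball \<tau> d"
      show "ambient_isotopic_in (sphere 0 1) (closed_braid s r (c \<tau>)) (closed_braid s r (c \<sigma>))"
      proof (rule ambient_isotopic_close_braids[where c\<^sub>0 = "c \<tau>" and c\<^sub>1 = "c \<sigma>" and \<delta> = \<delta>, OF s _ _ \<delta>])
        show "continuous_on ?T (c \<tau>)" "continuous_on ?T (c \<sigma>)"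
          using braid[OF \<tau>] braid[of \<sigma>] \<sigma> by (auto simp: geometric_braid_def)
        show "cmod (c \<sigma> p - c \<tau> p) \<le> \<delta> / (2 * real s)" if "p \<in> ?T" for p
          using d(2)[of "(\<tau>, p)" "(\<sigma>, p)"] \<tau> \<sigma> that
          by (auto simp: dist_Pair_Pair dist_commute dist_norm[of "c \<sigma> p"])
      qed
    qed (use \<tau> d(1) in auto)
  qed (use ambient_isotopic_in_sym ambient_isotopic_in_trans in \<open>blast | simp\<close>)+
qed

section \<open>Closed braids are links\<close>
lemma coprime_roots_of_unity:
  fixes z :: complex
  assumes "coprime m n" "z ^ m = 1" "z ^ n = 1" "m \<noteq> 0"
  shows "z = 1"
proof -
  have z0: "z \<noteq> 0" using assms by (metis power_0_left zero_neq_one)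
  obtain x y where xy: "x * int m + y * int n = 1"
    using bezout_int[of "int m" "int n"] assms(1) by (metis coprime_imp_gcd_eq_1 coprime_int_iff)
  have "z powi (int m * x + int n * y) = (z powi int m) powi x * (z powi int n) powi y"
    using z0 by (simp add: power_int_add power_int_mult)
  then show ?thesis using xy assms by (simp add: mult.commute)
qed

text \<open>With \<open>g = gcd s r\<close> the equation \<open>t\<^sup>s = w\<^sup>r\<close> says that \<open>t ^ (s div g) / w ^ (r div g)\<close> is a \<open>g\<close>-th root of unity.
Each value of this root gives one component, parametrised by a single \<open>z\<close> on the unit circle; Bezout
coefficients of the coprime exponents recover \<open>z\<close> from \<open>(w, t)\<close>.\<close>
lemma is_link_closed_braid:
  assumes s: "0 < s" and c: "geometric_braid s r c"
  shows "is_link (closed_braid s r c)"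
proof -
  let ?T = "torus_curve s r"
  define E where "E = (\<lambda>p. sphere_point (c p) (fst p))"
  define g s' r' where "g = gcd s r" and "s' = s div g" and "r' = r div g"
  define \<kappa> where "\<kappa> = (\<lambda>m. cis (2 * pi * real m / real s))"
  define curve where "curve = (\<lambda>m z. (z ^ s', \<kappa> m * z ^ r'))"
  have g: "0 < g" and s': "s = g * s'" and r': "r = g * r'"
    using s by (auto simp: g_def s'_def r'_def)
  have s'0: "0 < s'" using s s' by (cases s') auto
  have cop: "coprime s' r'" unfolding s'_def r'_def g_def using s by (intro div_gcd_coprime) auto
  have \<kappa>1: "cmod (\<kappa> m) = 1" "\<kappa> m \<noteq> 0" for m by (auto simp: \<kappa>_def)
  have \<kappa>s: "\<kappa> m ^ s = 1" for m
    using s cis_multiple_2pi[of "real m"] by (simp add: \<kappa>_def Complex.DeMoivre mult.commute)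
  have \<kappa>s': "\<kappa> m ^ s' = cis (2 * pi * real m / real g)" for m
    using s'0 g by (simp add: \<kappa>_def Complex.DeMoivre s')
  have curve_T: "curve m z \<in> ?T" if z: "cmod z = 1" for m z
  proof -
    have "(\<kappa> m * z ^ r') ^ s = (z ^ s') ^ r"
      using \<kappa>s[of m] by (simp add: power_mult_distrib s' r' ac_simps flip: power_mult)
    then show ?thesis using z \<kappa>1 by (simp add: curve_def torus_curve_def fibre_def norm_mult norm_power)
  qed
  have curve_ratio: "snd (curve m z) ^ s' / fst (curve m z) ^ r' = cis (2 * pi * real m / real g)"
    if z: "cmod z = 1" for m z
    using z \<kappa>s'[of m] by (auto simp: curve_def power_mult_distrib mult.commute simp flip: power_mult)
  have curve_inj: "inj_on (curve m) (sphere 0 1)" for m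
  proof (rule inj_onI)
    fix z z' assume z: "z \<in> sphere (0::complex) 1" "z' \<in> sphere (0::complex) 1" and eq: "curve m z = curve m z'"
    have "z' \<noteq> 0" using z by auto
    moreover have "z ^ s' = z' ^ s'" "z ^ r' = z' ^ r'" using eq \<kappa>1 by (auto simp: curve_def)
    ultimately have "(z / z') ^ s' = 1" "(z / z') ^ r' = 1" by (simp_all add: power_divide)
    then have "z / z' = 1" by (rule coprime_roots_of_unity[OF cop]) (use s'0 in simp)
    then show "z = z'" using \<open>z' \<noteq> 0\<close> by simp
  qed
  have T_eq: "?T = (\<Union>m<g. curve m ` sphere 0 1)"
  proof (intro subset_antisym subsetI)
    fix p assume "p \<in> ?T"
    then obtain w t where p: "p = (w, t)" and w: "cmod w = 1" and t: "cmod t = 1" "t ^ s = w ^ r"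
      by (auto simp: torus_curve_def fibre_def)
    have nz: "w \<noteq> 0" "t \<noteq> 0" using w t by auto
    have "(t ^ s' / w ^ r') ^ g = t ^ s / w ^ r"
      by (simp add: s' r' power_divide mult.commute flip: power_mult)
    then have "t ^ s' / w ^ r' \<in> {z. z ^ g = 1}" using t nz by simp
    then obtain m where m: "m < g" "t ^ s' / w ^ r' = cis (2 * pi * real m / real g)"
      using Complex.bij_betw_roots_unity[OF g] by (auto simp: bij_betw_def)
    obtain x y where xy: "x * int s' + y * int r' = 1"
      using bezout_int[of "int s'" "int r'"] cop by (metis coprime_imp_gcd_eq_1 coprime_int_iff)
    define t' where "t' = t / \<kappa> m"
    have t': "t' ^ s' = w ^ r'" "t' \<noteq> 0" "cmod t' = 1"
      using m(2) nz \<kappa>1 \<kappa>s'[of m] t by (auto simp: t'_def power_divide norm_divide field_simps)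
    define z where "z = w powi x * t' powi y"
    have "cmod z = 1" using w t' by (simp add: z_def norm_mult norm_power_int)
    have powi: "(a powi k) ^ n = a powi (k * int n)" "(a powi k) ^ n = (a ^ n) powi k" for a :: complex and k n
      using power_int_mult[of a k "int n"] power_int_mult[of a "int n" k] by (simp_all add: mult.commute)
    have "z ^ s' = w powi (x * int s') * (w ^ r') powi y"
      using t'(1) powi(1)[of w x s'] powi(2)[of t' y s'] by (simp add: z_def power_mult_distrib)
    also have "\<dots> = w powi (x * int s' + y * int r')"
      using nz powi[of w y r'] by (simp add: power_int_add)
    finally have "z ^ s' = w" using xy by simp
    have "z ^ r' = (t' ^ s') powi x * t' powi (y * int r')"
      using t'(1) powi(2)[of w x r'] powi(1)[of t' y r'] by (simp add: z_def power_mult_distrib)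
    also have "\<dots> = t' powi (x * int s' + y * int r')"
      using t'(2) powi[of t' x s'] by (simp add: power_int_add)
    finally have "z ^ r' = t'" using xy by simp
    with \<open>z ^ s' = w\<close> have "p = curve m z" using p \<kappa>1 by (simp add: curve_def t'_def)
    then show "p \<in> (\<Union>m<g. curve m ` sphere 0 1)" using m(1) \<open>cmod z = 1\<close>
      by (intro UN_I[of m] image_eqI[of _ _ z]) auto
  qed (use curve_T in auto)
  have contE: "continuous_on ?T E" and injE: "inj_on E ?T"
  proof -
    have "continuous_on ?T c" using c by (simp add: geometric_braid_def)
    then show "continuous_on ?T E"
      unfolding E_def sphere_point_def by (auto intro!: continuous_intros)
    show "inj_on E ?T"
    proof (rule inj_onI)
      fix p q assume p: "p \<in> ?T" and q: "q \<in> ?T" and eq: "E p = E q"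
      have 1: "cmod (c p) < 1" "cmod (c q) < 1" "cmod (fst p) = 1" "cmod (fst q) = 1"
        using p q c by (auto simp: geometric_braid_def torus_curve_def)
      have "c p = c q" using eq by (metis E_def u_of_sphere_point)
      moreover have "fst p = fst q" using eq 1 by (metis E_def sgn_v_of_sphere_point)
      ultimately have "snd p = snd q"
        using c p q unfolding geometric_braid_def by (metis prod.collapse)
      then show "p = q" using \<open>fst p = fst q\<close> by (simp add: prod_eq_iff)
    qed
  qed
  define \<C> where "\<C> = (\<lambda>m. E ` curve m ` sphere 0 1) ` {..<g}"
  have "pairwise disjnt \<C>"
  proof (rule pairwiseI)
    fix C D assume "C \<in> \<C>" "D \<in> \<C>" "C \<noteq> D"
    then obtain m n where mn: "m < g" "n < g" "m \<noteq> n" and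
      CD: "C = E ` curve m ` sphere 0 1" "D = E ` curve n ` sphere 0 1" by (auto simp: \<C>_def)
    have "curve m z \<noteq> curve n z'" if "cmod z = 1" "cmod z' = 1" for z z'
    proof
      assume "curve m z = curve n z'"
      then have "cis (2 * pi * real m / real g) = cis (2 * pi * real n / real g)"
        using curve_ratio[OF that(1), of m] curve_ratio[OF that(2), of n] by simp
      then show False using Complex.bij_betw_roots_unity[OF g] mn by (auto simp: bij_betw_def inj_on_def)
    qed
    then have "E (curve m z) \<noteq> E (curve n z')" if "cmod z = 1" "cmod z' = 1" for z z'
      using injE curve_T that by (metis inj_onD)
    then show "disjnt C D" unfolding CD disjnt_def by auto
  qed
  moreover have "C homeomorphic sphere (0 :: complex) 1" if "C \<in> \<C>" for C
  proof -
    obtain m where C: "C = E ` curve m ` sphere 0 1" using \<open>C \<in> \<C>\<close> by (auto simp: \<C>_def)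
    have sub: "curve m ` sphere 0 1 \<subseteq> ?T" using curve_T by auto
    have "sphere (0::complex) 1 homeomorphic C"
    proof (rule homeomorphic_compact)
      have "continuous_on (sphere 0 1) (curve m)" unfolding curve_def by (intro continuous_intros)
      then show "continuous_on (sphere 0 1) (E \<circ> curve m)"
        using sub contE by (intro continuous_on_compose) (auto intro: continuous_on_subset)
      show "inj_on (E \<circ> curve m) (sphere 0 1)"
        using curve_inj inj_on_subset[OF injE sub] by (rule comp_inj_on)
    qed (auto simp: C image_image)
    then show ?thesis by (rule homeomorphic_sym[THEN iffD1])
  qed
  moreover have "closed_braid s r c = \<Union>\<C>"
    unfolding closed_braid_def E_def[symmetric] T_eq \<C>_def by auto
  moreover have "finite \<C>" "\<C> \<noteq> {}" using g by (auto simp: \<C>_def)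
  ultimately show ?thesis unfolding is_link_def by blast
qed

section \<open>The lemniscate link as a closed braid\<close>
text \<open>Each \<open>Z\<^sub>j\<close> is this function of its own \<open>t\<close>; it traces the Lissajous figure with frequencies 1 and \<open>l\<close>.\<close>
definition lissajous :: "nat \<Rightarrow> real \<Rightarrow> real \<Rightarrow> complex \<Rightarrow> complex" where
  "lissajous l a b t = Complex (a * Re t) (b / real l * Im (t ^ l))"

lemma Z_eq_lissajous: "Z s r l a b j h = lissajous l a b (cis ((real r * h + 2 * pi * (real j - 1)) / real s))"
  by (simp add: Z_def lissajous_def Complex.DeMoivre)

lemma bij_betw_strands:
  assumes s: "0 < s"
  shows "bij_betw (\<lambda>j. cis ((real r * h + 2 * pi * (real j - 1)) / real s)) {1..s} (fibre s r (cis h))"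
proof -
  have "bij_betw (\<lambda>j. j - 1) {1..s} {..<s}"
    by (rule bij_betwI[where g = Suc]) (use s in auto)
  from bij_betw_trans[OF this Complex.bij_betw_roots_unity[OF s]]
  have "bij_betw (\<lambda>j. cis (2 * pi * real (j - 1) / real s)) {1..s} {z. z ^ s = 1}"
    by (simp add: o_def)
  moreover have "bij_betw (\<lambda>z. cis (real r * h / real s) * z) {z. z ^ s = 1} (fibre s r (cis h))"
  proof (rule bij_betwI[where g = "\<lambda>z. z / cis (real r * h / real s)"])
    have 1: "cis (real r * h / real s) ^ s = cis h ^ r" using s by (simp add: Complex.DeMoivre)
    show "(\<lambda>z. cis (real r * h / real s) * z) \<in> {z. z ^ s = 1} \<rightarrow> fibre s r (cis h)"
    proof
      fix z :: complex assume "z \<in> {z. z ^ s = 1}"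
      then show "cis (real r * h / real s) * z \<in> fibre s r (cis h)"
        using 1 power_eq_1_iff[of z s] s by (simp add: fibre_def norm_mult power_mult_distrib)
    qed
    show "(\<lambda>z. z / cis (real r * h / real s)) \<in> fibre s r (cis h) \<rightarrow> {z. z ^ s = 1}"
      using 1 by (auto simp: fibre_def power_divide)
  qed auto
  ultimately have bij: "bij_betw ((\<lambda>z. cis (real r * h / real s) * z) \<circ> (\<lambda>j. cis (2 * pi * real (j - 1) / real s)))
      {1..s} (fibre s r (cis h))" by (rule bij_betw_trans)
  show ?thesis
  proof (rule iffD1[OF bij_betw_cong bij])
    fix j assume "j \<in> {1..s}"
    then show "((\<lambda>z. cis (real r * h / real s) * z) \<circ> (\<lambda>j. cis (2 * pi * real (j - 1) / real s))) j =
        cis ((real r * h + 2 * pi * (real j - 1)) / real s)"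
      by (simp add: cis_mult of_nat_diff add_divide_distrib)
  qed
qed

lemma torus_curve_strands:
  assumes s: "0 < s"
  shows "torus_curve s r =
    (\<Union>j\<in>{1..s}. (\<lambda>h. (cis h, cis ((real r * h + 2 * pi * (real j - 1)) / real s))) ` {0..2 * pi})"
proof (intro subset_antisym subsetI)
  fix p assume "p \<in> torus_curve s r"
  then obtain w t where p: "p = (w, t)" "cmod w = 1" "t \<in> fibre s r w" by (auto simp: torus_curve_def)
  have "w = cis (Arg2pi w)" using p(2) by (metis Arg2pi_eq cis_conv_exp complex_norm_eq_1_exp)
  moreover have "Arg2pi w \<in> {0..2 * pi}" using Arg2pi[of w] by auto
  ultimately obtain h where h: "h \<in> {0..2 * pi}" "w = cis h" by metis
  then obtain j where "j \<in> {1..s}" "t = cis ((real r * h + 2 * pi * (real j - 1)) / real s)"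
    using bij_betw_imp_surj_on[OF bij_betw_strands[OF s, of r h]] p(3) by blast
  then show "p \<in> (\<Union>j\<in>{1..s}. (\<lambda>h. (cis h, cis ((real r * h + 2 * pi * (real j - 1)) / real s))) ` {0..2 * pi})"
    unfolding p(1) h(2) using h(1) by blast
next
  fix p assume "p \<in> (\<Union>j\<in>{1..s}. (\<lambda>h. (cis h, cis ((real r * h + 2 * pi * (real j - 1)) / real s))) ` {0..2 * pi})"
  then show "p \<in> torus_curve s r"
    using bij_betw_apply[OF bij_betw_strands[OF s, of r]] by (auto simp: torus_curve_def)
qed

text \<open>Equal real parts on the circle force \<open>t' = t\<close> or \<open>t' = cnj t\<close>. In the second case equal imaginary parts make \<open>t ^ l\<close>
real, so \<open>t\<close> and \<open>t'\<close> have the same \<open>l\<close>-th power as well as the same \<open>s\<close>-th power.\<close>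
lemma lissajous_inj_on_fibre:
  assumes "0 < s" "0 < l" "coprime s l" "0 < a" "0 < b"
    and t: "t \<in> fibre s r w" and t': "t' \<in> fibre s r w"
    and eq: "lissajous l a b t = lissajous l a b t'"
  shows "t = t'"
proof -
  have 1: "cmod t = 1" "cmod t' = 1" "t ^ s = t' ^ s" using t t' by (auto simp: fibre_def)
  have Re: "Re t = Re t'" and Im: "Im (t ^ l) = Im (t' ^ l)"
    using eq assms by (auto simp: lissajous_def)
  have "(Im t)\<^sup>2 = (Im t')\<^sup>2" using 1 Re by (simp add: cmod_def)
  then consider "Im t = Im t'" | "Im t = - Im t'" by (auto simp: power2_eq_iff)
  then show ?thesis
  proof cases
    case 1 then show ?thesis using Re by (simp add: complex_eq_iff)
  next
    case 2
    then have cnj: "t' = cnj t" using Re by (simp add: complex_eq_iff)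
    then have "Im (t ^ l) = 0" using Im by (simp flip: complex_cnj_power)
    then have "cnj (t ^ l) = t ^ l" by (simp only: complex_eq_iff cnj.sel minus_zero simp_thms)
    then have "t ^ l = t' ^ l" unfolding cnj complex_cnj_power by simp
    moreover have "t' \<noteq> 0" using \<open>cmod t' = 1\<close> by auto
    ultimately have "(t / t') ^ s = 1" "(t / t') ^ l = 1" using \<open>t ^ s = t' ^ s\<close>
      by (simp_all add: power_divide)
    then have "t / t' = 1"
      by (rule coprime_roots_of_unity[OF \<open>coprime s l\<close>]) (use assms in simp)
    then show ?thesis using \<open>t' \<noteq> 0\<close> by simp
  qed
qed

text \<open>Inverse stereographic projection in the coordinate \<open>u\<close>, on a half-plane bounded by the axis of rotation: \<open>Re W\<close> is the
distance of a point from the axis and \<open>Im W\<close> its height.\<close>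
definition half_plane_to_disc :: "complex \<Rightarrow> complex" where
  "half_plane_to_disc W = Complex ((cmod W)\<^sup>2 - 1) (2 * Im W) / of_real ((cmod W)\<^sup>2 + 1)"

lemma half_plane_to_disc:
  assumes "0 < Re W"
  shows "1 - (cmod (half_plane_to_disc W))\<^sup>2 = (2 * Re W / ((cmod W)\<^sup>2 + 1))\<^sup>2"
    and "sqrt (1 - (cmod (half_plane_to_disc W))\<^sup>2) = 2 * Re W / ((cmod W)\<^sup>2 + 1)"
    and "cmod (half_plane_to_disc W) < 1"
proof -
  define q where "q = (cmod W)\<^sup>2"
  have q: "q = (Re W)\<^sup>2 + (Im W)\<^sup>2" by (simp add: q_def cmod_power2)
  have pos: "q + 1 > 0" by (simp add: q_def add_nonneg_pos)
  have "(cmod (half_plane_to_disc W))\<^sup>2 = (cmod (Complex (q - 1) (2 * Im W)))\<^sup>2 / (q + 1)\<^sup>2"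
    unfolding half_plane_to_disc_def q_def[symmetric] norm_divide power_divide norm_of_real power2_abs ..
  also have "\<dots> = ((q - 1)\<^sup>2 + (2 * Im W)\<^sup>2) / (q + 1)\<^sup>2" by (simp add: cmod_power2)
  also have "\<dots> = 1 - (2 * Re W / (q + 1))\<^sup>2"
  proof -
    have "(q - 1)\<^sup>2 + (2 * Im W)\<^sup>2 = (q + 1)\<^sup>2 - (2 * Re W)\<^sup>2"
      unfolding q by (simp add: power2_eq_square algebra_simps)
    then show ?thesis using pos by (simp add: diff_divide_distrib power_divide)
  qed
  finally show *: "1 - (cmod (half_plane_to_disc W))\<^sup>2 = (2 * Re W / ((cmod W)\<^sup>2 + 1))\<^sup>2"
    by (simp add: q_def)
  have pos': "0 < 2 * Re W / ((cmod W)\<^sup>2 + 1)" using pos assms by (simp add: q_def)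
  then show "sqrt (1 - (cmod (half_plane_to_disc W))\<^sup>2) = 2 * Re W / ((cmod W)\<^sup>2 + 1)"
    unfolding * by (intro real_sqrt_unique) auto
  have "0 < (2 * Re W / ((cmod W)\<^sup>2 + 1))\<^sup>2" using pos' by (rule zero_less_power)
  then have "(cmod (half_plane_to_disc W))\<^sup>2 < 1\<^sup>2" using * unfolding power_one by linarith
  then show "cmod (half_plane_to_disc W) < 1" by (rule power2_less_imp_less) simp
qed

lemma half_plane_to_disc_inj:
  assumes "0 < Re W" "0 < Re W'" "half_plane_to_disc W = half_plane_to_disc W'"
  shows "W = W'"
proof -
  define q q' where "q = (cmod W)\<^sup>2" and "q' = (cmod W')\<^sup>2"
  have pos: "q + 1 > 0" "q' + 1 > 0" by (auto simp: q_def q'_def add_nonneg_pos)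
  have "(q - 1) / (q + 1) = (q' - 1) / (q' + 1)" and Im: "Im W / (q + 1) = Im W' / (q' + 1)"
    using assms(3) unfolding half_plane_to_disc_def q_def q'_def
    by (auto simp: complex_eq_iff Re_divide_of_real Im_divide_of_real)
  then have "(q - 1) * (q' + 1) = (q' - 1) * (q + 1)" using pos by (simp add: field_simps)
  then have qq: "q = q'" by (simp add: algebra_simps)
  have "2 * Re W / (q + 1) = 2 * Re W' / (q' + 1)"
    using half_plane_to_disc(2)[OF assms(1)] half_plane_to_disc(2)[OF assms(2)] assms(3)
    by (simp add: q_def q'_def)
  then show ?thesis using Im qq pos by (auto simp: complex_eq_iff)
qed

lemma continuous_on_half_plane_to_disc [continuous_intros]:
  "continuous_on A f \<Longrightarrow> continuous_on A (\<lambda>x. half_plane_to_disc (f x))"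
proof -
  have nz: "complex_of_real ((cmod z)\<^sup>2 + 1) \<noteq> 0" for z
    unfolding of_real_eq_0_iff using add_nonneg_pos[of "(cmod z)\<^sup>2" 1] by auto
  show "continuous_on A (\<lambda>x. half_plane_to_disc (f x))" if f: "continuous_on A f"
    unfolding half_plane_to_disc_def Complex_eq by (intro continuous_intros f ballI nz)
qed

lemma inv_stereographic_half_plane:
  assumes "0 < Re W"
  shows "inv_stereographic (vector [cos h * Re W, sin h * Re W, Im W]) =
    sphere_point (half_plane_to_disc W) (cis h)"
proof -
  have "(norm (vector [cos h * Re W, sin h * Re W, Im W] :: real ^ 3))\<^sup>2 =
      (cos h * Re W)\<^sup>2 + (sin h * Re W)\<^sup>2 + (Im W)\<^sup>2"
    unfolding norm_vec_def L2_set_def by (simp add: sum_3)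
  also have "(cos h * Re W)\<^sup>2 + (sin h * Re W)\<^sup>2 = (Re W)\<^sup>2"
    by (simp add: power_mult_distrib flip: distrib_right)
  finally have "(norm (vector [cos h * Re W, sin h * Re W, Im W] :: real ^ 3))\<^sup>2 = (cmod W)\<^sup>2"
    by (simp add: cmod_power2)
  moreover have "of_real 2 * Complex (cos h * Re W) (sin h * Re W) / of_real ((cmod W)\<^sup>2 + 1)
      = cis h * of_real (2 * Re W / ((cmod W)\<^sup>2 + 1))"
    by (simp add: complex_eq_iff Re_divide_of_real Im_divide_of_real)
  ultimately show ?thesis
    unfolding sphere_point_def half_plane_to_disc(2)[OF assms] inv_stereographic_def Let_def
    by (simp only: vector_3 half_plane_to_disc_def)
qed

lemma lemniscate_link_eq_closed_braid:
  assumes "0 < s" and "admissible_radius s r l a b R"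
  shows "lemniscate_link s r l a b R =
      closed_braid s r (\<lambda>p. half_plane_to_disc (of_real R + lissajous l a b (snd p)))"
    and "\<And>p. p \<in> torus_curve s r \<Longrightarrow> 0 < R + a * Re (snd p)"
proof -
  have pos: "0 < R + Re (Z s r l a b j h)" if "j \<in> {1..s}" "h \<in> {0..2 * pi}" for j h
    using assms(2) that by (auto simp: admissible_radius_def)
  then show "\<And>p. p \<in> torus_curve s r \<Longrightarrow> 0 < R + a * Re (snd p)"
    unfolding torus_curve_strands[OF assms(1)] by (auto simp: Z_eq_lissajous lissajous_def)
  have "inv_stereographic (vector [cos h * (R + Re (Z s r l a b j h)),
      sin h * (R + Re (Z s r l a b j h)), Im (Z s r l a b j h)]) =
      sphere_point (half_plane_to_disc (of_real R + Z s r l a b j h)) (cis h)"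
    if "j \<in> {1..s}" "h \<in> {0..2 * pi}" for j h
    using inv_stereographic_half_plane[of "of_real R + Z s r l a b j h" h] pos[OF that] by simp
  then show "lemniscate_link s r l a b R =
      closed_braid s r (\<lambda>p. half_plane_to_disc (of_real R + lissajous l a b (snd p)))"
    unfolding lemniscate_link_def lemniscate_link_R3_def closed_braid_def
      torus_curve_strands[OF assms(1)] image_UN image_image
    by (intro SUP_cong image_cong refl) (simp add: Z_eq_lissajous)
qed

section \<open>Laurent polynomials on the unit circle\<close>
lemma laurent_eval_superset:
  assumes "finite A" "Poly_Mapping.keys q \<subseteq> A"
  shows "laurent_eval q w = (\<Sum>k\<in>A. Poly_Mapping.lookup q k * w powi k)"
  unfolding laurent_eval_def
  by (rule sum.mono_neutral_left) (use assms in \<open>auto simp: in_keys_iff\<close>)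

lemma laurent_eval_0 [simp]: "laurent_eval 0 w = 0"
  by (simp add: laurent_eval_def)

lemma laurent_eval_single [simp]: "laurent_eval (Poly_Mapping.single k c) w = c * w powi k"
  by (subst laurent_eval_superset[of "{k}"]) auto

lemma laurent_eval_one [simp]: "laurent_eval 1 w = 1"
  by (simp add: laurent_eval_def)

lemma laurent_eval_add: "laurent_eval (p + q) w = laurent_eval p w + laurent_eval q w"
proof -
  let ?A = "Poly_Mapping.keys p \<union> Poly_Mapping.keys q"
  have "laurent_eval x w = (\<Sum>k\<in>?A. Poly_Mapping.lookup x k * w powi k)" if "x \<in> {p, q, p + q}" for x
    using that keys_add[of p q] by (intro laurent_eval_superset) auto
  then show ?thesis by (simp add: lookup_add ring_distribs sum.distrib)
qed

text \<open>After multiplication by a large power of the variable, the difference is a polynomial with infinitely many zeros.\<close>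
lemma laurent_eval_unit_circle_inj:
  assumes eq: "\<And>h. h \<in> {0..2 * pi} \<Longrightarrow> laurent_eval p (cis h) = laurent_eval q (cis h)"
  shows "p = q"
proof -
  let ?A = "Poly_Mapping.keys p \<union> Poly_Mapping.keys q"
  have fin: "finite ?A" by simp
  obtain N where N: "\<And>k. k \<in> ?A \<Longrightarrow> nat \<bar>k\<bar> \<le> N"
    using finite_nat_set_iff_bounded_le[of "(\<lambda>k. nat \<bar>k\<bar>) ` ?A"] fin by blast
  have N': "0 \<le> k + int N" if "k \<in> ?A" for k using N[OF that] by linarith
  define d where "d = (\<lambda>k. Poly_Mapping.lookup p k - Poly_Mapping.lookup q k)"
  define D where "D = (\<Sum>k\<in>?A. Polynomial.monom (d k) (nat (k + int N)))"
  have "poly D (cis h) = 0" if "h \<in> {0..2 * pi}" for h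
  proof -
    have "poly D (cis h) = (\<Sum>k\<in>?A. d k * cis h powi k * cis h ^ N)"
      unfolding D_def poly_sum
    proof (intro sum.cong refl)
      fix k assume "k \<in> ?A"
      then have "cis h ^ nat (k + int N) = cis h powi (k + int N)"
        using N' by (simp add: power_int_def)
      then show "poly (Polynomial.monom (d k) (nat (k + int N))) (cis h) = d k * cis h powi k * cis h ^ N"
        by (simp add: poly_monom power_int_add)
    qed
    also have "\<dots> = (laurent_eval p (cis h) - laurent_eval q (cis h)) * cis h ^ N"
      unfolding laurent_eval_superset[OF fin Un_upper1] laurent_eval_superset[OF fin Un_upper2]
      by (simp add: d_def sum_distrib_right left_diff_distrib sum_subtractf)
    finally show ?thesis using eq[OF that] by simp
  qed
  then have sub: "cis ` {0..pi} \<subseteq> {z. poly D z = 0}" by auto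
  have "inj_on cis {0..pi}"
    by (rule inj_onI) (metis atLeastAtMost_iff cis.sel(1) cos_inj_pi)
  moreover have "infinite {0..pi}" using infinite_Icc[OF pi_gt_zero] .
  ultimately have "infinite (cis ` {0..pi})" by (simp add: finite_image_iff)
  then have D0: "D = 0" using sub poly_roots_finite[of D] finite_subset by blast
  have "d k = 0" for k
  proof (cases "k \<in> ?A")
    case True
    have "0 = coeff D (nat (k + int N))" using D0 by simp
    also have "\<dots> = (\<Sum>k'\<in>?A. if k' = k then d k' else 0)"
      unfolding D_def coeff_sum
    proof (intro sum.cong refl)
      fix k' assume "k' \<in> ?A"
      then show "coeff (Polynomial.monom (d k') (nat (k' + int N))) (nat (k + int N)) = (if k' = k then d k' else 0)"
        using N'[of k'] N'[OF True] by (auto simp: nat_eq_iff)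
    qed
    also have "\<dots> = d k" using True fin by simp
    finally show ?thesis by simp
  qed (auto simp: d_def in_keys_iff)
  then show ?thesis by (intro poly_mapping_eqI) (simp add: d_def)
qed

section \<open>Trigonometric polynomials and averaging\<close>
inductive trig_poly :: "(real \<Rightarrow> complex) \<Rightarrow> bool" where
  zero: "trig_poly (\<lambda>x. 0)"
| add_term: "trig_poly f \<Longrightarrow> trig_poly (\<lambda>x. c * cis (real_of_int k * x) + f x)"

lemma trig_poly_term: "trig_poly (\<lambda>x. c * cis (real_of_int k * x))"
  using trig_poly.add_term[OF trig_poly.zero] by simp

lemma trig_poly_const: "trig_poly (\<lambda>x. c)"
  using trig_poly_term[of c 0] by simp

lemma trig_poly_add: "trig_poly f \<Longrightarrow> trig_poly g \<Longrightarrow> trig_poly (\<lambda>x. f x + g x)"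
proof (induction rule: trig_poly.induct)
  case (add_term f c k)
  from trig_poly.add_term[OF add_term.IH[OF add_term.prems], of c k] show ?case by (simp add: add.assoc)
qed simp

lemma trig_poly_term_mult: "trig_poly f \<Longrightarrow> trig_poly (\<lambda>x. c * cis (real_of_int k * x) * f x)"
proof (induction rule: trig_poly.induct)
  case zero then show ?case by (simp add: trig_poly.zero)
next
  case (add_term f d m)
  have "c * cis (real_of_int k * x) * (d * cis (real_of_int m * x) + f x) =
      (c * d) * cis (real_of_int (k + m) * x) + c * cis (real_of_int k * x) * f x" for x
    by (simp add: algebra_simps flip: cis_mult)
  then show ?case using trig_poly.add_term[OF add_term.IH, of "c * d" "k + m"] by simp
qed

lemma trig_poly_mult: "trig_poly f \<Longrightarrow> trig_poly g \<Longrightarrow> trig_poly (\<lambda>x. f x * g x)"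
proof (induction rule: trig_poly.induct)
  case zero then show ?case by (simp add: trig_poly.zero)
next
  case (add_term f c k)
  have "trig_poly (\<lambda>x. c * cis (real_of_int k * x) * g x + f x * g x)"
    by (intro trig_poly_add trig_poly_term_mult add_term)
  then show ?case by (simp add: distrib_right)
qed

lemma trig_poly_lissajous: "trig_poly (\<lambda>x. lissajous l a b (cis (x + \<alpha>)))"
proof -
  let ?f = "\<lambda>x. (of_real a / 2 * cis \<alpha>) * cis (real_of_int 1 * x) +
     ((of_real a / 2 * cis (- \<alpha>)) * cis (real_of_int (-1) * x) +
     ((of_real (b / real l) / 2 * cis (real l * \<alpha>)) * cis (real_of_int (int l) * x) +
     (- of_real (b / real l) / 2 * cis (- real l * \<alpha>)) * cis (real_of_int (- int l) * x)))"
  have "lissajous l a b (cis (x + \<alpha>)) = ?f x" for x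
  proof -
    have "lissajous l a b (cis y) = of_real a / 2 * (cis y + cis (- y)) +
        of_real (b / real l) / 2 * (cis (real l * y) - cis (- (real l * y)))" for y
      by (simp add: lissajous_def Complex.DeMoivre complex_eq_iff)
    from this[of "x + \<alpha>"]
    show ?thesis by (simp add: cis_mult algebra_simps)
  qed
  moreover have "trig_poly ?f" by (intro trig_poly_add trig_poly_term)
  ultimately show ?thesis by simp
qed

lemma trig_poly_coeff_prod:
  assumes "finite A" "\<And>j. j \<in> A \<Longrightarrow> trig_poly (\<zeta> j)"
  shows "trig_poly (\<lambda>x. coeff (\<Prod>j\<in>A. [:- \<zeta> j x, 1:]) i)"
  using assms
proof (induction A arbitrary: i rule: finite_induct)
  case empty
  then show ?case by (simp add: trig_poly_const)
next
  case (insert j A)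
  have "trig_poly (\<lambda>x. (-1 * \<zeta> j x) * coeff (\<Prod>j\<in>A. [:- \<zeta> j x, 1:]) i +
      (case i of 0 \<Rightarrow> 0 | Suc n \<Rightarrow> coeff (\<Prod>j\<in>A. [:- \<zeta> j x, 1:]) n))"
  proof (intro trig_poly_add trig_poly_mult trig_poly_const)
    show "trig_poly (\<lambda>x. case i of 0 \<Rightarrow> 0 | Suc n \<Rightarrow> coeff (\<Prod>j\<in>A. [:- \<zeta> j x, 1:]) n)"
      using insert by (cases i) (simp_all add: trig_poly.zero)
  qed (use insert in auto)
  then show ?case using insert by (simp add: coeff_pCons)
qed

lemma sum_roots_of_unity:
  assumes s: "0 < s"
  shows "(\<Sum>m<s. cis (2 * pi * real m * real_of_int k / real s)) = (if int s dvd k then of_nat s else 0)"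
proof -
  define \<zeta> where "\<zeta> = cis (2 * pi * real_of_int k / real s)"
  have pow: "cis (2 * pi * real m * real_of_int k / real s) = \<zeta> ^ m" for m
    by (simp add: \<zeta>_def Complex.DeMoivre mult_ac)
  have "\<zeta> ^ s = 1" using s cis_multiple_2pi[of "real_of_int k"] by (simp add: \<zeta>_def Complex.DeMoivre mult_ac)
  moreover have "\<zeta> = 1 \<longleftrightarrow> int s dvd k"
  proof
    assume "\<zeta> = 1"
    then have "cos (2 * pi * real_of_int k / real s) = 1" by (simp add: \<zeta>_def complex_eq_iff)
    then obtain n where "2 * pi * real_of_int k / real s = real_of_int n * 2 * pi"
      unfolding cos_one_2pi_int by auto
    then have "real_of_int k = real_of_int (n * int s)" using s by (simp add: field_simps)
    then show "int s dvd k" by (simp only: of_int_eq_iff) simp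
  next
    assume "int s dvd k"
    then obtain n where "k = int s * n" by auto
    then have "2 * pi * real_of_int k / real s = 2 * pi * real_of_int n" using s by simp
    then show "\<zeta> = 1" unfolding \<zeta>_def by (simp only: cis_multiple_2pi Ints_of_int)
  qed
  ultimately show ?thesis
    unfolding pow by (cases "\<zeta> = 1") (simp_all add: sum_gp_strict)
qed

text \<open>Averaging over the \<open>s\<close> shifts by \<open>2\<pi>/s\<close> kills every frequency \<open>k\<close> that \<open>s\<close> does not divide, and at
the point \<open>rh/s\<close> a surviving frequency \<open>k\<close> contributes the exponent \<open>r * (k div s)\<close> of \<open>exp(ih)\<close>.\<close>
lemma trig_poly_average:
  assumes s: "0 < s" and \<phi>: "trig_poly \<phi>"
  shows "\<exists>q. (\<forall>k\<in>Poly_Mapping.keys q. int r dvd k) \<and>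
    (\<forall>h. (\<Sum>m<s. \<phi> ((real r * h + 2 * pi * real m) / real s)) / of_nat s = laurent_eval q (cis h))"
  using \<phi>
proof induction
  case zero
  show ?case by (intro exI[of _ 0]) auto
next
  case (add_term f c k)
  then obtain q where q: "\<forall>k\<in>Poly_Mapping.keys q. int r dvd k"
    "\<And>h. (\<Sum>m<s. f ((real r * h + 2 * pi * real m) / real s)) / of_nat s = laurent_eval q (cis h)" by auto
  define q' where "q' = (if int s dvd k then Poly_Mapping.single (int r * (k div int s)) c else 0)"
  have "(\<Sum>m<s. c * cis (real_of_int k * ((real r * h + 2 * pi * real m) / real s))) / of_nat s =
      laurent_eval q' (cis h)" for h
  proof -
    have "(\<Sum>m<s. c * cis (real_of_int k * ((real r * h + 2 * pi * real m) / real s))) =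
        c * cis (real_of_int k * real r * h / real s) * (\<Sum>m<s. cis (2 * pi * real m * real_of_int k / real s))"
      unfolding sum_distrib_left mult.assoc cis_mult
      by (intro sum.cong refl) (simp add: field_simps)
    moreover have "cis (real_of_int k * real r * h / real s) = cis h powi (int r * (k div int s))"
      if "int s dvd k"
    proof -
      obtain n where k: "k = int s * n" using \<open>int s dvd k\<close> by auto
      then show ?thesis using s by (simp add: cis_power_int mult_ac)
    qed
    ultimately show ?thesis
      using s by (simp add: sum_roots_of_unity q'_def)
  qed
  then have "(\<Sum>m<s. c * cis (real_of_int k * ((real r * h + 2 * pi * real m) / real s)) +
      f ((real r * h + 2 * pi * real m) / real s)) / of_nat s = laurent_eval (q' + q) (cis h)" for h
    using q(2)[of h] by (simp add: sum.distrib add_divide_distrib laurent_eval_add)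
  moreover have "\<forall>k\<in>Poly_Mapping.keys (q' + q). int r dvd k"
    using q(1) keys_add[of q' q] by (auto simp: q'_def split: if_splits)
  ultimately show ?case by blast
qed

section \<open>The Laurent polynomial of the braid\<close>
text \<open>Indexing by the fibre shows that the braid polynomial depends on \<open>w\<close> alone and not on an order of the strands.\<close>
definition strand_poly :: "nat \<Rightarrow> nat \<Rightarrow> nat \<Rightarrow> real \<Rightarrow> real \<Rightarrow> complex \<Rightarrow> complex poly" where
  "strand_poly s r l a b w = (\<Prod>t\<in>fibre s r w. [:- lissajous l a b t, 1:])"

lemma poly_strand_poly: "poly (strand_poly s r l a b w) u = (\<Prod>t\<in>fibre s r w. u - lissajous l a b t)"
  by (simp add: strand_poly_def poly_prod)

lemma braid_poly_eq_strand_poly: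
  assumes "0 < s" shows "braid_poly s r l a b u h = poly (strand_poly s r l a b (cis h)) u"
  unfolding poly_strand_poly braid_poly_def Z_eq_lissajous
  by (rule prod.reindex_bij_betw[OF bij_betw_strands[OF assms]])

lemma strand_poly_monic:
  assumes "0 < s" "cmod w = 1"
  shows "degree (strand_poly s r l a b w) = s" "coeff (strand_poly s r l a b w) s = 1"
proof -
  have "degree (strand_poly s r l a b w) = (\<Sum>t\<in>fibre s r w. degree [:- lissajous l a b t, 1:])"
    unfolding strand_poly_def by (rule degree_prod_eq_sum_degree) auto
  then show d: "degree (strand_poly s r l a b w) = s"
    using card_fibre[OF assms, of r] by simp
  have "lead_coeff (strand_poly s r l a b w) = 1"
    unfolding strand_poly_def lead_coeff_prod by simp
  then show "coeff (strand_poly s r l a b w) s = 1" using d by simp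
qed

text \<open>As a function of \<open>x = rh/s\<close> a coefficient is a trigonometric polynomial. Shifting \<open>x\<close> by \<open>2\<pi>/s\<close> permutes
the strands, so the coefficient equals its own average over these shifts.\<close>
lemma strand_poly_coeff_laurent:
  assumes s: "0 < s"
  shows "\<exists>q. (\<forall>k\<in>Poly_Mapping.keys q. int r dvd k) \<and>
    (\<forall>h. coeff (strand_poly s r l a b (cis h)) i = laurent_eval q (cis h))"
proof -
  define \<phi> where "\<phi> = (\<lambda>x. coeff (\<Prod>j=1..s. [:- lissajous l a b (cis (x + 2 * pi * (real j - 1) / real s)), 1:]) i)"
  have \<phi>: "\<phi> ((real r * h + 2 * pi * real m) / real s) = coeff (strand_poly s r l a b (cis h)) i" for h m
  proof -
    let ?y = "real r * h + 2 * pi * real m"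
    have "cis ?y = cis h ^ r"
      using cis_multiple_2pi[of "real m"] by (simp add: Complex.DeMoivre flip: cis_mult)
    then have fib: "fibre s 1 (cis ?y) = fibre s r (cis h)" by (simp add: fibre_def)
    have "(\<Prod>j=1..s. [:- lissajous l a b (cis ((real 1 * ?y + 2 * pi * (real j - 1)) / real s)), 1:]) =
        strand_poly s r l a b (cis h)"
      unfolding strand_poly_def fib[symmetric]
      by (rule prod.reindex_bij_betw[OF bij_betw_strands[OF s]])
    then show ?thesis by (simp add: \<phi>_def add_divide_distrib)
  qed
  have "trig_poly \<phi>" unfolding \<phi>_def by (intro trig_poly_coeff_prod trig_poly_lissajous) auto
  from trig_poly_average[OF s this, of r] show ?thesis
    unfolding \<phi> using s by simp
qed

lemma braid_laurent:
  fixes s r l :: nat and a b :: real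
  assumes s: "0 < s"
  defines "P \<equiv> braid_laurent s r l a b"
  shows "\<And>h. h \<in> {0..2 * pi} \<Longrightarrow> map_poly (\<lambda>q. laurent_eval q (cis h)) P = strand_poly s r l a b (cis h)"
    and "degree P = s" and "coeff P s = 1"
    and "\<And>i k. k \<in> Poly_Mapping.keys (coeff P i) \<Longrightarrow> int r dvd k"
proof -
  let ?Q = "\<lambda>P. \<forall>u. \<forall>h\<in>{0..2 * pi}. poly (map_poly (\<lambda>q. laurent_eval q (cis h)) P) u = braid_poly s r l a b u h"
  have Q_iff: "?Q P \<longleftrightarrow> (\<forall>h\<in>{0..2 * pi}. map_poly (\<lambda>q. laurent_eval q (cis h)) P = strand_poly s r l a b (cis h))" for P
    unfolding braid_poly_eq_strand_poly[OF s] by (metis (no_types, lifting) poly_eq_poly_eq_iff ext)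
  obtain q where q: "\<And>i k. k \<in> Poly_Mapping.keys (q i) \<Longrightarrow> int r dvd k"
    "\<And>i h. coeff (strand_poly s r l a b (cis h)) i = laurent_eval (q i) (cis h)"
    using strand_poly_coeff_laurent[OF s, of r l a b] by metis
  define P' where "P' = (\<Sum>i<s. Polynomial.monom (q i) i) + Polynomial.monom 1 s"
  have coeff_P': "coeff P' i = (if i < s then q i else if i = s then 1 else 0)" for i
  proof -
    have "coeff (\<Sum>i<s. Polynomial.monom (q i) i) i = (\<Sum>j<s. if j = i then q j else 0)"
      by (simp add: coeff_sum)
    also have "\<dots> = (if i < s then q i else 0)" by simp
    finally show ?thesis by (auto simp: P'_def)
  qed
  have "map_poly (\<lambda>q. laurent_eval q (cis h)) P' = strand_poly s r l a b (cis h)" for h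
  proof (rule poly_eqI)
    fix i
    consider "i < s" | "i = s" | "s < i" by linarith
    then show "coeff (map_poly (\<lambda>q. laurent_eval q (cis h)) P') i = coeff (strand_poly s r l a b (cis h)) i"
    proof cases
      case 1 then show ?thesis by (simp add: coeff_map_poly coeff_P' q(2))
    next
      case 2 then show ?thesis by (simp add: coeff_map_poly coeff_P' strand_poly_monic[OF s])
    next
      case 3 then show ?thesis
        using strand_poly_monic(1)[OF s, of "cis h" r l a b] by (simp add: coeff_map_poly coeff_P' coeff_eq_0)
    qed
  qed
  then have QP': "?Q P'" unfolding Q_iff by blast
  have uniq: "P\<^sub>1 = P'" if "?Q P\<^sub>1" for P\<^sub>1
  proof (rule poly_eqI, rule laurent_eval_unit_circle_inj)
    fix i h assume "h \<in> {0..2 * pi}"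
    then have "map_poly (\<lambda>q. laurent_eval q (cis h)) P\<^sub>1 = map_poly (\<lambda>q. laurent_eval q (cis h)) P'"
      using that QP' unfolding Q_iff by simp
    then have "coeff (map_poly (\<lambda>q. laurent_eval q (cis h)) P\<^sub>1) i = coeff (map_poly (\<lambda>q. laurent_eval q (cis h)) P') i"
      by simp
    then show "laurent_eval (coeff P\<^sub>1 i) (cis h) = laurent_eval (coeff P' i) (cis h)"
      by (simp add: coeff_map_poly)
  qed
  have P: "P = P'" unfolding P_def braid_laurent_def using QP' uniq by (rule the_equality)
  show "map_poly (\<lambda>q. laurent_eval q (cis h)) P = strand_poly s r l a b (cis h)" if "h \<in> {0..2 * pi}" for h
    using QP' that unfolding Q_iff P by blast
  show "degree P = s" unfolding P
    by (rule antisym) (auto intro!: degree_le le_degree simp: coeff_P')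
  show "coeff P s = 1" by (simp add: P coeff_P')
  show "int r dvd k" if "k \<in> Poly_Mapping.keys (coeff P i)" for i k
    using that q(1) by (auto simp: P coeff_P' split: if_splits)
qed

section \<open>The mixed polynomial\<close>
lemma mixed_eval_superset:
  assumes "finite A" "Poly_Mapping.keys f \<subseteq> A"
  shows "mixed_eval f u v = (\<Sum>(i, m, n)\<in>A. Poly_Mapping.lookup f (i, m, n) * u ^ i * v ^ m * cnj v ^ n)"
  unfolding mixed_eval_def
  by (rule sum.mono_neutral_left) (use assms in \<open>auto simp: in_keys_iff\<close>)

lemma mixed_eval_0 [simp]: "mixed_eval 0 u v = 0"
  by (simp add: mixed_eval_def)

lemma mixed_eval_single [simp]:
  "mixed_eval (Poly_Mapping.single (i, m, n) c) u v = c * u ^ i * v ^ m * cnj v ^ n"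
  by (subst mixed_eval_superset[of "{(i, m, n)}"]) auto

lemma mixed_eval_add: "mixed_eval (f + g) u v = mixed_eval f u v + mixed_eval g u v"
proof -
  let ?A = "Poly_Mapping.keys f \<union> Poly_Mapping.keys g"
  have "mixed_eval x u v = (\<Sum>(i, m, n)\<in>?A. Poly_Mapping.lookup x (i, m, n) * u ^ i * v ^ m * cnj v ^ n)"
    if "x \<in> {f, g, f + g}" for x
    using that keys_add[of f g] by (intro mixed_eval_superset) auto
  then show ?thesis by (simp add: lookup_add ring_distribs sum.distrib case_prod_unfold)
qed

lemma mixed_eval_sum: "mixed_eval (\<Sum>x\<in>A. f x) u v = (\<Sum>x\<in>A. mixed_eval (f x) u v)"
  by (induction A rule: infinite_finite_induct) (simp_all add: mixed_eval_add)

lemma f1_unit_circle: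
  assumes s: "0 < s" and w: "cmod w = 1"
  shows "mixed_eval (f1 s r l a b) u w = (\<Prod>t\<in>fibre s r w. u - lissajous l a b t)"
proof -
  define P where "P = braid_laurent s r l a b"
  note P = braid_laurent[OF s, where r = r and l = l and a = a and b = b, folded P_def]
  have "w = cis (Arg2pi w)" using w by (metis Arg2pi_eq cis_conv_exp complex_norm_eq_1_exp)
  moreover have "Arg2pi w \<in> {0..2 * pi}" using Arg2pi[of w] by auto
  ultimately obtain h where h: "h \<in> {0..2 * pi}" "w = cis h" by metis
  have "mixed_eval (f1 s r l a b) u w =
      (\<Sum>i\<le>s. \<Sum>k\<in>Poly_Mapping.keys (coeff P i). Poly_Mapping.lookup (coeff P i) k * w powi k * u ^ i)"
    unfolding f1_def Let_def P_def[symmetric] P(2) mixed_eval_sum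
  proof (intro sum.cong refl)
    fix i k
    have "cnj w = inverse w" using w by (metis cis_cnj h(2) cis_inverse)
    then have "cnj w ^ nat \<bar>k\<bar> = w powi k" if "k < 0"
      using that by (simp add: power_int_def)
    then show "mixed_eval (Poly_Mapping.single (if 0 \<le> k then (i, nat k, 0) else (i, 0, nat \<bar>k\<bar>))
        (Poly_Mapping.lookup (coeff P i) k)) u w = Poly_Mapping.lookup (coeff P i) k * w powi k * u ^ i"
      by (auto simp: power_int_def)
  qed
  also have "\<dots> = (\<Sum>i\<le>s. laurent_eval (coeff P i) w * u ^ i)"
    by (simp add: laurent_eval_def sum_distrib_right)
  also have "\<dots> = (\<Sum>i\<le>s. coeff (strand_poly s r l a b w) i * u ^ i)"
    unfolding h(2) P(1)[OF h(1), symmetric] by (simp add: coeff_map_poly)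
  also have "\<dots> = poly (strand_poly s r l a b w) u"
    using strand_poly_monic(1)[OF s w, of r l a b] by (simp add: poly_altdef)
  finally show ?thesis by (simp add: poly_strand_poly)
qed

text \<open>The exponents of \<open>v\<close> and of its conjugate are multiples of the even number \<open>r\<close>; the leading coefficient in \<open>u\<close> is 1.\<close>
lemma keys_f1:
  assumes s: "0 < s" and r: "even r"
  shows "(i, m, n) \<in> Poly_Mapping.keys (f1 s r l a b) \<Longrightarrow>
      i \<le> s \<and> even m \<and> even n \<and> (i = s \<longrightarrow> m = 0 \<and> n = 0)"
    and "Poly_Mapping.lookup (f1 s r l a b) (s, 0, 0) = 1"
proof -
  define P where "P = braid_laurent s r l a b"
  note P = braid_laurent[OF s, where r = r and l = l and a = a and b = b, folded P_def]
  define key where "key = (\<lambda>(i::nat) (k::int). if 0 \<le> k then (i, nat k, 0) else (i, 0::nat, nat \<bar>k\<bar>))"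
  have f1: "f1 s r l a b = (\<Sum>i\<le>s. \<Sum>k\<in>Poly_Mapping.keys (coeff P i).
      Poly_Mapping.single (key i k) (Poly_Mapping.lookup (coeff P i) k))"
    by (simp add: f1_def P_def[symmetric] P(2) key_def)
  show "i \<le> s \<and> even m \<and> even n \<and> (i = s \<longrightarrow> m = 0 \<and> n = 0)"
    if imn: "(i, m, n) \<in> Poly_Mapping.keys (f1 s r l a b)"
  proof -
    obtain i' k where ik: "i' \<le> s" "k \<in> Poly_Mapping.keys (coeff P i')" "(i, m, n) = key i' k"
    proof -
      have "(i, m, n) \<in> (\<Union>i\<le>s. \<Union>k\<in>Poly_Mapping.keys (coeff P i).
          Poly_Mapping.keys (Poly_Mapping.single (key i k) (Poly_Mapping.lookup (coeff P i) k)))"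
        using imn keys_sum unfolding f1 by (smt (verit) UN_iff subset_eq)
      then show ?thesis using that by (auto split: if_splits)
    qed
    have "even k"
      using P(4)[OF ik(2)] r by (metis dvd_trans even_of_nat)
    moreover have "k = 0" if "i' = s" using ik(2) P(3) that by simp
    ultimately show ?thesis using ik by (auto simp: key_def even_nat_iff split: if_splits)
  qed
  have "Poly_Mapping.lookup (f1 s r l a b) (s, 0, 0) =
      (\<Sum>i\<le>s. \<Sum>k\<in>Poly_Mapping.keys (coeff P i).
        if i = s \<and> k = 0 then Poly_Mapping.lookup (coeff P i) k else 0)"
    unfolding f1 lookup_sum
    by (intro sum.cong refl) (auto simp: lookup_single key_def when_def)
  also have "\<dots> = (\<Sum>i\<le>s. if i = s then 1 else 0)"
  proof (intro sum.cong refl)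
    fix i
    show "(\<Sum>k\<in>Poly_Mapping.keys (coeff P i).
        if i = s \<and> k = 0 then Poly_Mapping.lookup (coeff P i) k else 0) = (if i = s then 1 else 0)"
      using P(3) by auto
  qed
  also have "\<dots> = 1" by simp
  finally show "Poly_Mapping.lookup (f1 s r l a b) (s, 0, 0) = 1" .
qed

lemma le_total_deg: "(i, m, n) \<in> Poly_Mapping.keys f \<Longrightarrow> i + m + n \<le> total_deg f"
  unfolding total_deg_def by (rule Max_ge) force+

lemma mixed_eval_f1_monic:
  assumes "0 < s" "even r"
  shows "mixed_eval (f1 s r l a b) u v = u ^ s +
    (\<Sum>(i, m, n)\<in>Poly_Mapping.keys (f1 s r l a b) - {(s, 0, 0)}.
       Poly_Mapping.lookup (f1 s r l a b) (i, m, n) * u ^ i * v ^ m * cnj v ^ n)"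
proof -
  have "(s, 0, 0) \<in> Poly_Mapping.keys (f1 s r l a b)"
    using keys_f1(2)[OF assms, of l a b] by (simp add: in_keys_iff)
  then show ?thesis
    unfolding mixed_eval_def using keys_f1(2)[OF assms, of l a b]
    by (subst sum.remove[of _ "(s, 0, 0)"]) auto
qed

text \<open>Since the degree in \<open>u\<close> is \<open>s\<close>, only \<open>s = 1\<close> could fail. Then a total degree of 1 and even exponents would leave no
\<open>v\<close> at all, although the single strand moves from real part \<open>a\<close> to \<open>- a\<close>.\<close>
lemma total_deg_f1_ge_2:
  assumes s: "0 < s" and r: "even r" "0 < r" and a: "a \<noteq> 0"
  shows "2 \<le> total_deg (f1 s r l a b)"
proof (rule ccontr)
  assume "\<not> 2 \<le> total_deg (f1 s r l a b)"
  moreover have "s \<le> total_deg (f1 s r l a b)"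
    using le_total_deg[of s 0 0 "f1 s r l a b"] keys_f1(2)[OF s r(1), of l a b] by (simp add: in_keys_iff)
  ultimately have D: "total_deg (f1 s r l a b) = 1" and s1: "s = 1" using s by auto
  have const: "mixed_eval (f1 s r l a b) u v = mixed_eval (f1 s r l a b) u 1" for u v
    unfolding mixed_eval_def
  proof (intro sum.cong refl)
    fix x assume x: "x \<in> Poly_Mapping.keys (f1 s r l a b)"
    obtain i m n where x_eq: "x = (i, m, n)" by (cases x)
    have "even m" "even n" "i + m + n \<le> 1"
      using x x_eq keys_f1(1)[OF s r(1)] le_total_deg[of i m n "f1 s r l a b"] D by auto
    then have "m = 0" "n = 0" by (auto elim!: evenE)
    then show "(case x of (i, m, n) \<Rightarrow> Poly_Mapping.lookup (f1 s r l a b) (i, m, n) * u ^ i * v ^ m * cnj v ^ n) =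
        (case x of (i, m, n) \<Rightarrow> Poly_Mapping.lookup (f1 s r l a b) (i, m, n) * u ^ i * 1 ^ m * cnj 1 ^ n)"
      by (simp add: x_eq)
  qed
  have fib: "fibre s r w = {w ^ r}" if "cmod w = 1" for w
    using that by (auto simp: fibre_def s1 norm_power)
  have "cis (pi / real r) ^ r = -1" using r by (simp add: Complex.DeMoivre)
  then have "lissajous l a b 1 = lissajous l a b (-1)"
    using f1_unit_circle[OF s, of 1 r l a b 0] f1_unit_circle[OF s, of "cis (pi / real r)" r l a b 0]
      const[of 0 "cis (pi / real r)"] by (simp add: fib)
  then show False using a by (simp add: lissajous_def)
qed

section \<open>Uniformly Lipschitz families\<close>
text \<open>Bounds and Lipschitz constants in \<open>u\<close> that are uniform in a parameter \<open>p\<close>. Parameter values to be excluded are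
given the empty domain \<open>D p\<close>.\<close>
definition unif_lipschitz :: "('p \<Rightarrow> complex set) \<Rightarrow> ('p \<Rightarrow> complex \<Rightarrow> complex) \<Rightarrow> bool" where
  "unif_lipschitz D \<Phi> \<longleftrightarrow> (\<exists>C\<ge>0. \<forall>p. \<forall>u\<in>D p. \<forall>u'\<in>D p.
     cmod (\<Phi> p u) \<le> C \<and> cmod (\<Phi> p u - \<Phi> p u') \<le> C * cmod (u - u'))"

lemma unif_lipschitzE:
  assumes "unif_lipschitz D \<Phi>"
  obtains C where "0 < C" "\<And>p u. u \<in> D p \<Longrightarrow> cmod (\<Phi> p u) \<le> C"
    "\<And>p u u'. u \<in> D p \<Longrightarrow> u' \<in> D p \<Longrightarrow> cmod (\<Phi> p u - \<Phi> p u') \<le> C * cmod (u - u')"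
proof -
  obtain C where C: "C \<ge> 0" "\<And>p u u'. u \<in> D p \<Longrightarrow> u' \<in> D p \<Longrightarrow>
      cmod (\<Phi> p u) \<le> C \<and> cmod (\<Phi> p u - \<Phi> p u') \<le> C * cmod (u - u')"
    using assms unfolding unif_lipschitz_def by metis
  show ?thesis
  proof
    show "0 < C + 1" using C by simp
    show "cmod (\<Phi> p u) \<le> C + 1" if "u \<in> D p" for p u using C(2)[OF that that] by simp
    show "cmod (\<Phi> p u - \<Phi> p u') \<le> (C + 1) * cmod (u - u')" if "u \<in> D p" "u' \<in> D p" for p u u'
      using C(2)[OF that] norm_ge_zero[of "u - u'"] unfolding distrib_right by linarith
  qed
qed

lemma unif_lipschitzI:
  assumes "\<And>p u. u \<in> D p \<Longrightarrow> cmod (\<Phi> p u) \<le> B" "0 \<le> L"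
    "\<And>p u u'. u \<in> D p \<Longrightarrow> u' \<in> D p \<Longrightarrow> cmod (\<Phi> p u - \<Phi> p u') \<le> L * cmod (u - u')"
  shows "unif_lipschitz D \<Phi>"
  unfolding unif_lipschitz_def
proof (intro exI[of _ "max B L"] conjI allI ballI)
  fix p u u' assume u: "u \<in> D p" "u' \<in> D p"
  show "cmod (\<Phi> p u) \<le> max B L" using assms(1)[OF u(1)] by simp
  have "L * cmod (u - u') \<le> max B L * cmod (u - u')" by (intro mult_right_mono) auto
  then show "cmod (\<Phi> p u - \<Phi> p u') \<le> max B L * cmod (u - u')" using assms(3)[OF u] by linarith
qed (use assms(2) in auto)

lemma unif_lipschitz_const:
  assumes "\<And>p u. u \<in> D p \<Longrightarrow> cmod (k p) \<le> B" shows "unif_lipschitz D (\<lambda>p u. k p)"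
  by (rule unif_lipschitzI[of _ _ B 0]) (use assms in auto)

lemma unif_lipschitz_id:
  assumes "\<And>p. D p \<subseteq> cball 0 B" shows "unif_lipschitz D (\<lambda>p u. u)"
  by (rule unif_lipschitzI[of _ _ B 1]) (use assms in force)+

lemma unif_lipschitz_cnj:
  assumes "unif_lipschitz D \<Phi>" shows "unif_lipschitz D (\<lambda>p u. cnj (\<Phi> p u))"
  using assms unfolding unif_lipschitz_def by (simp flip: complex_cnj_diff)

lemma unif_lipschitz_minus:
  assumes "unif_lipschitz D \<Phi>" shows "unif_lipschitz D (\<lambda>p u. - \<Phi> p u)"
  using assms unfolding unif_lipschitz_def by (simp add: norm_minus_commute)

lemma unif_lipschitz_add:
  assumes "unif_lipschitz D \<Phi>" "unif_lipschitz D \<Psi>" shows "unif_lipschitz D (\<lambda>p u. \<Phi> p u + \<Psi> p u)"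
proof -
  obtain A where A: "0 < A" "\<And>p u. u \<in> D p \<Longrightarrow> cmod (\<Phi> p u) \<le> A"
    "\<And>p u u'. u \<in> D p \<Longrightarrow> u' \<in> D p \<Longrightarrow> cmod (\<Phi> p u - \<Phi> p u') \<le> A * cmod (u - u')"
    using unif_lipschitzE[OF assms(1)] by metis
  obtain B where B: "0 < B" "\<And>p u. u \<in> D p \<Longrightarrow> cmod (\<Psi> p u) \<le> B"
    "\<And>p u u'. u \<in> D p \<Longrightarrow> u' \<in> D p \<Longrightarrow> cmod (\<Psi> p u - \<Psi> p u') \<le> B * cmod (u - u')"
    using unif_lipschitzE[OF assms(2)] by metis
  show ?thesis
  proof (rule unif_lipschitzI)
    show "cmod (\<Phi> p u + \<Psi> p u) \<le> A + B" if "u \<in> D p" for p u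
      using norm_triangle_ineq[of "\<Phi> p u" "\<Psi> p u"] A(2)[OF that] B(2)[OF that] by linarith
    show "cmod (\<Phi> p u + \<Psi> p u - (\<Phi> p u' + \<Psi> p u')) \<le> (A + B) * cmod (u - u')"
      if "u \<in> D p" "u' \<in> D p" for p u u'
      using norm_triangle_ineq[of "\<Phi> p u - \<Phi> p u'" "\<Psi> p u - \<Psi> p u'"] A(3)[OF that] B(3)[OF that]
      by (simp add: distrib_right add_diff_add)
  qed (use A B in simp)
qed

lemma unif_lipschitz_mult:
  assumes "unif_lipschitz D \<Phi>" "unif_lipschitz D \<Psi>" shows "unif_lipschitz D (\<lambda>p u. \<Phi> p u * \<Psi> p u)"
proof -
  obtain A where A: "0 < A" "\<And>p u. u \<in> D p \<Longrightarrow> cmod (\<Phi> p u) \<le> A"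
    "\<And>p u u'. u \<in> D p \<Longrightarrow> u' \<in> D p \<Longrightarrow> cmod (\<Phi> p u - \<Phi> p u') \<le> A * cmod (u - u')"
    using unif_lipschitzE[OF assms(1)] by metis
  obtain B where B: "0 < B" "\<And>p u. u \<in> D p \<Longrightarrow> cmod (\<Psi> p u) \<le> B"
    "\<And>p u u'. u \<in> D p \<Longrightarrow> u' \<in> D p \<Longrightarrow> cmod (\<Psi> p u - \<Psi> p u') \<le> B * cmod (u - u')"
    using unif_lipschitzE[OF assms(2)] by metis
  show ?thesis
  proof (rule unif_lipschitzI)
    show "cmod (\<Phi> p u * \<Psi> p u) \<le> A * B" if "u \<in> D p" for p u
      unfolding norm_mult using A(2)[OF that] B(2)[OF that] A(1) by (intro mult_mono) auto
    show "cmod (\<Phi> p u * \<Psi> p u - \<Phi> p u' * \<Psi> p u') \<le> (2 * A * B) * cmod (u - u')"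
      if u: "u \<in> D p" "u' \<in> D p" for p u u'
    proof -
      have "\<Phi> p u * \<Psi> p u - \<Phi> p u' * \<Psi> p u' = \<Phi> p u * (\<Psi> p u - \<Psi> p u') + (\<Phi> p u - \<Phi> p u') * \<Psi> p u'"
        by (simp add: algebra_simps)
      then have "cmod (\<Phi> p u * \<Psi> p u - \<Phi> p u' * \<Psi> p u') \<le>
          cmod (\<Phi> p u) * cmod (\<Psi> p u - \<Psi> p u') + cmod (\<Phi> p u - \<Phi> p u') * cmod (\<Psi> p u')"
        by (metis norm_mult norm_triangle_ineq)
      also have "\<dots> \<le> A * (B * cmod (u - u')) + (A * cmod (u - u')) * B"
        by (intro add_mono mult_mono A B u) (use A(1) in auto)
      finally show ?thesis by (simp add: algebra_simps)
    qed
  qed (use A B in simp)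
qed

lemma unif_lipschitz_power:
  assumes "unif_lipschitz D \<Phi>" shows "unif_lipschitz D (\<lambda>p u. \<Phi> p u ^ n)"
  by (induction n) (auto intro: unif_lipschitz_mult assms unif_lipschitz_const[of _ _ 1])

lemma unif_lipschitz_sum:
  assumes "\<And>i. i \<in> I \<Longrightarrow> unif_lipschitz D (\<lambda>p u. \<Phi> i p u)"
  shows "unif_lipschitz D (\<lambda>p u. \<Sum>i\<in>I. \<Phi> i p u)"
  using assms
  by (induction I rule: infinite_finite_induct)
    (auto intro: unif_lipschitz_add unif_lipschitz_const[of _ _ 0])

lemma unif_lipschitz_prod:
  assumes "\<And>i. i \<in> I \<Longrightarrow> unif_lipschitz D (\<lambda>p u. \<Phi> i p u)"
  shows "unif_lipschitz D (\<lambda>p u. \<Prod>i\<in>I. \<Phi> i p u)"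
  using assms
  by (induction I rule: infinite_finite_induct)
    (auto intro: unif_lipschitz_mult unif_lipschitz_const[of _ _ 1])

lemma unif_lipschitz_inverse:
  assumes "unif_lipschitz D \<Phi>" "0 < m" "\<And>p u. u \<in> D p \<Longrightarrow> m \<le> cmod (\<Phi> p u)"
  shows "unif_lipschitz D (\<lambda>p u. inverse (\<Phi> p u))"
proof -
  obtain A where A: "0 < A" "\<And>p u. u \<in> D p \<Longrightarrow> cmod (\<Phi> p u) \<le> A"
    "\<And>p u u'. u \<in> D p \<Longrightarrow> u' \<in> D p \<Longrightarrow> cmod (\<Phi> p u - \<Phi> p u') \<le> A * cmod (u - u')"
    using unif_lipschitzE[OF assms(1)] by metis
  have inv: "cmod (inverse (\<Phi> p u)) \<le> 1 / m" if "u \<in> D p" for p u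
    using assms(3)[OF that] assms(2) by (simp add: norm_inverse divide_inverse le_imp_inverse_le)
  show ?thesis
  proof (rule unif_lipschitzI)
    show "cmod (inverse (\<Phi> p u) - inverse (\<Phi> p u')) \<le> (1 / m * A * (1 / m)) * cmod (u - u')"
      if u: "u \<in> D p" "u' \<in> D p" for p u u'
    proof -
      have "\<Phi> p u \<noteq> 0" "\<Phi> p u' \<noteq> 0" using assms(3)[OF u(1)] assms(3)[OF u(2)] assms(2) by auto
      then have "cmod (inverse (\<Phi> p u) - inverse (\<Phi> p u')) =
          cmod (inverse (\<Phi> p u)) * cmod (\<Phi> p u - \<Phi> p u') * cmod (inverse (\<Phi> p u'))"
        by (simp add: inverse_diff_inverse norm_mult)
      also have "\<dots> \<le> (1 / m) * (A * cmod (u - u')) * (1 / m)"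
        by (intro mult_mono inv A u) (use A(1) assms(2) in auto)
      finally show ?thesis by (simp add: algebra_simps)
    qed
  qed (use A assms inv in auto)
qed

section \<open>Zeros on a thin ellipsoid\<close>
text \<open>The properties of \<open>f\<^sub>1\<close> on which the perturbation argument rests: \<open>J\<close> and \<open>c\<close> are the exponents and coefficients of
its non-leading monomials, \<open>\<zeta>\<close> is the strand function.\<close>
locale braid_polynomial =
  fixes s r :: nat and f :: "complex \<Rightarrow> complex \<Rightarrow> complex" and J :: "(nat \<times> nat \<times> nat) set"
    and c :: "nat \<times> nat \<times> nat \<Rightarrow> complex" and \<zeta> :: "complex \<Rightarrow> complex"
  assumes s: "0 < s"
    and J: "\<And>i m n. (i, m, n) \<in> J \<Longrightarrow> i < s \<and> even m \<and> even n"
    and f_eq: "\<And>u v. f u v = u ^ s + (\<Sum>(i, m, n)\<in>J. c (i, m, n) * u ^ i * v ^ m * cnj v ^ n)"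
    and unit_circle: "\<And>u w. cmod w = 1 \<Longrightarrow> f u w = (\<Prod>t\<in>fibre s r w. u - \<zeta> t)"
    and continuous_\<zeta>: "continuous_on (sphere 0 1) \<zeta>"
    and inj_\<zeta>: "\<And>w t t'. cmod w = 1 \<Longrightarrow> t \<in> fibre s r w \<Longrightarrow> t' \<in> fibre s r w \<Longrightarrow> \<zeta> t = \<zeta> t' \<Longrightarrow> t = t'"
begin

text \<open>Cauchy's bound for the roots of a monic polynomial, uniform in \<open>|v| \<le> 1\<close>.\<close>
definition root_bound :: real where
  "root_bound = 1 + (\<Sum>j\<in>J. cmod (c j))"

lemma root_bound: "1 \<le> root_bound"
  unfolding root_bound_def by (simp add: sum_nonneg)

lemma cmod_root_le:
  assumes v: "cmod v \<le> 1" and f: "f u v = 0"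
  shows "cmod u \<le> root_bound"
proof (rule ccontr)
  assume "\<not> cmod u \<le> root_bound"
  then have u: "root_bound < cmod u" "1 \<le> cmod u" using root_bound by auto
  have us: "u ^ s = - (\<Sum>(i, m, n)\<in>J. c (i, m, n) * u ^ i * v ^ m * cnj v ^ n)"
    using f unfolding f_eq by (rule eq_neg_iff_add_eq_0[THEN iffD2])
  have "cmod u ^ s = cmod (u ^ s)" by (simp add: norm_power)
  also have "\<dots> = cmod (\<Sum>(i, m, n)\<in>J. c (i, m, n) * u ^ i * v ^ m * cnj v ^ n)"
    unfolding us by (rule norm_minus_cancel)
  also have "\<dots> \<le> (\<Sum>j\<in>J. cmod (c j) * cmod u ^ (s - 1))"
  proof (rule sum_norm_le)
    fix j assume "j \<in> J"
    obtain i m n where j: "j = (i, m, n)" by (cases j)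
    then have "i \<le> s - 1" using J \<open>j \<in> J\<close> by force
    have "cmod (c j * u ^ i * v ^ m * cnj v ^ n) \<le> cmod (c j) * cmod u ^ (s - 1) * 1 * 1"
      unfolding norm_mult norm_power complex_mod_cnj
      by (intro mult_mono power_increasing power_le_one v u \<open>i \<le> s - 1\<close>) auto
    then show "cmod (case j of (i, m, n) \<Rightarrow> c (i, m, n) * u ^ i * v ^ m * cnj v ^ n) \<le> cmod (c j) * cmod u ^ (s - 1)"
      by (simp add: j)
  qed
  also have "\<dots> = (root_bound - 1) * cmod u ^ (s - 1)"
    by (simp add: root_bound_def sum_distrib_right)
  also have "\<dots> < cmod u * cmod u ^ (s - 1)"
    using u by (intro mult_strict_right_mono zero_less_power) auto
  also have "\<dots> = cmod u ^ s" using s by (simp add: power_eq_if)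
  finally show False by simp
qed

text \<open>The modulus of \<open>v\<close> on the ellipsoid \<open>\<rho>\<^sup>2 |u|\<^sup>2 + |v|\<^sup>2 = 1\<close>.\<close>
definition shell_root :: "real \<Rightarrow> complex \<Rightarrow> real" where
  "shell_root \<rho> u = sqrt (1 - \<rho>\<^sup>2 * (cmod u)\<^sup>2)"

definition correction :: "real \<Rightarrow> complex \<Rightarrow> complex \<Rightarrow> complex" where
  "correction \<rho> w u = (\<Sum>(i, m, n)\<in>J. c (i, m, n) * u ^ i * w ^ m * cnj w ^ n *
     (- (u * cnj u) * (\<Sum>k<(m + n) div 2. (1 - of_real (\<rho>\<^sup>2) * (u * cnj u)) ^ k)))"

text \<open>Only even powers of the square root in \<open>shell_root\<close> occur, so on the ellipsoid \<open>f\<close> is a polynomial in \<open>\<rho>\<^sup>2\<close>, \<open>u\<close>, \<open>w\<close> and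
their conjugates, and a geometric sum factors \<open>\<rho>\<^sup>2\<close> out of the deviation from \<open>\<rho> = 0\<close>.\<close>
lemma f_shell:
  assumes "\<rho>\<^sup>2 * (cmod u)\<^sup>2 \<le> 1" and w: "cmod w = 1"
  shows "f u (w * of_real (shell_root \<rho> u)) = f u w + of_real (\<rho>\<^sup>2) * correction \<rho> w u"
proof -
  let ?\<sigma> = "complex_of_real (shell_root \<rho> u)" and ?x = "1 - of_real (\<rho>\<^sup>2) * (u * cnj u)"
  have \<sigma>2: "?\<sigma>\<^sup>2 = ?x"
    unfolding complex_norm_square[symmetric] of_real_power[symmetric] of_real_mult[symmetric]
    using assms(1) by (simp add: shell_root_def)
  have pow: "?\<sigma> ^ m * ?\<sigma> ^ n = 1 + of_real (\<rho>\<^sup>2) * (- (u * cnj u) * (\<Sum>k<(m + n) div 2. ?x ^ k))"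
    if "even m" "even n" for m n
  proof -
    have "?\<sigma> ^ m * ?\<sigma> ^ n = (?\<sigma>\<^sup>2) ^ ((m + n) div 2)"
      using that by (simp flip: power_add power_mult)
    also have "\<dots> = 1 + (?x - 1) * (\<Sum>k<(m + n) div 2. ?x ^ k)"
      unfolding \<sigma>2 using power_diff_1_eq[of ?x "(m + n) div 2"] by (simp add: algebra_simps)
    finally show ?thesis by (simp add: algebra_simps)
  qed
  have distr: "x * (1 + y * z) = x + y * (x * z)" for x y z :: complex
    by (simp add: algebra_simps)
  have "(\<Sum>(i, m, n)\<in>J. c (i, m, n) * u ^ i * (w * ?\<sigma>) ^ m * cnj (w * ?\<sigma>) ^ n) =
      (\<Sum>j\<in>J. (case j of (i, m, n) \<Rightarrow> c (i, m, n) * u ^ i * w ^ m * cnj w ^ n) +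
        of_real (\<rho>\<^sup>2) * (case j of (i, m, n) \<Rightarrow> c (i, m, n) * u ^ i * w ^ m * cnj w ^ n *
          (- (u * cnj u) * (\<Sum>k<(m + n) div 2. ?x ^ k))))"
  proof (intro sum.cong refl)
    fix j assume "j \<in> J"
    obtain i m n where j: "j = (i, m, n)" by (cases j)
    have ev: "even m" "even n" using J[of i m n] \<open>j \<in> J\<close> j by auto
    have "c (i, m, n) * u ^ i * (w * ?\<sigma>) ^ m * cnj (w * ?\<sigma>) ^ n =
        (c (i, m, n) * u ^ i * w ^ m * cnj w ^ n) * (?\<sigma> ^ m * ?\<sigma> ^ n)"
      by (simp add: power_mult_distrib mult_ac)
    also have "\<dots> = c (i, m, n) * u ^ i * w ^ m * cnj w ^ n + of_real (\<rho>\<^sup>2) *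
        (c (i, m, n) * u ^ i * w ^ m * cnj w ^ n * (- (u * cnj u) * (\<Sum>k<(m + n) div 2. ?x ^ k)))"
      by (simp only: pow[OF ev] distr)
    finally show "(case j of (i, m, n) \<Rightarrow> c (i, m, n) * u ^ i * (w * ?\<sigma>) ^ m * cnj (w * ?\<sigma>) ^ n) =
        (case j of (i, m, n) \<Rightarrow> c (i, m, n) * u ^ i * w ^ m * cnj w ^ n) +
        of_real (\<rho>\<^sup>2) * (case j of (i, m, n) \<Rightarrow> c (i, m, n) * u ^ i * w ^ m * cnj w ^ n *
          (- (u * cnj u) * (\<Sum>k<(m + n) div 2. ?x ^ k)))"
      by (simp only: j prod.case)
  qed
  also have "\<dots> = (\<Sum>(i, m, n)\<in>J. c (i, m, n) * u ^ i * w ^ m * cnj w ^ n) + of_real (\<rho>\<^sup>2) * correction \<rho> w u"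
    unfolding correction_def sum.distrib sum_distrib_left[symmetric, of "of_real (\<rho>\<^sup>2)"] ..
  finally show ?thesis unfolding f_eq by simp
qed

lemma unif_lipschitz_correction:
  assumes D: "\<And>p. D p \<subseteq> cball 0 B" and w: "\<And>p u. u \<in> D p \<Longrightarrow> cmod (w p) = 1"
    and \<rho>: "\<And>p u. u \<in> D p \<Longrightarrow> \<bar>\<rho> p\<bar> \<le> 1"
  shows "unif_lipschitz D (\<lambda>p u. correction (\<rho> p) (w p) u)"
proof -
  note id = unif_lipschitz_id[OF D] 
  note uu = unif_lipschitz_mult[OF id unif_lipschitz_cnj[OF id]]
  have \<rho>2: "unif_lipschitz D (\<lambda>p u. of_real ((\<rho> p)\<^sup>2))"
    by (rule unif_lipschitz_const[of _ _ 1]) (use \<rho> in \<open>simp add: norm_power abs_square_le_1\<close>)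
  have wp: "unif_lipschitz D (\<lambda>p u. w p)" 
    by (rule unif_lipschitz_const[of _ _ 1]) (use w in simp)
  have one: "unif_lipschitz D (\<lambda>p u. k)" for k :: complex
    by (rule unif_lipschitz_const[of _ _ "cmod k"]) simp
  show ?thesis
    unfolding correction_def case_prod_unfold diff_conv_add_uminus
    by (intro unif_lipschitz_sum unif_lipschitz_mult unif_lipschitz_power unif_lipschitz_add
        unif_lipschitz_minus uu \<rho>2 wp one id unif_lipschitz_cnj[OF wp])
qed

text \<open>The factors of \<open>f\<close> belonging to the other strands over the same \<open>w\<close>. Writing these strands as \<open>t * \<omega>\<close>
makes the index set independent of \<open>t\<close>, which allows uniform estimates.\<close>
definition cofactor :: "complex \<Rightarrow> complex \<Rightarrow> complex" where
  "cofactor t u = (\<Prod>\<omega>\<in>{z. z ^ s = 1} - {1}. u - \<zeta> (t * \<omega>))"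

lemma fibre_translate:
  assumes "t \<in> fibre s r w" shows "bij_betw (\<lambda>\<omega>. t * \<omega>) {z. z ^ s = 1} (fibre s r w)"
proof (rule bij_betwI[where g = "\<lambda>z. z / t"])
  have t: "cmod t = 1" "t ^ s = w ^ r" "t \<noteq> 0" using assms by (auto simp: fibre_def)
  show "(*) t \<in> {z. z ^ s = 1} \<rightarrow> fibre s r w"
    using t s power_eq_1_iff[of _ s] by (auto simp: fibre_def norm_mult power_mult_distrib)
  show "(\<lambda>z. z / t) \<in> fibre s r w \<rightarrow> {z. z ^ s = 1}"
  proof
    fix z assume "z \<in> fibre s r w"
    then have "z ^ s = t ^ s" using t by (simp add: fibre_def)
    then show "z / t \<in> {z. z ^ s = 1}" using t(3) by (simp add: power_divide)
  qed
qed (use assms in \<open>auto simp: fibre_def\<close>)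

lemma f_eq_cofactor:
  assumes "(w, t) \<in> torus_curve s r" shows "f u w = (u - \<zeta> t) * cofactor t u"
proof -
  have w: "cmod w = 1" and t: "t \<in> fibre s r w" using assms by (auto simp: torus_curve_def)
  have "f u w = (\<Prod>\<omega>\<in>{z. z ^ s = 1}. u - \<zeta> (t * \<omega>))"
    unfolding unit_circle[OF w] by (rule prod.reindex_bij_betw[OF fibre_translate[OF t], symmetric])
  also have "\<dots> = (u - \<zeta> (t * 1)) * cofactor t u"
    unfolding cofactor_def using s by (intro prod.remove) (auto intro: finite_nth_roots)
  finally show ?thesis by simp
qed

lemma roots_separated:
  obtains d where "0 < d" "\<And>w t \<omega>. (w, t) \<in> torus_curve s r \<Longrightarrow> \<omega> ^ s = 1 \<Longrightarrow> \<omega> \<noteq> 1 \<Longrightarrow>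
    d \<le> cmod (\<zeta> t - \<zeta> (t * \<omega>))"
proof -
  have "continuous_on (torus_curve s r) (\<lambda>p. \<zeta> (snd p))"
    by (rule continuous_on_compose2[OF continuous_\<zeta>])
      (auto intro!: continuous_intros simp: torus_curve_def fibre_def)
  then obtain d where d: "0 < d" "\<And>w t t'. (w, t) \<in> torus_curve s r \<Longrightarrow> (w, t') \<in> torus_curve s r \<Longrightarrow> t \<noteq> t' \<Longrightarrow>
      d \<le> cmod (\<zeta> (snd (w, t)) - \<zeta> (snd (w, t')))"
    by (rule strands_separated[OF s]) (use inj_\<zeta> in \<open>auto simp: torus_curve_def\<close>)
  show ?thesis
  proof
    fix w t \<omega> assume p: "(w, t) \<in> torus_curve s r" and \<omega>: "\<omega> ^ s = 1" "\<omega> \<noteq> (1::complex)"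
    have t: "t \<in> fibre s r w" "cmod w = 1" using p by (auto simp: torus_curve_def)
    then have "t * \<omega> \<in> fibre s r w" using bij_betw_apply[OF fibre_translate] \<omega> by blast
    moreover have "t \<noteq> 0" using t by (auto simp: fibre_def)
    ultimately show "d \<le> cmod (\<zeta> t - \<zeta> (t * \<omega>))" using d(2)[OF p, of "t * \<omega>"] t \<omega> by (simp add: torus_curve_def)
  qed fact
qed

text \<open>In discs of radius \<open>k\<close>, at most half the mutual distance of the strands, around a strand the cofactor stays away
from 0. One constant \<open>C\<close> serves all estimates.\<close>
lemma strand_estimates:
  assumes "0 < \<kappa>"
  obtains k B C where "0 < k" "k \<le> \<kappa>" "k \<le> 1" "0 < B" "0 < C"
    "\<And>t. cmod t = 1 \<Longrightarrow> cball (\<zeta> t) k \<subseteq> cball 0 B"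
    "\<And>w t u. (w, t) \<in> torus_curve s r \<Longrightarrow> u \<in> cball (\<zeta> t) k \<Longrightarrow> cofactor t u \<noteq> 0 \<and> 1 / C \<le> cmod (cofactor t u)"
    "\<And>\<rho> w t u. \<bar>\<rho>\<bar> \<le> 1 \<Longrightarrow> (w, t) \<in> torus_curve s r \<Longrightarrow> u \<in> cball (\<zeta> t) k \<Longrightarrow>
        cmod (correction \<rho> w u / cofactor t u) \<le> C"
    "\<And>\<rho> w t u u'. \<bar>\<rho>\<bar> \<le> 1 \<Longrightarrow> (w, t) \<in> torus_curve s r \<Longrightarrow> u \<in> cball (\<zeta> t) k \<Longrightarrow> u' \<in> cball (\<zeta> t) k \<Longrightarrow>
        cmod (correction \<rho> w u / cofactor t u - correction \<rho> w u' / cofactor t u') \<le> C * cmod (u - u')"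
    "\<And>\<rho> w u. \<bar>\<rho>\<bar> \<le> 1 \<Longrightarrow> cmod w = 1 \<Longrightarrow> cmod u \<le> root_bound \<Longrightarrow> cmod (correction \<rho> w u) \<le> C"
proof -
  obtain d where d: "0 < d" "\<And>w t \<omega>. (w, t) \<in> torus_curve s r \<Longrightarrow> \<omega> ^ s = 1 \<Longrightarrow> \<omega> \<noteq> 1 \<Longrightarrow>
      d \<le> cmod (\<zeta> t - \<zeta> (t * \<omega>))"
    using roots_separated by blast
  define k where "k = min \<kappa> (min (d / 2) 1)"
  have k: "0 < k" "k \<le> \<kappa>" "k \<le> 1" "2 * k \<le> d" using d(1) assms by (auto simp: k_def min_def)
  have "bounded (\<zeta> ` sphere 0 1)"
    by (intro compact_imp_bounded compact_continuous_image continuous_\<zeta> compact_sphere)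
  then obtain B\<^sub>0 where B\<^sub>0: "0 < B\<^sub>0" "\<And>t. cmod t = 1 \<Longrightarrow> cmod (\<zeta> t) \<le> B\<^sub>0"
    unfolding bounded_pos by auto
  define B where "B = B\<^sub>0 + 1"
  have B: "cmod u \<le> B" if "cmod t = 1" "u \<in> cball (\<zeta> t) k" for t u
  proof -
    have "cmod u \<le> cmod (u - \<zeta> t) + cmod (\<zeta> t)" by (metis diff_add_cancel norm_triangle_ineq)
    then show ?thesis using that B\<^sub>0(2)[of t] k(3) by (simp add: B_def dist_norm norm_minus_commute)
  qed
  define D where "D = (\<lambda>(\<rho>::real, w, t). if \<bar>\<rho>\<bar> \<le> 1 \<and> (w, t) \<in> torus_curve s r then cball (\<zeta> t) k else {})"
  have D: "\<bar>fst p\<bar> \<le> 1 \<and> snd p \<in> torus_curve s r \<and> u \<in> cball (\<zeta> (snd (snd p))) k" if "u \<in> D p" for p u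
    using that by (auto simp: D_def split: if_splits prod.splits)
  have T1: "cmod (fst q) = 1" "cmod (snd q) = 1" if "q \<in> torus_curve s r" for q
    using that by (auto simp: torus_curve_def fibre_def)
  have DB: "D p \<subseteq> cball 0 B" for p
  proof
    fix u assume "u \<in> D p"
    from D[OF this] show "u \<in> cball 0 B" using B[of "snd (snd p)" u] T1(2)[of "snd p"] by simp
  qed
  have inv: "unif_lipschitz D (\<lambda>p u. inverse (u - \<zeta> (snd (snd p) * \<omega>)))"
    if \<omega>: "\<omega> \<in> {z. z ^ s = 1} - {1}" for \<omega>
  proof (rule unif_lipschitz_inverse)
    have tw: "cmod (\<zeta> (snd (snd p) * \<omega>)) \<le> B\<^sub>0" if "u \<in> D p" for p u
    proof -
      have "cmod \<omega> = 1" using \<omega> s power_eq_1_iff[of \<omega> s] by auto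
      then show ?thesis using D[OF that] T1(2)[of "snd p"] by (intro B\<^sub>0) (simp add: norm_mult)
    qed
    show "unif_lipschitz D (\<lambda>p u. u - \<zeta> (snd (snd p) * \<omega>))"
      unfolding diff_conv_add_uminus
      by (intro unif_lipschitz_add unif_lipschitz_minus unif_lipschitz_id[OF DB] unif_lipschitz_const[OF tw])
    show "k \<le> cmod (u - \<zeta> (snd (snd p) * \<omega>))" if u: "u \<in> D p" for p u
    proof -
      have "d \<le> cmod (\<zeta> (snd (snd p)) - \<zeta> (snd (snd p) * \<omega>))"
        using d(2)[of "fst (snd p)" "snd (snd p)" \<omega>] D[OF u] \<omega> by simp
      also have "\<dots> \<le> cmod (\<zeta> (snd (snd p)) - u) + cmod (u - \<zeta> (snd (snd p) * \<omega>))"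
        using norm_triangle_ineq[of "\<zeta> (snd (snd p)) - u" "u - \<zeta> (snd (snd p) * \<omega>)"] by simp
      finally show ?thesis using D[OF u] k(4) by (simp add: dist_norm)
    qed
  qed (use k in simp)
  have cof: "inverse (cofactor t u) = (\<Prod>\<omega>\<in>{z. z ^ s = 1} - {1}. inverse (u - \<zeta> (t * \<omega>)))" for t u
    unfolding cofactor_def by (rule prod_inversef[unfolded o_def, symmetric])
  have inv_cof: "unif_lipschitz D (\<lambda>p u. inverse (cofactor (snd (snd p)) u))"
    unfolding cof by (intro unif_lipschitz_prod inv)
  then obtain C\<^sub>1 where C\<^sub>1: "0 < C\<^sub>1" "\<And>p u. u \<in> D p \<Longrightarrow> cmod (inverse (cofactor (snd (snd p)) u)) \<le> C\<^sub>1"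
    using unif_lipschitzE by metis
  have "unif_lipschitz D (\<lambda>p u. correction (fst p) (fst (snd p)) u)"
    by (rule unif_lipschitz_correction[OF DB]) (use D T1 in blast)+
  note lip = unif_lipschitz_mult[OF this inv_cof]
  obtain C\<^sub>2 where C\<^sub>2: "0 < C\<^sub>2"
    "\<And>p u. u \<in> D p \<Longrightarrow> cmod (correction (fst p) (fst (snd p)) u * inverse (cofactor (snd (snd p)) u)) \<le> C\<^sub>2"
    "\<And>p u u'. u \<in> D p \<Longrightarrow> u' \<in> D p \<Longrightarrow> cmod (correction (fst p) (fst (snd p)) u * inverse (cofactor (snd (snd p)) u) -
       correction (fst p) (fst (snd p)) u' * inverse (cofactor (snd (snd p)) u')) \<le> C\<^sub>2 * cmod (u - u')"
    by (rule unif_lipschitzE[OF lip]) (rule that)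
  define E where "E = (\<lambda>(\<rho>::real, w::complex). if \<bar>\<rho>\<bar> \<le> 1 \<and> cmod w = 1 then cball (0::complex) root_bound else {})"
  have "unif_lipschitz E (\<lambda>p u. correction (fst p) (snd p) u)"
    by (rule unif_lipschitz_correction[of _ root_bound]) (auto simp: E_def split: if_splits)
  note lipE = this
  obtain C\<^sub>3 where C\<^sub>3: "0 < C\<^sub>3" "\<And>p u. u \<in> E p \<Longrightarrow> cmod (correction (fst p) (snd p) u) \<le> C\<^sub>3"
    by (rule unif_lipschitzE[OF lipE]) (rule that)
  define C where "C = max C\<^sub>1 (max C\<^sub>2 C\<^sub>3)"
  have C: "C\<^sub>1 \<le> C" "C\<^sub>2 \<le> C" "C\<^sub>3 \<le> C" by (auto simp: C_def)
  show ?thesis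
  proof (rule that[of k B C])
    show "0 < B" "0 < C" using B\<^sub>0 C\<^sub>1 C by (auto simp: B_def)
    show "cball (\<zeta> t) k \<subseteq> cball 0 B" if "cmod t = 1" for t using B[OF that] by auto
    show "cofactor t u \<noteq> 0 \<and> 1 / C \<le> cmod (cofactor t u)"
      if p: "(w, t) \<in> torus_curve s r" and u: "u \<in> cball (\<zeta> t) k" for w t u
    proof -
      have "u \<noteq> \<zeta> (t * \<omega>)" if "\<omega> \<in> {z. z ^ s = 1} - {1}" for \<omega>
        using d(2)[OF p, of \<omega>] u that k by (auto simp: dist_norm)
      then have nz: "cofactor t u \<noteq> 0"
        unfolding cofactor_def using finite_nth_roots[OF s] by auto
      have "1 / cmod (cofactor t u) \<le> C"
        using C\<^sub>1(2)[of u "(0, w, t)"] p u C(1) by (simp add: D_def norm_inverse divide_inverse)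
      then show ?thesis using nz \<open>0 < C\<close> by (simp add: field_simps)
    qed
    show "cmod (correction \<rho> w u / cofactor t u) \<le> C"
      if "\<bar>\<rho>\<bar> \<le> 1" "(w, t) \<in> torus_curve s r" "u \<in> cball (\<zeta> t) k" for \<rho> w t u
      using C\<^sub>2(2)[of u "(\<rho>, w, t)"] that C(2) by (simp add: D_def divide_inverse)
    show "cmod (correction \<rho> w u / cofactor t u - correction \<rho> w u' / cofactor t u') \<le> C * cmod (u - u')"
      if "\<bar>\<rho>\<bar> \<le> 1" "(w, t) \<in> torus_curve s r" "u \<in> cball (\<zeta> t) k" "u' \<in> cball (\<zeta> t) k" for \<rho> w t u u'
    proof -
      have "cmod (correction \<rho> w u / cofactor t u - correction \<rho> w u' / cofactor t u') \<le> C\<^sub>2 * cmod (u - u')"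
        using C\<^sub>2(3)[of u "(\<rho>, w, t)" u'] that by (simp add: D_def divide_inverse)
      also have "\<dots> \<le> C * cmod (u - u')" using C(2) by (intro mult_right_mono) auto
      finally show ?thesis .
    qed
    show "cmod (correction \<rho> w u) \<le> C" if "\<bar>\<rho>\<bar> \<le> 1" "cmod w = 1" "cmod u \<le> root_bound" for \<rho> w u
      using C\<^sub>3(2)[of u "(\<rho>, w)"] that C(3) by (simp add: E_def)
  qed (use k in auto)
qed

text \<open>\<open>U\<close> describes all zeros of \<open>f\<close> on the ellipsoid, as strands within \<open>\<kappa>\<close> of \<open>\<zeta>\<close>; the last conjunct expresses
that they are simple zeros along the slices of constant \<open>w\<close>.\<close>
definition zero_strands :: "real \<Rightarrow> real \<Rightarrow> (complex \<times> complex \<Rightarrow> complex) \<Rightarrow> bool" where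
  "zero_strands \<kappa> \<rho> U \<longleftrightarrow> continuous_on (torus_curve s r) U \<and>
     (\<forall>p\<in>torus_curve s r. cmod (U p - \<zeta> (snd p)) \<le> \<kappa> \<and> \<rho> * cmod (U p) < 1) \<and>
     (\<forall>u v. \<rho>\<^sup>2 * (cmod u)\<^sup>2 + (cmod v)\<^sup>2 = 1 \<longrightarrow>
        (f u v = 0 \<longleftrightarrow> (\<exists>p\<in>torus_curve s r. u = U p \<and> v = fst p * of_real (shell_root \<rho> u)))) \<and>
     (\<exists>m>0. \<exists>\<eta>>0. \<forall>p\<in>torus_curve s r. \<forall>u. cmod (u - U p) < \<eta> \<longrightarrow>
        \<rho> * cmod u < 1 \<and> m * cmod (u - U p) \<le> cmod (f u (fst p * of_real (shell_root \<rho> u))))"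

lemma zero_strandsD:
  assumes "zero_strands \<kappa> \<rho> U"
  shows "continuous_on (torus_curve s r) U"
    and "\<And>p. p \<in> torus_curve s r \<Longrightarrow> cmod (U p - \<zeta> (snd p)) \<le> \<kappa>"
    and "\<And>p. p \<in> torus_curve s r \<Longrightarrow> \<rho> * cmod (U p) < 1"
    and "\<And>u v. \<rho>\<^sup>2 * (cmod u)\<^sup>2 + (cmod v)\<^sup>2 = 1 \<Longrightarrow>
        f u v = 0 \<longleftrightarrow> (\<exists>p\<in>torus_curve s r. u = U p \<and> v = fst p * of_real (shell_root \<rho> u))"
    and "\<exists>m>0. \<exists>\<eta>>0. \<forall>p\<in>torus_curve s r. \<forall>u. cmod (u - U p) < \<eta> \<longrightarrow>
        \<rho> * cmod u < 1 \<and> m * cmod (u - U p) \<le> cmod (f u (fst p * of_real (shell_root \<rho> u)))"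
  using assms unfolding zero_strands_def by simp_all

text \<open>Near the strand \<open>\<zeta> t\<close> the equation \<open>f = 0\<close> on the ellipsoid reads
\<open>u = \<zeta> t - \<rho>\<^sup>2 * correction / cofactor\<close>, the fixed point equation of a contraction \<open>N\<close> of a small disc. Far
from all strands the product is too large for the correction to cancel it. The fixed point depends continuously on
\<open>(w, t)\<close> because its graph is closed.\<close>
lemma exists_zero_strands:
  assumes \<kappa>: "0 < \<kappa>"
  obtains \<rho>\<^sub>1 where "0 < \<rho>\<^sub>1" "\<And>\<rho>. 0 < \<rho> \<Longrightarrow> \<rho> < \<rho>\<^sub>1 \<Longrightarrow> \<exists>U. zero_strands \<kappa> \<rho> U"
proof -
  let ?T = "torus_curve s r"
  obtain k B C where k: "0 < k" "k \<le> \<kappa>" "k \<le> 1" and B: "0 < B" and C: "0 < C"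
    and ball: "\<And>t. cmod t = 1 \<Longrightarrow> cball (\<zeta> t) k \<subseteq> cball 0 B"
    and cof: "\<And>w t u. (w, t) \<in> ?T \<Longrightarrow> u \<in> cball (\<zeta> t) k \<Longrightarrow> cofactor t u \<noteq> 0 \<and> 1 / C \<le> cmod (cofactor t u)"
    and quot: "\<And>\<rho> w t u. \<bar>\<rho>\<bar> \<le> 1 \<Longrightarrow> (w, t) \<in> ?T \<Longrightarrow> u \<in> cball (\<zeta> t) k \<Longrightarrow>
        cmod (correction \<rho> w u / cofactor t u) \<le> C"
    and lip: "\<And>\<rho> w t u u'. \<bar>\<rho>\<bar> \<le> 1 \<Longrightarrow> (w, t) \<in> ?T \<Longrightarrow> u \<in> cball (\<zeta> t) k \<Longrightarrow> u' \<in> cball (\<zeta> t) k \<Longrightarrow>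
        cmod (correction \<rho> w u / cofactor t u - correction \<rho> w u' / cofactor t u') \<le> C * cmod (u - u')"
    and corr: "\<And>\<rho> w u. \<bar>\<rho>\<bar> \<le> 1 \<Longrightarrow> cmod w = 1 \<Longrightarrow> cmod u \<le> root_bound \<Longrightarrow> cmod (correction \<rho> w u) \<le> C"
    using strand_estimates[OF \<kappa>] by blast
  \<comment> \<open>the bounds keep \<open>\<rho> |u| < 1\<close> near the strands and at every root, make \<open>N\<close> a contraction of the disc, and exclude zeros far from the strands\<close>
  define \<rho>\<^sub>1 where "\<rho>\<^sub>1 = Min {1, 1 / B, 1 / root_bound, k / (2 * C), k ^ s / C}"
  have \<rho>\<^sub>1: "0 < \<rho>\<^sub>1" "\<rho>\<^sub>1 \<le> 1" "\<rho>\<^sub>1 \<le> 1 / B" "\<rho>\<^sub>1 \<le> 1 / root_bound" "\<rho>\<^sub>1 \<le> k / (2 * C)" "\<rho>\<^sub>1 \<le> k ^ s / C"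
    unfolding \<rho>\<^sub>1_def using k B C root_bound by auto
  show ?thesis
  proof (rule that[OF \<rho>\<^sub>1(1)])
    fix \<rho> :: real assume \<rho>: "0 < \<rho>" "\<rho> < \<rho>\<^sub>1"
    have \<rho>_less: "\<rho> < 1" "\<rho> * B < 1" "\<rho> * root_bound < 1" "\<rho> * C \<le> k / 2" "\<rho> * C < k ^ s"
    proof -
      show "\<rho> < 1" using \<rho> \<rho>\<^sub>1 by linarith
      have "\<rho> < 1 / B" "\<rho> < 1 / root_bound" "\<rho> < k / (2 * C)" "\<rho> < k ^ s / C" using \<rho> \<rho>\<^sub>1 by linarith+
      then show "\<rho> * B < 1" "\<rho> * root_bound < 1" "\<rho> * C \<le> k / 2" "\<rho> * C < k ^ s"
        using B C root_bound by (simp_all add: field_simps)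
    qed
    have \<rho>2: "\<rho>\<^sup>2 \<le> \<rho>" using \<rho> \<rho>_less by (simp add: power2_eq_square mult_left_le)
    have "\<rho>\<^sup>2 * C \<le> \<rho> * C" by (rule mult_right_mono[OF \<rho>2]) (use C in simp)
    then have \<rho>2C: "\<rho>\<^sup>2 * C \<le> k / 2" "\<rho>\<^sup>2 * C < k ^ s" "\<rho>\<^sup>2 * C \<le> 1 / 2"
      using \<rho>_less k by linarith+
    have abs: "\<bar>\<rho>\<bar> \<le> 1" using \<rho> \<rho>_less by simp
    have small: "\<rho> * cmod u < 1" "\<rho>\<^sup>2 * (cmod u)\<^sup>2 \<le> 1" if "\<rho> * cmod u < 1" for u
      using that \<rho> by (auto simp flip: power_mult_distrib simp: abs_square_le_1)
    define g where "g = (\<lambda>w u. f u (w * of_real (shell_root \<rho> u)))"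
    define N where "N = (\<lambda>(w, t) u. \<zeta> t - of_real (\<rho>\<^sup>2) * (correction \<rho> w u / cofactor t u))"
    have T1: "cmod w = 1" "cmod t = 1" "t \<in> fibre s r w" if "(w, t) \<in> ?T" for w t
      using that by (auto simp: torus_curve_def fibre_def)
    have in_ball: "\<rho> * cmod u < 1" if "(w, t) \<in> ?T" "u \<in> cball (\<zeta> t) k" for w t u
    proof -
      have "cmod u \<le> B" using ball[OF T1(2)[OF that(1)]] that(2) by auto
      then have "\<rho> * cmod u \<le> \<rho> * B" using \<rho> by simp
      then show ?thesis using \<rho>_less by linarith
    qed
    have g_eq: "g w u = cofactor t u * (u - N (w, t) u)" if p: "(w, t) \<in> ?T" and u: "u \<in> cball (\<zeta> t) k" for w t u
    proof -
      have "g w u = (u - \<zeta> t) * cofactor t u + of_real (\<rho>\<^sup>2) * correction \<rho> w u"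
        unfolding g_def by (subst f_shell[OF small(2)[OF in_ball[OF p u]] T1(1)[OF p]]) (simp only: f_eq_cofactor[OF p])
      then show ?thesis using cof[OF p u] by (simp add: N_def algebra_simps)
    qed
    have norm_\<rho>: "cmod (of_real (\<rho>\<^sup>2) * x) = \<rho>\<^sup>2 * cmod x" for x
      by (simp add: norm_mult norm_power)
    have N_near: "cmod (N (w, t) u - \<zeta> t) \<le> k / 2" if "(w, t) \<in> ?T" "u \<in> cball (\<zeta> t) k" for w t u
    proof -
      have "cmod (N (w, t) u - \<zeta> t) = \<rho>\<^sup>2 * cmod (correction \<rho> w u / cofactor t u)"
        unfolding norm_\<rho>[symmetric] by (simp add: N_def)
      also have "\<dots> \<le> \<rho>\<^sup>2 * C" by (intro mult_left_mono quot abs that) auto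
      finally show ?thesis using \<rho>2C by linarith
    qed
    have N_lip: "cmod (N (w, t) u - N (w, t) u') \<le> 1 / 2 * cmod (u - u')"
      if "(w, t) \<in> ?T" "u \<in> cball (\<zeta> t) k" "u' \<in> cball (\<zeta> t) k" for w t u u'
    proof -
      have "N (w, t) u - N (w, t) u' = - (of_real (\<rho>\<^sup>2) * (correction \<rho> w u / cofactor t u - correction \<rho> w u' / cofactor t u'))"
        by (simp add: N_def algebra_simps)
      then have "cmod (N (w, t) u - N (w, t) u') = \<rho>\<^sup>2 * cmod (correction \<rho> w u / cofactor t u - correction \<rho> w u' / cofactor t u')"
        by (simp only: norm_minus_cancel norm_\<rho>)
      also have "\<dots> \<le> \<rho>\<^sup>2 * (C * cmod (u - u'))" by (intro mult_left_mono lip abs that) auto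
      also have "\<dots> = \<rho>\<^sup>2 * C * cmod (u - u')" by simp
      also have "\<dots> \<le> 1 / 2 * cmod (u - u')" by (intro mult_right_mono \<rho>2C) auto
      finally show ?thesis .
    qed
    have "\<exists>u\<in>cball (\<zeta> (snd p)) k. N p u = u" if p: "p \<in> ?T" for p
    proof -
      obtain w t where p_eq: "p = (w, t)" by (cases p)
      have "\<exists>!u\<in>cball (\<zeta> t) k. N (w, t) u = u"
      proof (rule Banach_fix)
        show "complete (cball (\<zeta> t) k)" by (intro compact_imp_complete compact_cball)
        show "N (w, t) ` cball (\<zeta> t) k \<subseteq> cball (\<zeta> t) k"
        proof
          fix y assume "y \<in> N (w, t) ` cball (\<zeta> t) k"
          then obtain u where "u \<in> cball (\<zeta> t) k" "y = N (w, t) u" by blast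
          then show "y \<in> cball (\<zeta> t) k"
            using N_near[of w t u] p p_eq k(1) by (simp add: dist_norm norm_minus_commute)
        qed
        show "dist (N (w, t) u) (N (w, t) u') \<le> 1 / 2 * dist u u'"
          if "u \<in> cball (\<zeta> t) k" "u' \<in> cball (\<zeta> t) k" for u u'
          using N_lip[of w t u u'] that p p_eq by (simp add: dist_norm)
      qed (use k in auto)
      then show ?thesis unfolding p_eq snd_conv by blast
    qed
    then have "\<forall>p\<in>?T. \<exists>u. u \<in> cball (\<zeta> (snd p)) k \<and> N p u = u" by blast
    from bchoice[OF this] obtain U where U: "\<And>p. p \<in> ?T \<Longrightarrow> U p \<in> cball (\<zeta> (snd p)) k" "\<And>p. p \<in> ?T \<Longrightarrow> N p (U p) = U p"
      by blast
    have lower: "1 / (2 * C) * cmod (u - U (w, t)) \<le> cmod (g w u)" if p: "(w, t) \<in> ?T" and u: "u \<in> cball (\<zeta> t) k" for w t u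
    proof -
      have Ub: "U (w, t) \<in> cball (\<zeta> t) k" using U(1)[OF p] by simp
      have "cmod (u - U (w, t)) \<le> cmod (u - N (w, t) u) + cmod (N (w, t) u - U (w, t))"
        using norm_triangle_ineq[of "u - N (w, t) u" "N (w, t) u - U (w, t)"] by simp
      also have "cmod (N (w, t) u - U (w, t)) \<le> 1 / 2 * cmod (u - U (w, t))"
        using N_lip[OF p u Ub] U(2)[OF p] by simp
      finally have "1 / 2 * cmod (u - U (w, t)) \<le> cmod (u - N (w, t) u)" by simp
      then have "1 / C * (1 / 2 * cmod (u - U (w, t))) \<le> cmod (cofactor t u) * cmod (u - N (w, t) u)"
        using cof[OF p u] C by (intro mult_mono) auto
      then show ?thesis unfolding g_eq[OF p u] norm_mult by simp
    qed
    have U_near: "cmod (U p - \<zeta> (snd p)) \<le> k / 2" if "p \<in> ?T" for p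
      using N_near[of "fst p" "snd p" "U p"] U[OF that] that by simp
    have g_U: "g (fst p) (U p) = 0" if p: "p \<in> ?T" for p
      using g_eq[of "fst p" "snd p" "U p"] U[OF p] p by simp
    have zeros: "f u v = 0 \<longleftrightarrow> (\<exists>p\<in>?T. u = U p \<and> v = fst p * of_real (shell_root \<rho> u))"
      if uv: "\<rho>\<^sup>2 * (cmod u)\<^sup>2 + (cmod v)\<^sup>2 = 1" for u v
    proof
      assume f0: "f u v = 0"
      have "(cmod v)\<^sup>2 \<le> 1" using uv zero_le_power2[of "\<rho> * cmod u"] unfolding power_mult_distrib by linarith
      then have "cmod v \<le> 1" by (simp add: abs_square_le_1)
      then have M: "cmod u \<le> root_bound" using cmod_root_le f0 by blast
      then have "\<rho> * cmod u \<le> \<rho> * root_bound" using \<rho> by simp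
      then have \<rho>u: "\<rho> * cmod u < 1" using \<rho>_less by linarith
      have \<sigma>: "shell_root \<rho> u = cmod v" 
        unfolding shell_root_def using uv by (intro real_sqrt_unique) auto
      have "(\<rho> * cmod u)\<^sup>2 < 1" using \<rho>u \<rho> by (simp add: abs_square_less_1)
      then have v0: "v \<noteq> 0" using uv by (auto simp: power_mult_distrib)
      then have w: "cmod (sgn v) = 1" by (simp add: norm_sgn)
      have v: "v = sgn v * of_real (shell_root \<rho> u)"
        using v0 by (simp add: \<sigma> sgn_div_norm scaleR_conv_of_real)
      have g0: "g (sgn v) u = 0" unfolding g_def using f0 v by simp
      have "f u (sgn v) = - (of_real (\<rho>\<^sup>2) * correction \<rho> (sgn v) u)"
        using g0 f_shell[OF small(2)[OF \<rho>u] w] unfolding g_def by (simp add: eq_neg_iff_add_eq_0)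
      then have "cmod (f u (sgn v)) = \<rho>\<^sup>2 * cmod (correction \<rho> (sgn v) u)" by (simp only: norm_minus_cancel norm_\<rho>)
      also have "\<dots> \<le> \<rho>\<^sup>2 * C" by (intro mult_left_mono corr abs w M) auto
      finally have less: "cmod (f u (sgn v)) < k ^ s" using \<rho>2C by linarith
      have "\<exists>t\<in>fibre s r (sgn v). cmod (u - \<zeta> t) < k"
      proof (rule ccontr)
        assume "\<not> ?thesis"
        then have "(\<Prod>t\<in>fibre s r (sgn v). k) \<le> (\<Prod>t\<in>fibre s r (sgn v). cmod (u - \<zeta> t))"
          using k by (intro prod_mono) (auto simp: not_less)
        also have "\<dots> = cmod (f u (sgn v))" unfolding unit_circle[OF w] by (simp add: prod_norm)
        finally show False using less card_fibre[OF s w, of r] by simp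
      qed
      then obtain t where t: "t \<in> fibre s r (sgn v)" "cmod (u - \<zeta> t) < k" by blast
      have p: "(sgn v, t) \<in> ?T" using t w by (simp add: torus_curve_def)
      have "1 / (2 * C) * cmod (u - U (sgn v, t)) \<le> 0"
        using lower[OF p, of u] t(2) g0 by (simp add: dist_norm norm_minus_commute)
      then have "u = U (sgn v, t)" using C by (auto simp: divide_le_0_iff)
      then show "\<exists>p\<in>?T. u = U p \<and> v = fst p * of_real (shell_root \<rho> u)"
        using p v by (intro bexI[of _ "(sgn v, t)"]) auto
    qed (use g_U in \<open>auto simp: g_def\<close>)
    have cont: "continuous_on ?T U"
    proof -
      have UB: "U \<in> ?T \<rightarrow> cball 0 B"
      proof
        fix p assume p: "p \<in> ?T"
        then have "cmod (snd p) = 1" using T1(2)[of "fst p" "snd p"] by simp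
        then show "U p \<in> cball 0 B" using U(1)[OF p] ball by blast
      qed
      let ?X = "?T \<times> cball (0::complex) B"
      have cont\<zeta>: "continuous_on ?X (\<lambda>x. \<zeta> (snd (fst x)))"
        by (rule continuous_on_compose2[OF continuous_\<zeta>]) (use T1(2) in \<open>auto intro!: continuous_intros\<close>)
      have contg: "continuous_on ?X (\<lambda>x. g (fst (fst x)) (snd x))"
        unfolding g_def f_eq shell_root_def case_prod_unfold by (intro continuous_intros)
      have "closedin (top_of_set ?X) (?X \<inter> (\<lambda>x. (cmod (snd x - \<zeta> (snd (fst x))), g (fst (fst x)) (snd x))) -` ({..k} \<times> {0}))"
        by (intro continuous_closedin_preimage continuous_intros cont\<zeta> contg closed_Times)
      also have "?X \<inter> (\<lambda>x. (cmod (snd x - \<zeta> (snd (fst x))), g (fst (fst x)) (snd x))) -` ({..k} \<times> {0}) =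
          (\<lambda>p. (p, U p)) ` ?T"
      proof (intro subset_antisym subsetI)
        fix x assume x: "x \<in> ?X \<inter> (\<lambda>x. (cmod (snd x - \<zeta> (snd (fst x))), g (fst (fst x)) (snd x))) -` ({..k} \<times> {0})"
        obtain w t u where x_eq: "x = ((w, t), u)" by (metis prod.collapse)
        have p: "(w, t) \<in> ?T" and u: "u \<in> cball (\<zeta> t) k" and g0: "g w u = 0"
          using x by (auto simp: x_eq dist_norm norm_minus_commute)
        have "u = U (w, t)" using lower[OF p u] g0 C by (auto simp: divide_le_0_iff)
        then show "x \<in> (\<lambda>p. (p, U p)) ` ?T" using p x_eq by blast
      next
        fix x assume "x \<in> (\<lambda>p. (p, U p)) ` ?T"
        then obtain p where p: "p \<in> ?T" "x = (p, U p)" by blast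
        then show "x \<in> ?X \<inter> (\<lambda>x. (cmod (snd x - \<zeta> (snd (fst x))), g (fst (fst x)) (snd x))) -` ({..k} \<times> {0})"
          using g_U[OF p(1)] U_near[OF p(1)] UB k(1) by (auto simp: Pi_iff)
      qed
      finally show ?thesis using continuous_closed_graph_eq[OF compact_cball UB] by blast
    qed
    have near: "\<rho> * cmod u < 1 \<and> 1 / (2 * C) * cmod (u - U p) \<le> cmod (f u (fst p * of_real (shell_root \<rho> u)))"
      if p: "p \<in> ?T" and u: "cmod (u - U p) < k / 2" for p u
    proof -
      obtain w t where p_eq: "p = (w, t)" by (cases p)
      have "cmod (u - \<zeta> t) \<le> cmod (u - U p) + cmod (U p - \<zeta> t)"
        using norm_triangle_ineq[of "u - U p" "U p - \<zeta> t"] by simp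
      then have "u \<in> cball (\<zeta> t) k" using u U_near[OF p] by (simp add: p_eq dist_norm norm_minus_commute)
      then show ?thesis using lower[of w t u] in_ball[of w t u] p by (simp add: p_eq g_def)
    qed
    have "cmod (U p - \<zeta> (snd p)) \<le> \<kappa> \<and> \<rho> * cmod (U p) < 1" if p: "p \<in> ?T" for p
      using U_near[OF p] k in_ball[of "fst p" "snd p" "U p"] U(1)[OF p] p by auto
    moreover have "\<exists>m>0. \<exists>\<eta>>0. \<forall>p\<in>?T. \<forall>u. cmod (u - U p) < \<eta> \<longrightarrow>
        \<rho> * cmod u < 1 \<and> m * cmod (u - U p) \<le> cmod (f u (fst p * of_real (shell_root \<rho> u)))"
      by (rule exI[of _ "1 / (2 * C)"], rule conjI, use C in simp, rule exI[of _ "k / 2"], rule conjI,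
          use k(1) in simp) (use near in blast)
    ultimately show "\<exists>U. zero_strands \<kappa> \<rho> U"
      using cont zeros unfolding zero_strands_def by blast
  qed
qed

end

section \<open>Isotopy from the lemniscate link to small strands\<close>
lemma half_plane_to_disc_near_1:
  assumes "cmod W \<le> 1"
  shows "cmod (half_plane_to_disc (1 + W) - W) \<le> 4 * (cmod W)\<^sup>2"
proof -
  define q where "q = (cmod (1 + W))\<^sup>2 + 1"
  have q1: "1 \<le> q" by (simp add: q_def)
  have q_eq: "q = 2 + 2 * Re W + (cmod W)\<^sup>2"
    by (simp add: q_def cmod_power2 power2_sum algebra_simps)
  have num: "Complex ((cmod (1 + W))\<^sup>2 - 1) (2 * Im (1 + W)) = 2 * W + of_real ((cmod W)\<^sup>2)"
    using q_eq by (simp add: complex_eq_iff q_def)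
  have "half_plane_to_disc (1 + W) - W = (2 * W + of_real ((cmod W)\<^sup>2)) / of_real q - W"
    unfolding half_plane_to_disc_def num q_def ..
  also have "\<dots> = (2 * W + of_real ((cmod W)\<^sup>2) - W * of_real q) / of_real q"
    using q1 by (simp add: diff_divide_distrib)
  also have "2 * W + of_real ((cmod W)\<^sup>2) - W * of_real q =
      of_real ((cmod W)\<^sup>2) - W * of_real (2 * Re W + (cmod W)\<^sup>2)"
    by (simp add: q_eq algebra_simps)
  finally have "cmod (half_plane_to_disc (1 + W) - W) =
      cmod (of_real ((cmod W)\<^sup>2) - W * of_real (2 * Re W + (cmod W)\<^sup>2)) / q"
    using q1 by (simp add: norm_divide)
  also have "\<dots> \<le> cmod (of_real ((cmod W)\<^sup>2) - W * of_real (2 * Re W + (cmod W)\<^sup>2)) / 1"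
    using q1 by (intro divide_left_mono) auto
  also have "\<dots> \<le> (cmod W)\<^sup>2 + cmod W * \<bar>2 * Re W + (cmod W)\<^sup>2\<bar>"
    using norm_triangle_ineq4[of "of_real ((cmod W)\<^sup>2)" "W * of_real (2 * Re W + (cmod W)\<^sup>2)"]
    by (simp only: norm_mult norm_of_real) simp
  also have "\<dots> \<le> (cmod W)\<^sup>2 + cmod W * (3 * cmod W)"
  proof -
    have "(cmod W)\<^sup>2 \<le> cmod W" using assms by (simp add: power2_eq_square mult_left_le)
    then have "\<bar>2 * Re W + (cmod W)\<^sup>2\<bar> \<le> 3 * cmod W"
      using abs_Re_le_cmod[of W] by (intro abs_leI) (use zero_le_power2[of "cmod W"] in linarith)+
    then show ?thesis by (intro add_left_mono mult_left_mono) auto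
  qed
  finally show ?thesis by (simp add: power2_eq_square)
qed

text \<open>Strands that stay within a quarter of the mutual distance of the scaled strands \<open>\<rho> \<zeta>\<close> cannot meet.\<close>
lemma geometric_braid_near_scaled:
  assumes d: "\<And>w t t'. (w, t) \<in> torus_curve s r \<Longrightarrow> (w, t') \<in> torus_curve s r \<Longrightarrow> t \<noteq> t' \<Longrightarrow>
        d \<le> cmod (\<zeta> t - \<zeta> t')" "0 < d"
    and \<rho>: "0 < \<rho>"
    and c: "continuous_on (torus_curve s r) c" "\<And>p. p \<in> torus_curve s r \<Longrightarrow> cmod (c p) < 1"
      "\<And>p. p \<in> torus_curve s r \<Longrightarrow> cmod (c p - of_real \<rho> * \<zeta> (snd p)) \<le> \<rho> * (d / 4)"
  shows "geometric_braid s r c"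
proof -
  have "t = t'" if p: "(w, t) \<in> torus_curve s r" "(w, t') \<in> torus_curve s r" and eq: "c (w, t) = c (w, t')" for w t t'
  proof (rule ccontr)
    assume "t \<noteq> t'"
    then have "\<rho> * d \<le> \<rho> * cmod (\<zeta> t - \<zeta> t')" using d(1)[OF p] \<rho> by simp
    also have "\<dots> = cmod (of_real \<rho> * (\<zeta> t - \<zeta> t'))" using \<rho> by (simp add: norm_mult)
    also have "of_real \<rho> * (\<zeta> t - \<zeta> t') = (c (w, t') - of_real \<rho> * \<zeta> t') - (c (w, t) - of_real \<rho> * \<zeta> t)"
      using eq by (simp add: algebra_simps)
    also have "cmod \<dots> \<le> \<rho> * (d / 4) + \<rho> * (d / 4)"
      using norm_triangle_ineq4[of "c (w, t') - of_real \<rho> * \<zeta> t'" "c (w, t) - of_real \<rho> * \<zeta> t"]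
        c(3)[OF p(1)] c(3)[OF p(2)] by simp
    finally show False using mult_pos_pos[OF \<rho> d(2)] by simp
  qed
  then show ?thesis using c(1,2) unfolding geometric_braid_def by blast
qed

lemma scaled_strands:
  assumes d: "\<And>w t t'. (w, t) \<in> torus_curve s r \<Longrightarrow> (w, t') \<in> torus_curve s r \<Longrightarrow> t \<noteq> t' \<Longrightarrow>
        d \<le> cmod (\<zeta> t - \<zeta> t')" "0 < d"
    and \<rho>: "0 < \<rho>"
    and U: "continuous_on (torus_curve s r) U"
      "\<And>p. p \<in> torus_curve s r \<Longrightarrow> cmod (U p - \<zeta> (snd p)) \<le> d / 4"
      "\<And>p. p \<in> torus_curve s r \<Longrightarrow> \<rho> * cmod (U p) < 1"
  shows "\<And>p. p \<in> torus_curve s r \<Longrightarrow> cmod (of_real \<rho> * U p - of_real \<rho> * \<zeta> (snd p)) \<le> \<rho> * (d / 4)"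
    and "\<And>p. p \<in> torus_curve s r \<Longrightarrow> cmod (of_real \<rho> * U p) < 1"
    and "geometric_braid s r (\<lambda>p. of_real \<rho> * U p)"
proof -
  show near: "cmod (of_real \<rho> * U p - of_real \<rho> * \<zeta> (snd p)) \<le> \<rho> * (d / 4)"
    if "p \<in> torus_curve s r" for p
  proof -
    have "of_real \<rho> * U p - of_real \<rho> * \<zeta> (snd p) = of_real \<rho> * (U p - \<zeta> (snd p))"
      by (simp add: algebra_simps)
    then have "cmod (of_real \<rho> * U p - of_real \<rho> * \<zeta> (snd p)) = \<rho> * cmod (U p - \<zeta> (snd p))"
      using \<rho> by (simp add: norm_mult)
    also have "\<dots> \<le> \<rho> * (d / 4)" using U(2)[OF that] \<rho> by (intro mult_left_mono) auto
    finally show ?thesis .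
  qed
  show less: "cmod (of_real \<rho> * U p) < 1" if "p \<in> torus_curve s r" for p
    using U(3)[OF that] \<rho> by (simp add: norm_mult)
  show "geometric_braid s r (\<lambda>p. of_real \<rho> * U p)"
  proof (rule geometric_braid_near_scaled[where \<zeta> = \<zeta> and d = d and \<rho> = \<rho>])
    show "continuous_on (torus_curve s r) (\<lambda>p. of_real \<rho> * U p)" by (intro continuous_intros U(1))
  qed (fact d \<rho> less near)+
qed

text \<open>Two paths of braids are joined at \<open>half_plane_to_disc (1 + \<rho> \<zeta>)\<close>: from the lemniscate link it is reached by a linear
path in the half-plane, along which the strands keep being positive multiples of \<open>\<zeta>\<close> up to translation. From
there to \<open>\<rho> U\<close> a linear path in the disc suffices, since both ends are close to \<open>\<rho> \<zeta>\<close> compared with the distance of its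
strands; the constant 16 absorbs the factor 4 in \<open>half_plane_to_disc_near_1\<close> and the quarter of \<open>d\<close>.\<close>
lemma lemniscate_braid_isotopic_small_strands:
  assumes s: "0 < s" and \<zeta>: "continuous_on (sphere 0 1) \<zeta>"
    and d: "\<And>w t t'. (w, t) \<in> torus_curve s r \<Longrightarrow> (w, t') \<in> torus_curve s r \<Longrightarrow> t \<noteq> t' \<Longrightarrow>
        d \<le> cmod (\<zeta> t - \<zeta> t')" "0 < d"
    and B: "\<And>t. cmod t = 1 \<Longrightarrow> cmod (\<zeta> t) \<le> B" "0 < B"
    and \<rho>: "0 < \<rho>" "\<rho> * B < 1" "16 * \<rho> * B\<^sup>2 \<le> d"
    and U: "continuous_on (torus_curve s r) U"
      "\<And>p. p \<in> torus_curve s r \<Longrightarrow> cmod (U p - \<zeta> (snd p)) \<le> d / 4"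
      "\<And>p. p \<in> torus_curve s r \<Longrightarrow> \<rho> * cmod (U p) < 1"
    and R: "\<And>p. p \<in> torus_curve s r \<Longrightarrow> 0 < R + Re (\<zeta> (snd p))"
  shows "ambient_isotopic_in (sphere 0 1) (closed_braid s r (\<lambda>p. of_real \<rho> * U p))
           (closed_braid s r (\<lambda>p. half_plane_to_disc (of_real R + \<zeta> (snd p))))"
proof -
  let ?T = "torus_curve s r"
  have T1: "cmod (snd p) = 1" if "p \<in> ?T" for p using that by (auto simp: torus_curve_def fibre_def)
  have cont\<zeta>: "continuous_on ?T (\<lambda>p. \<zeta> (snd p))"
    by (rule continuous_on_compose2[OF \<zeta>]) (use T1 in \<open>auto intro!: continuous_intros\<close>)
  have inj: "t = t'" if "(w, t) \<in> ?T" "(w, t') \<in> ?T" "\<zeta> t = \<zeta> t'" for w t t'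
    using d(1)[OF that(1,2)] d(2) that(3) by auto
  have close: "geometric_braid s r c"
    if c: "continuous_on ?T c" "\<And>p. p \<in> ?T \<Longrightarrow> cmod (c p) < 1"
      "\<And>p. p \<in> ?T \<Longrightarrow> cmod (c p - of_real \<rho> * \<zeta> (snd p)) \<le> \<rho> * (d / 4)" for c
    by (rule geometric_braid_near_scaled[where \<zeta> = \<zeta> and d = d and \<rho> = \<rho>]; fact d \<rho>(1) c)
  have U_near: "cmod (of_real \<rho> * U p - of_real \<rho> * \<zeta> (snd p)) \<le> \<rho> * (d / 4)"
    and U_less: "cmod (of_real \<rho> * U p) < 1" if p: "p \<in> ?T" for p
    using scaled_strands(1,2)[where \<zeta> = \<zeta> and d = d and \<rho> = \<rho> and U = U and p = p and s = s and r = r] d \<rho>(1) U p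
    by blast+
  have \<zeta>_le: "cmod (of_real \<rho> * \<zeta> (snd p)) \<le> \<rho> * B" if "p \<in> ?T" for p
    using B(1)[OF T1[OF that]] \<rho>(1) by (simp add: norm_mult)
  have pos: "0 < Re (1 + of_real \<rho> * \<zeta> (snd p))" if "p \<in> ?T" for p
    using \<zeta>_le[OF that] \<rho>(2) abs_Re_le_cmod[of "of_real \<rho> * \<zeta> (snd p)"] by simp
  define c where "c = (\<lambda>p::complex \<times> complex. half_plane_to_disc (1 + of_real \<rho> * \<zeta> (snd p)))"
  have c_near: "cmod (c p - of_real \<rho> * \<zeta> (snd p)) \<le> \<rho> * (d / 4)" if p: "p \<in> ?T" for p
  proof -
    have "cmod (c p - of_real \<rho> * \<zeta> (snd p)) \<le> 4 * (cmod (of_real \<rho> * \<zeta> (snd p)))\<^sup>2"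
      unfolding c_def by (rule half_plane_to_disc_near_1) (use \<zeta>_le[OF p] \<rho>(2) in linarith)
    also have "\<dots> \<le> 4 * (\<rho> * B)\<^sup>2" by (intro mult_left_mono power_mono \<zeta>_le p) auto
    also have "\<dots> = \<rho> * (16 * \<rho> * B\<^sup>2) / 4" by (simp add: power2_eq_square)
    also have "\<dots> \<le> \<rho> * d / 4" using \<rho>(1,3) by (intro divide_right_mono mult_left_mono) auto
    finally show ?thesis by simp
  qed
  have c_less: "cmod (c p) < 1" if "p \<in> ?T" for p
    unfolding c_def by (rule half_plane_to_disc(3)[OF pos[OF that]])
  have c_cont: "continuous_on ?T c" unfolding c_def by (intro continuous_intros cont\<zeta>)
  define e where "e = (\<lambda>(\<tau>::real) (p::complex \<times> complex). of_real (1 - \<tau>) * c p + of_real \<tau> * (of_real \<rho> * U p))"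
  have "ambient_isotopic_in (sphere 0 1) (closed_braid s r (e 0)) (closed_braid s r (e 1))"
  proof (rule ambient_isotopic_braid_path[OF s])
    have "continuous_on ({0..1::real} \<times> ?T) (\<lambda>x. c (snd x))" "continuous_on ({0..1::real} \<times> ?T) (\<lambda>x. U (snd x))"
      by (rule continuous_on_compose2[OF c_cont continuous_on_snd[OF continuous_on_id]], force)
        (rule continuous_on_compose2[OF U(1) continuous_on_snd[OF continuous_on_id]], force)
    then show "continuous_on ({0..1} \<times> ?T) (\<lambda>(\<tau>, p). e \<tau> p)"
      unfolding e_def case_prod_unfold by (intro continuous_intros)
    fix \<tau> :: real assume \<tau>: "\<tau> \<in> {0..1}"
    have convex: "cmod (of_real (1 - \<tau>) * x + of_real \<tau> * y) \<le> (1 - \<tau>) * cmod x + \<tau> * cmod y" for x y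
      using norm_triangle_ineq[of "of_real (1 - \<tau>) * x" "of_real \<tau> * y"] \<tau> unfolding norm_mult norm_of_real by simp
    show "geometric_braid s r (e \<tau>)"
    proof (rule close)
      show "continuous_on ?T (e \<tau>)" unfolding e_def by (intro continuous_intros c_cont U)
      show "cmod (e \<tau> p) < 1" if p: "p \<in> ?T" for p
      proof -
        have "(1 - \<tau>) * cmod (c p) + \<tau> * cmod (of_real \<rho> * U p) < 1"
          by (rule convex_bound_lt[OF c_less[OF p] U_less[OF p]]) (use \<tau> in auto)
        then show ?thesis unfolding e_def using convex[of "c p" "of_real \<rho> * U p"] by linarith
      qed
      show "cmod (e \<tau> p - of_real \<rho> * \<zeta> (snd p)) \<le> \<rho> * (d / 4)" if p: "p \<in> ?T" for p
      proof -
        have "e \<tau> p - of_real \<rho> * \<zeta> (snd p) = of_real (1 - \<tau>) * (c p - of_real \<rho> * \<zeta> (snd p)) +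
            of_real \<tau> * (of_real \<rho> * U p - of_real \<rho> * \<zeta> (snd p))"
          by (simp add: e_def algebra_simps)
        then have "cmod (e \<tau> p - of_real \<rho> * \<zeta> (snd p)) \<le> (1 - \<tau>) * cmod (c p - of_real \<rho> * \<zeta> (snd p)) +
            \<tau> * cmod (of_real \<rho> * U p - of_real \<rho> * \<zeta> (snd p))"
          using convex by simp
        also have "\<dots> \<le> \<rho> * (d / 4)"
          by (rule convex_bound_le[OF c_near[OF p] U_near[OF p]]) (use \<tau> in auto)
        finally show ?thesis .
      qed
    qed
  qed
  moreover have "e 0 = c" "e 1 = (\<lambda>p. of_real \<rho> * U p)" by (simp_all add: e_def)
  ultimately have 1: "ambient_isotopic_in (sphere 0 1) (closed_braid s r c) (closed_braid s r (\<lambda>p. of_real \<rho> * U p))"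
    by simp
  define A where "A = (\<lambda>(\<tau>::real) (p::complex \<times> complex). of_real (1 - \<tau>) * (of_real R + \<zeta> (snd p)) + of_real \<tau> * (1 + of_real \<rho> * \<zeta> (snd p)))"
  have A_pos: "0 < Re (A \<tau> p)" if p: "p \<in> ?T" and \<tau>: "\<tau> \<in> {0..1}" for \<tau> p
  proof -
    have "Re (A \<tau> p) = (1 - \<tau>) * (R + Re (\<zeta> (snd p))) + \<tau> * Re (1 + of_real \<rho> * \<zeta> (snd p))"
      by (simp add: A_def)
    moreover have "0 \<le> (1 - \<tau>) * (R + Re (\<zeta> (snd p)))" "0 \<le> \<tau> * Re (1 + of_real \<rho> * \<zeta> (snd p))"
      using \<tau> R[OF p] pos[OF p] by (auto intro!: mult_nonneg_nonneg)
    moreover have "0 < (1 - \<tau>) * (R + Re (\<zeta> (snd p)))" if "\<tau> < 1" using that R[OF p] by simp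
    moreover have "0 < \<tau> * Re (1 + of_real \<rho> * \<zeta> (snd p))" if "0 < \<tau>" using that pos[OF p] by (intro mult_pos_pos)
    ultimately show ?thesis by (cases "\<tau> < 1") auto
  qed
  have "ambient_isotopic_in (sphere 0 1) (closed_braid s r ((\<lambda>\<tau> p. half_plane_to_disc (A \<tau> p)) 0))
      (closed_braid s r ((\<lambda>\<tau> p. half_plane_to_disc (A \<tau> p)) 1))"
  proof (rule ambient_isotopic_braid_path[OF s])
    have "continuous_on ({0..1::real} \<times> ?T) (\<lambda>x. \<zeta> (snd (snd x)))"
      by (rule continuous_on_compose2[OF cont\<zeta> continuous_on_snd[OF continuous_on_id]]) force
    then show "continuous_on ({0..1} \<times> ?T) (\<lambda>(\<tau>, p). half_plane_to_disc (A \<tau> p))"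
      unfolding A_def case_prod_unfold by (intro continuous_intros)
    fix \<tau> :: real assume \<tau>: "\<tau> \<in> {0..1}"
    have "t = t'" if p: "(w, t) \<in> ?T" "(w, t') \<in> ?T"
      and eq: "half_plane_to_disc (A \<tau> (w, t)) = half_plane_to_disc (A \<tau> (w, t'))" for w t t'
    proof -
      have "A \<tau> (w, t) = A \<tau> (w, t')"
        using half_plane_to_disc_inj[OF A_pos[OF p(1) \<tau>] A_pos[OF p(2) \<tau>] eq] .
      then have "of_real (1 - \<tau> + \<tau> * \<rho>) * \<zeta> t = of_real (1 - \<tau> + \<tau> * \<rho>) * \<zeta> t'"
        by (simp add: A_def algebra_simps)
      moreover have "1 - \<tau> + \<tau> * \<rho> > 0"
        using \<tau> \<rho>(1) by (cases "\<tau> < 1") (auto intro: add_pos_nonneg)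
      ultimately have "\<zeta> t = \<zeta> t'" by (simp del: of_real_add of_real_diff)
      then show ?thesis using inj p by blast
    qed
    moreover have "continuous_on ?T (\<lambda>p. half_plane_to_disc (A \<tau> p))"
      unfolding A_def by (intro continuous_intros cont\<zeta>)
    ultimately show "geometric_braid s r (\<lambda>p. half_plane_to_disc (A \<tau> p))"
      unfolding geometric_braid_def using half_plane_to_disc(3)[OF A_pos[OF _ \<tau>]] by blast
  qed
  moreover have "(\<lambda>p. half_plane_to_disc (A 1 p)) = c" by (simp add: A_def c_def)
  moreover have "(\<lambda>p. half_plane_to_disc (A 0 p)) = (\<lambda>p. half_plane_to_disc (of_real R + \<zeta> (snd p)))"
    by (simp add: A_def)
  ultimately have 2: "ambient_isotopic_in (sphere 0 1)
      (closed_braid s r (\<lambda>p. half_plane_to_disc (of_real R + \<zeta> (snd p)))) (closed_braid s r c)" by simp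
  show "ambient_isotopic_in (sphere 0 1) (closed_braid s r (\<lambda>p. of_real \<rho> * U p))
           (closed_braid s r (\<lambda>p. half_plane_to_disc (of_real R + \<zeta> (snd p))))"
    by (rule ambient_isotopic_in_sym[OF ambient_isotopic_in_trans[OF 2 1]])
qed

lemma f1_braid_polynomial:
  assumes "0 < s" "0 < l" "coprime s l" "even r" "0 < a" "0 < b"
  shows "braid_polynomial s r (mixed_eval (f1 s r l a b)) (Poly_Mapping.keys (f1 s r l a b) - {(s, 0, 0)})
    (Poly_Mapping.lookup (f1 s r l a b)) (lissajous l a b)"
proof
  show "i < s \<and> even m \<and> even n" if "(i, m, n) \<in> Poly_Mapping.keys (f1 s r l a b) - {(s, 0, 0)}" for i m n
    using keys_f1(1)[OF assms(1,4), of i m n l a b] that by (auto simp: le_less)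
  show "continuous_on (sphere 0 1) (lissajous l a b)"
    unfolding lissajous_def Complex_eq by (intro continuous_intros)
  show "0 < s" by fact
  show "mixed_eval (f1 s r l a b) u v = u ^ s + (\<Sum>(i, m, n)\<in>Poly_Mapping.keys (f1 s r l a b) - {(s, 0, 0)}.
      Poly_Mapping.lookup (f1 s r l a b) (i, m, n) * u ^ i * v ^ m * cnj v ^ n)" for u v
    by (rule mixed_eval_f1_monic[OF assms(1,4)])
  show "mixed_eval (f1 s r l a b) u w = (\<Prod>t\<in>fibre s r w. u - lissajous l a b t)" if "cmod w = 1" for u w
    by (rule f1_unit_circle[OF assms(1) that])
  show "t = t'" if "t \<in> fibre s r w" "t' \<in> fibre s r w" "lissajous l a b t = lissajous l a b t'" for w t t'
    by (rule lissajous_inj_on_fibre[OF assms(1,2,3,5,6) that])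
qed

section \<open>The polynomial extension\<close>
lemma norm_real2_of [simp]: "norm (real2_of w) = cmod w"
  by (simp add: real2_of_def norm_vec_def L2_set_def sum_2 cmod_def)

lemma real2_of_eq_0 [simp]: "real2_of w = 0 \<longleftrightarrow> w = 0"
  using norm_real2_of[of w] by (metis norm_eq_zero)

text \<open>Real and imaginary parts are recorded separately, so that complex products of polynomial functions can be formed.\<close>
definition complex_polynomial_function :: "('a::real_normed_vector \<Rightarrow> complex) \<Rightarrow> bool" where
  "complex_polynomial_function g \<longleftrightarrow>
     real_polynomial_function (\<lambda>x. Re (g x)) \<and> real_polynomial_function (\<lambda>x. Im (g x))"

lemma complex_polynomial_function_of_real:
  "real_polynomial_function g \<Longrightarrow> complex_polynomial_function (\<lambda>x. of_real (g x))"
  by (auto simp: complex_polynomial_function_def)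

lemma complex_polynomial_function_const: "complex_polynomial_function (\<lambda>x. c)"
  by (auto simp: complex_polynomial_function_def)

lemma complex_polynomial_function_add:
  "complex_polynomial_function f \<Longrightarrow> complex_polynomial_function g \<Longrightarrow> complex_polynomial_function (\<lambda>x. f x + g x)"
  by (auto simp: complex_polynomial_function_def)

lemma complex_polynomial_function_mult:
  "complex_polynomial_function f \<Longrightarrow> complex_polynomial_function g \<Longrightarrow> complex_polynomial_function (\<lambda>x. f x * g x)"
  by (auto simp: complex_polynomial_function_def)

lemma complex_polynomial_function_cnj:
  "complex_polynomial_function f \<Longrightarrow> complex_polynomial_function (\<lambda>x. cnj (f x))"
  by (auto simp: complex_polynomial_function_def)

lemma complex_polynomial_function_power:
  "complex_polynomial_function f \<Longrightarrow> complex_polynomial_function (\<lambda>x. f x ^ n)"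
  by (induction n) (auto intro: complex_polynomial_function_mult complex_polynomial_function_const)

lemma complex_polynomial_function_sum:
  "(\<And>i. i \<in> I \<Longrightarrow> complex_polynomial_function (\<lambda>x. f i x)) \<Longrightarrow> complex_polynomial_function (\<lambda>x. \<Sum>i\<in>I. f i x)"
  by (induction I rule: infinite_finite_induct)
    (auto intro: complex_polynomial_function_add complex_polynomial_function_const)

lemma polynomial_function_real2_of:
  assumes "complex_polynomial_function g" shows "polynomial_function (\<lambda>x. real2_of (g x))"
  unfolding polynomial_function_iff_Basis_inner
proof
  fix b :: "real ^ 2" assume "b \<in> Basis"
  then obtain i where b: "b = axis i 1" by (auto simp: Basis_vec_def)
  have "i = 1 \<or> i = 2" by (rule exhaust_2)
  then show "real_polynomial_function (\<lambda>x. real2_of (g x) \<bullet> b)"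
    using assms by (auto simp: b inner_axis real2_of_def complex_polynomial_function_def)
qed

lemma real_polynomial_function_nth: "real_polynomial_function (\<lambda>x::real ^ 'n. x $ i)"
  by (rule real_polynomial_function.intros(1)) (rule bounded_linear_vec_nth)

lemma complex_polynomial_function_u_of: "complex_polynomial_function u_of"
  and complex_polynomial_function_v_of: "complex_polynomial_function v_of"
  by (simp_all add: complex_polynomial_function_def u_of_def v_of_def real_polynomial_function_nth)

lemma norm_real4: "(norm x)\<^sup>2 = (cmod (u_of x))\<^sup>2 + (cmod (v_of x))\<^sup>2"
  unfolding rho_eq_norm[of x, symmetric] by (simp add: rho_def)

lemma real_polynomial_function_norm_power2: "real_polynomial_function (\<lambda>x::real ^ 4. (norm x)\<^sup>2)"
proof -
  have "(\<lambda>x::real ^ 4. (norm x)\<^sup>2) = (\<lambda>x. (x $ 1)\<^sup>2 + (x $ 2)\<^sup>2 + (x $ 3)\<^sup>2 + (x $ 4)\<^sup>2)"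
    unfolding norm_real4 by (simp add: u_of_def v_of_def cmod_power2 add.assoc)
  then show ?thesis
    by (simp only:) (intro real_polynomial_function.intros(3) real_polynomial_function_power real_polynomial_function_nth)
qed

text \<open>The monomial \<open>(i, m, n)\<close> acquires the factor \<open>\<rho>\<close> to the power \<open>N + s + deg - 2i - m - n\<close>. The power is nonnegative because
\<open>i \<le> s\<close> and \<open>i + m + n \<le> deg\<close>, and with \<open>m\<close>, \<open>n\<close> even it is even as soon as \<open>N\<close> has the parity of \<open>s + deg\<close>.\<close>
lemma exists_polynomial_extension:
  assumes s: "0 < s" and r: "even r"
  shows "\<exists>N G. polynomial_function G \<and> extends_F s r l a b N G"
proof -
  define f where "f = f1 s r l a b"
  define N where "N = (s + total_deg f) mod 2"
  define e where "e = (\<lambda>i m n. (N + s + total_deg f - m - n) div 2 - i)"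
  define g where "g = (\<lambda>x::real ^ 4. \<Sum>(i, m, n)\<in>Poly_Mapping.keys f.
    Poly_Mapping.lookup f (i, m, n) * of_real ((norm x)\<^sup>2) ^ e i m n * u_of x ^ i * v_of x ^ m * cnj (v_of x) ^ n)"
  have "complex_polynomial_function g"
    unfolding g_def case_prod_unfold
    by (intro complex_polynomial_function_sum complex_polynomial_function_mult complex_polynomial_function_power
        complex_polynomial_function_cnj complex_polynomial_function_const complex_polynomial_function_u_of
        complex_polynomial_function_v_of complex_polynomial_function_of_real real_polynomial_function_norm_power2)
  then have poly: "polynomial_function (\<lambda>x. real2_of (g x))" by (rule polynomial_function_real2_of)
  have "of_real (norm x ^ N) * F s r l a b (u_of x) (v_of x) = g x" if x: "x \<noteq> 0" for x
  proof -
    let ?\<rho> = "complex_of_real (norm x)"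
    have \<rho>: "?\<rho> \<noteq> 0" using x by simp
    have "of_real (norm x ^ N) * F s r l a b (u_of x) (v_of x) =
        ?\<rho> ^ (N + s + total_deg f) * mixed_eval f (u_of x / of_real ((norm x)\<^sup>2)) (v_of x / of_real (norm x))"
      by (simp add: F_def rho_eq_norm f_def power_add)
    also have "\<dots> = g x"
      unfolding mixed_eval_def g_def sum_distrib_left
    proof (intro sum.cong refl)
      fix j assume "j \<in> Poly_Mapping.keys f"
      obtain i m n where j: "j = (i, m, n)" by (cases j)
      then have k: "i \<le> s" "even m" "even n" "i + m + n \<le> total_deg f"
        using \<open>j \<in> _\<close> keys_f1(1)[OF s r, of i m n l a b] le_total_deg[of i m n f] by (auto simp: f_def)
      have "even (N + s + total_deg f)" by (simp add: N_def) presburger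
      then have "even (N + s + total_deg f - m - n)" using k by simp
      then obtain q where q: "N + s + total_deg f - m - n = 2 * q" by (elim evenE)
      then have "e i m n = q - i" by (simp add: e_def)
      then have "2 * e i m n + 2 * i + m + n = N + s + total_deg f" using q k(1,4) by linarith
      then have "?\<rho> ^ (N + s + total_deg f) = (?\<rho>\<^sup>2) ^ e i m n * (?\<rho>\<^sup>2) ^ i * ?\<rho> ^ m * ?\<rho> ^ n"
        by (metis power_add power_mult)
      then show "?\<rho> ^ (N + s + total_deg f) * (case j of (i, m, n) \<Rightarrow> Poly_Mapping.lookup f (i, m, n) *
            (u_of x / of_real ((norm x)\<^sup>2)) ^ i * (v_of x / of_real (norm x)) ^ m * cnj (v_of x / of_real (norm x)) ^ n) =
          (case j of (i, m, n) \<Rightarrow> Poly_Mapping.lookup f (i, m, n) * of_real ((norm x)\<^sup>2) ^ e i m n *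
            u_of x ^ i * v_of x ^ m * cnj (v_of x) ^ n)"
        using \<rho> by (simp add: j power_divide)
    qed
    finally show ?thesis .
  qed
  then have "extends_F s r l a b N (\<lambda>x. real2_of (g x))"
    by (simp add: extends_F_def rho_eq_norm)
  then show ?thesis using poly by blast
qed

lemma extends_F_norm:
  assumes "extends_F s r l a b N G" "x \<noteq> 0"
  shows "norm (G x) = norm x ^ (N + s + total_deg (f1 s r l a b)) *
    cmod (mixed_eval (f1 s r l a b) (u_of x / of_real ((norm x)\<^sup>2)) (v_of x / of_real (norm x)))"
  using assms by (simp add: extends_F_def rho_eq_norm F_def norm_mult norm_power power_add)

text \<open>Since \<open>|u| \<le> \<rho>\<close>, the factor \<open>(u / \<rho>\<^sup>2) ^ i\<close> costs at most \<open>i \<le> s\<close> of the \<open>N + s + deg\<close> powers of \<open>\<rho>\<close>, and \<open>deg \<ge> 2\<close>.\<close>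
lemma extends_F_quadratic_bound:
  assumes s: "0 < s" and r: "even r" "0 < r" and a: "a \<noteq> 0" and G: "extends_F s r l a b N G"
  obtains C where "0 < C" "\<And>x. x \<noteq> 0 \<Longrightarrow> norm x \<le> 1 \<Longrightarrow> norm (G x) \<le> C * (norm x)\<^sup>2"
proof -
  define f where "f = f1 s r l a b"
  define C where "C = 1 + (\<Sum>j\<in>Poly_Mapping.keys f. cmod (Poly_Mapping.lookup f j))"
  show ?thesis
  proof
    show "0 < C" unfolding C_def by (simp add: sum_nonneg add_pos_nonneg)
    fix x :: "real ^ 4" assume x: "x \<noteq> 0" "norm x \<le> 1"
    let ?E = "N + s + total_deg f"
    have \<rho>: "0 < norm x" using x by simp
    have u: "cmod (u_of x / of_real ((norm x)\<^sup>2)) \<le> 1 / norm x"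
    proof -
      have "cmod (u_of x) \<le> norm x" by (rule power2_le_imp_le) (simp_all add: norm_real4)
      then have "cmod (u_of x) / (norm x)\<^sup>2 \<le> norm x / (norm x)\<^sup>2" by (rule divide_right_mono) simp
      then show ?thesis unfolding norm_divide norm_of_real using \<rho> by (simp add: power2_eq_square)
    qed
    have v: "cmod (v_of x / of_real (norm x)) \<le> 1"
    proof -
      have "cmod (v_of x) \<le> norm x" by (rule power2_le_imp_le) (simp_all add: norm_real4)
      then show ?thesis using \<rho> by (simp add: norm_divide)
    qed
    have "norm (G x) = norm x ^ ?E * cmod (mixed_eval f (u_of x / of_real ((norm x)\<^sup>2)) (v_of x / of_real (norm x)))"
      unfolding f_def by (rule extends_F_norm[OF G x(1)])
    also have "\<dots> = cmod (\<Sum>j\<in>Poly_Mapping.keys f. of_real (norm x ^ ?E) * (case j of (i, m, n) \<Rightarrow> Poly_Mapping.lookup f (i, m, n) *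
        (u_of x / of_real ((norm x)\<^sup>2)) ^ i * (v_of x / of_real (norm x)) ^ m * cnj (v_of x / of_real (norm x)) ^ n))"
      unfolding mixed_eval_def sum_distrib_left[symmetric] by (simp add: norm_mult norm_power)
    also have "\<dots> \<le> (\<Sum>j\<in>Poly_Mapping.keys f. cmod (Poly_Mapping.lookup f j) * (norm x)\<^sup>2)"
    proof (rule sum_norm_le)
      fix j assume "j \<in> Poly_Mapping.keys f"
      obtain i m n where j: "j = (i, m, n)" by (cases j)
      have i: "i \<le> s" using keys_f1(1)[OF s r(1), of i m n l a b] \<open>j \<in> _\<close> j by (simp add: f_def)
      have D: "2 \<le> total_deg f" unfolding f_def by (rule total_deg_f1_ge_2[OF s r a])
      have "cmod (of_real (norm x ^ ?E) * (Poly_Mapping.lookup f (i, m, n) * (u_of x / of_real ((norm x)\<^sup>2)) ^ i *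
          (v_of x / of_real (norm x)) ^ m * cnj (v_of x / of_real (norm x)) ^ n)) \<le>
          norm x ^ ?E * (cmod (Poly_Mapping.lookup f (i, m, n)) * (1 / norm x) ^ i * 1 ^ m * 1 ^ n)"
        unfolding norm_mult norm_power complex_mod_cnj norm_of_real abs_norm_cancel power_abs
        by (intro mult_mono power_mono u v order_refl mult_nonneg_nonneg zero_le_power) auto
      also have "\<dots> = cmod (Poly_Mapping.lookup f (i, m, n)) * norm x ^ (?E - i)"
        using \<rho> i by (simp add: power_diff power_divide)
      also have "\<dots> \<le> cmod (Poly_Mapping.lookup f (i, m, n)) * (norm x)\<^sup>2"
        using i D x by (intro mult_left_mono power_decreasing) auto
      finally show "cmod (of_real (norm x ^ ?E) * (case j of (i, m, n) \<Rightarrow> Poly_Mapping.lookup f (i, m, n) *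
        (u_of x / of_real ((norm x)\<^sup>2)) ^ i * (v_of x / of_real (norm x)) ^ m * cnj (v_of x / of_real (norm x)) ^ n)) \<le>
        cmod (Poly_Mapping.lookup f j) * (norm x)\<^sup>2" by (simp only: j prod.case)
    qed
    also have "\<dots> \<le> C * (norm x)\<^sup>2"
      unfolding C_def by (simp add: sum_distrib_right distrib_right)
    finally show "norm (G x) \<le> C * (norm x)\<^sup>2" .
  qed
qed

section \<open>Singular and regular points\<close>
lemma singular_zero_of_quadratic_bound:
  fixes G :: "real ^ 4 \<Rightarrow> real ^ 2"
  assumes cont: "isCont G 0" and C: "0 < C"
    and bound: "\<And>x. x \<noteq> 0 \<Longrightarrow> norm x \<le> 1 \<Longrightarrow> norm (G x) \<le> C * (norm x)\<^sup>2"
  shows "G 0 = 0" and "singular_point G 0"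
proof -
  have "((\<lambda>x. G x) \<longlongrightarrow> 0) (at 0)"
  proof (rule Lim_null_comparison)
    show "\<forall>\<^sub>F x in at 0. norm (G x) \<le> C * (norm x)\<^sup>2"
      unfolding eventually_at by (intro exI[of _ 1]) (auto intro!: bound)
    have "((\<lambda>x::real ^ 4. C * (norm x)\<^sup>2) \<longlongrightarrow> C * (norm (0::real ^ 4))\<^sup>2) (at 0)"
      by (intro tendsto_intros)
    then show "((\<lambda>x::real ^ 4. C * (norm x)\<^sup>2) \<longlongrightarrow> 0) (at 0)" by simp
  qed
  moreover have "((\<lambda>x. G x) \<longlongrightarrow> G 0) (at 0)" using cont by (simp add: isCont_def)
  ultimately show G0: "G 0 = 0" using tendsto_unique[OF trivial_limit_at] by blast
  have "(G has_derivative (\<lambda>_. 0)) (at 0)"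
    unfolding has_derivative_at_alt
  proof (intro conjI allI impI)
    fix e :: real assume e: "0 < e"
    show "\<exists>d>0. \<forall>y. norm (y - 0) < d \<longrightarrow> norm (G y - G 0 - 0) \<le> e * norm (y - 0)"
    proof (intro exI[of _ "min 1 (e / C)"] conjI allI impI)
      fix y :: "real ^ 4" assume y: "norm (y - 0) < min 1 (e / C)"
      show "norm (G y - G 0 - 0) \<le> e * norm (y - 0)"
      proof (cases "y = 0")
        case False
        have "norm (G y) \<le> C * norm y * norm y" using bound[OF False] y by (simp add: power2_eq_square mult.assoc)
        also have "\<dots> \<le> e * norm y" using y C by (intro mult_right_mono) (auto simp: field_simps)
        finally show ?thesis using G0 by simp
      qed simp
    qed (use e C in auto)
  qed simp
  then have "frechet_derivative G (at 0) = (\<lambda>_. 0)" by (rule frechet_derivative_at[symmetric])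
  then have "jacobian G (at 0) = 0" by (simp add: jacobian_def matrix_def vec_eq_iff)
  then show "singular_point G 0" by (simp add: singular_point_def)
qed

text \<open>A direction in the kernel of the derivative would make \<open>f\<close> smaller than linear along a ray.\<close>
lemma has_derivative_lower_bound_inj:
  assumes der: "(f has_derivative f') (at x)" and fx: "f x = 0" and "0 < m" "0 < \<eta>"
    and lower: "\<And>y. norm (y - x) < \<eta> \<Longrightarrow> m * norm (y - x) \<le> norm (f y)" and h: "f' h = 0"
  shows "h = 0"
proof (rule ccontr)
  assume "h \<noteq> 0"
  obtain d where d: "0 < d" "\<And>y. norm (y - x) < d \<Longrightarrow> norm (f y - f x - f' (y - x)) \<le> m / 2 * norm (y - x)"
    using der \<open>0 < m\<close> unfolding has_derivative_at_alt by (meson half_gt_zero)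
  define t where "t = min d \<eta> / (2 * norm h)"
  have t: "0 < t" using d(1) \<open>0 < \<eta>\<close> \<open>h \<noteq> 0\<close> by (simp add: t_def)
  have th: "norm (t *\<^sub>R h) < d" "norm (t *\<^sub>R h) < \<eta>" "t *\<^sub>R h \<noteq> 0"
    using t d(1) \<open>0 < \<eta>\<close> \<open>h \<noteq> 0\<close> by (auto simp: t_def)
  have "f' (t *\<^sub>R h) = 0" using der h by (metis has_derivative_linear linear_scale scaleR_zero_right)
  then have "m * norm (t *\<^sub>R h) \<le> m / 2 * norm (t *\<^sub>R h)"
    using d(2)[of "x + t *\<^sub>R h"] lower[of "x + t *\<^sub>R h"] th fx by simp
  then show False using \<open>0 < m\<close> th(3) by (auto simp: mult_le_0_iff)
qed

text \<open>If \<open>G\<close> grows at least linearly along a surface through the point, the derivative of \<open>G\<close> along the surface is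
injective, so that of \<open>G\<close> has a range of dimension at least 2.\<close>
lemma regular_point_of_slice:
  fixes G :: "real ^ 4 \<Rightarrow> real ^ 2" and X :: "complex \<Rightarrow> real ^ 4"
  assumes G: "G differentiable (at (X a))" and X: "X differentiable (at a)" and zero: "G (X a) = 0"
    and "0 < m" "0 < \<eta>" and lower: "\<And>u. cmod (u - a) < \<eta> \<Longrightarrow> m * cmod (u - a) \<le> norm (G (X u))"
  shows "\<not> singular_point G (X a)"
proof -
  define G' where "G' = frechet_derivative G (at (X a))"
  have G': "(G has_derivative G') (at (X a))" using G by (simp add: G'_def frechet_derivative_works)
  obtain X' where X': "(X has_derivative X') (at a)" using X by (auto simp: differentiable_def)
  have GX: "(G \<circ> X has_derivative G' \<circ> X') (at a)" by (rule diff_chain_at[OF X' G'])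
  have lin: "linear (G' \<circ> X')" "linear G'" using GX G' has_derivative_linear by blast+
  have "inj (G' \<circ> X')"
    unfolding linear_injective_0[OF lin(1)]
    using has_derivative_lower_bound_inj[OF GX _ \<open>0 < m\<close> \<open>0 < \<eta>\<close>] zero lower by simp
  then have "dim (range (G' \<circ> X')) = 2"
    using dim_image_eq[OF lin(1), of UNIV] by (simp add: inj_on_def)
  moreover have "range (G' \<circ> X') \<subseteq> range G'" by auto
  ultimately have "2 \<le> dim (range G')" by (metis dim_subset)
  moreover have "range (\<lambda>x. matrix G' *v x) = range G'" using lin(2) by simp
  ultimately show ?thesis
    by (simp add: singular_point_def jacobian_def rank_dim_range flip: G'_def)
qed

lemma differentiable_real4_of:
  fixes f g :: "complex \<Rightarrow> complex"
  assumes "f differentiable (at a)" "g differentiable (at a)"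
  shows "(\<lambda>u. real4_of (f u) (g u)) differentiable (at a)"
proof -
  have "linear (\<lambda>p. real4_of (fst p) (snd p))"
    by (rule linearI) (simp_all add: real4_of_def vec_eq_iff forall_4)
  then have "(\<lambda>p. real4_of (fst p) (snd p)) differentiable (at (f a, g a))"
    by (intro bounded_linear_imp_differentiable) (simp add: linear_conv_bounded_linear)
  moreover have "(\<lambda>u. (f u, g u)) differentiable (at a)" using assms by (rule differentiable_Pair)
  ultimately have "(\<lambda>p. real4_of (fst p) (snd p)) \<circ> (\<lambda>u. (f u, g u)) differentiable (at a)"
    by (intro differentiable_chain_at)
  then show ?thesis by (simp add: o_def)
qed

lemma differentiable_shell_root:
  fixes a :: complex
  assumes "\<rho>\<^sup>2 * (cmod a)\<^sup>2 < 1"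
  shows "(\<lambda>u. complex_of_real (sqrt (1 - \<rho>\<^sup>2 * (cmod u)\<^sup>2))) differentiable (at a)"
proof -
  have "((\<lambda>u::complex. 1 - \<rho>\<^sup>2 * (u \<bullet> u)) has_derivative (\<lambda>h. 0 - \<rho>\<^sup>2 * (a \<bullet> h + h \<bullet> a))) (at a)"
    by (intro derivative_intros)
  then have "((\<lambda>u. 1 - \<rho>\<^sup>2 * (cmod u)\<^sup>2) has_derivative (\<lambda>h. 0 - \<rho>\<^sup>2 * (a \<bullet> h + h \<bullet> a))) (at a)"
    by (simp only: power2_norm_eq_inner)
  from has_derivative_of_real[OF has_derivative_real_sqrt[OF _ this]] assms
  show ?thesis by (auto simp: differentiable_def)
qed

section \<open>Weakly isolated singularities with lemniscate links\<close>
theorem mainTheorem3: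
  fixes s r l :: nat and a b :: real
  assumes "0 < s" and "0 < r" and "0 < l"
    and "coprime s l" and "even r"
    and "0 < a" and "0 < b"
  shows "(\<exists>N G. polynomial_function G \<and> extends_F s r l a b N G) \<and>
    (\<forall>N G. polynomial_function G \<and> extends_F s r l a b N G \<longrightarrow>
       weakly_isolated_singularity G 0 \<and>
       (\<exists>\<epsilon>>0. \<forall>\<rho>\<^sub>0. 0 < \<rho>\<^sub>0 \<and> \<rho>\<^sub>0 < \<epsilon> \<longrightarrow>
          (let K = (\<lambda>x. x /\<^sub>R \<rho>\<^sub>0) ` (sphere 0 \<rho>\<^sub>0 \<inter> {x. G x = 0}) in
           is_link K \<and>
           (\<forall>R. admissible_radius s r l a b R \<longrightarrow>
              ambient_isotopic_in (sphere 0 1) K (lemniscate_link s r l a b R)))))"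
proof (intro conjI allI impI)
  show "\<exists>N G. polynomial_function G \<and> extends_F s r l a b N G"
    by (rule exists_polynomial_extension[OF \<open>0 < s\<close> \<open>even r\<close>])
  define f where "f = mixed_eval (f1 s r l a b)"
  define \<zeta> where "\<zeta> = lissajous l a b"
  let ?T = "torus_curve s r"
  interpret braid_polynomial s r f "Poly_Mapping.keys (f1 s r l a b) - {(s, 0, 0)}"
    "Poly_Mapping.lookup (f1 s r l a b)" \<zeta>
    unfolding f_def \<zeta>_def by (rule f1_braid_polynomial) fact+
  have T1: "cmod (fst p) = 1" "cmod (snd p) = 1" if "p \<in> ?T" for p
    using that by (auto simp: torus_curve_def fibre_def)
  have cont\<zeta>: "continuous_on ?T (\<lambda>p. \<zeta> (snd p))"
    by (rule continuous_on_compose2[OF continuous_\<zeta>]) (use T1 in \<open>auto intro!: continuous_intros\<close>)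
  obtain d where d: "0 < d"
    "\<And>w t t'. (w, t) \<in> ?T \<Longrightarrow> (w, t') \<in> ?T \<Longrightarrow> t \<noteq> t' \<Longrightarrow> d \<le> cmod (\<zeta> (snd (w, t)) - \<zeta> (snd (w, t')))"
    by (rule strands_separated[OF s cont\<zeta>]) (use inj_\<zeta> in \<open>auto simp: torus_curve_def\<close>)
  have "bounded (\<zeta> ` sphere 0 1)"
    by (intro compact_imp_bounded compact_continuous_image continuous_\<zeta> compact_sphere)
  then obtain B where B: "0 < B" "\<And>t. cmod t = 1 \<Longrightarrow> cmod (\<zeta> t) \<le> B"
    unfolding bounded_pos by auto
  obtain \<rho>\<^sub>1 where \<rho>\<^sub>1: "0 < \<rho>\<^sub>1"
    and strands: "\<And>\<rho>. 0 < \<rho> \<Longrightarrow> \<rho> < \<rho>\<^sub>1 \<Longrightarrow> \<exists>U. zero_strands (d / 4) \<rho> U"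
    by (rule exists_zero_strands[of "d / 4"]) (use d(1) in simp, rule that)
  fix N G assume "polynomial_function G \<and> extends_F s r l a b N G"
  then have poly: "polynomial_function G" and G: "extends_F s r l a b N G" by auto
  \<comment> \<open>the surface \<open>u \<mapsto> (\<rho>\<^sup>2 u, \<rho> w shell_root \<rho> u)\<close> lies in the sphere of radius \<open>\<rho>\<close>; there \<open>G\<close> is \<open>f\<close> on the ellipsoid times \<open>\<rho>\<close> to the power \<open>E\<close>\<close>
  define E where "E = N + s + total_deg (f1 s r l a b)"
  have norm_G: "norm (G x) = norm x ^ E * cmod (f (u_of x / of_real ((norm x)\<^sup>2)) (v_of x / of_real (norm x)))"
    if "x \<noteq> 0" for x
    unfolding E_def f_def by (rule extends_F_norm[OF G that])
  have shell: "\<rho>\<^sup>2 * (cmod (u_of x / of_real (\<rho>\<^sup>2)))\<^sup>2 + (cmod (v_of x / of_real \<rho>))\<^sup>2 = 1"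
    if "0 < \<rho>" "norm x = \<rho>" for x \<rho>
  proof -
    have "(cmod (u_of x))\<^sup>2 + (cmod (v_of x))\<^sup>2 = \<rho>\<^sup>2" using norm_real4[of x] that by simp
    then have "(cmod (u_of x))\<^sup>2 / \<rho>\<^sup>2 + (cmod (v_of x))\<^sup>2 / \<rho>\<^sup>2 = 1"
      using that(1) by (simp flip: add_divide_distrib)
    then show ?thesis using that(1) unfolding norm_divide norm_of_real power_divide
      by (simp add: power2_eq_square)
  qed
  have norm_shell_point: "norm (real4_of (of_real (\<rho>\<^sup>2) * u) (of_real \<rho> * (w * of_real (shell_root \<rho> u)))) = \<rho>"
    if "0 < \<rho>" "\<rho> * cmod u < 1" "cmod w = 1" for \<rho> u w
  proof -
    have "(\<rho> * cmod u)\<^sup>2 \<le> 1" using that by (simp add: abs_square_le_1)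
    then have "(shell_root \<rho> u)\<^sup>2 = 1 - \<rho>\<^sup>2 * (cmod u)\<^sup>2" by (simp add: shell_root_def power_mult_distrib)
    then have 1: "\<rho>\<^sup>2 * (cmod u)\<^sup>2 + (shell_root \<rho> u)\<^sup>2 = 1" by simp
    have "(norm (real4_of (of_real (\<rho>\<^sup>2) * u) (of_real \<rho> * (w * of_real (shell_root \<rho> u)))))\<^sup>2 =
        \<rho>\<^sup>2 * (\<rho>\<^sup>2 * (cmod u)\<^sup>2 + (shell_root \<rho> u)\<^sup>2)"
      unfolding norm_real4 u_of_real4_of v_of_real4_of norm_mult norm_of_real power_mult_distrib power2_abs
        \<open>cmod w = 1\<close> by (simp add: power2_eq_square algebra_simps)
    also have "\<dots> = \<rho>\<^sup>2" unfolding 1 by simp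
    finally have "(norm (real4_of (of_real (\<rho>\<^sup>2) * u) (of_real \<rho> * (w * of_real (shell_root \<rho> u)))))\<^sup>2 = \<rho>\<^sup>2" .
    then show ?thesis by (rule power2_eq_imp_eq) (use that in auto)
  qed
  have norm_G_shell_point: "norm (G (real4_of (of_real (\<rho>\<^sup>2) * u) (of_real \<rho> * (w * of_real (shell_root \<rho> u))))) =
      \<rho> ^ E * cmod (f u (w * of_real (shell_root \<rho> u)))"
    if "0 < \<rho>" "\<rho> * cmod u < 1" "cmod w = 1" for \<rho> u w
  proof -
    define x where "x = real4_of (of_real (\<rho>\<^sup>2) * u) (of_real \<rho> * (w * of_real (shell_root \<rho> u)))"
    have x: "norm x = \<rho>" unfolding x_def by (rule norm_shell_point[OF that])
    then have "x \<noteq> 0" using that(1) by auto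
    moreover have "u_of x / of_real ((norm x)\<^sup>2) = u" "v_of x / of_real (norm x) = w * of_real (shell_root \<rho> u)"
      unfolding x using that(1) by (simp_all add: x_def)
    ultimately show ?thesis unfolding x_def[symmetric] using norm_G[of x] by (simp only: x not_False_eq_True simp_thms)
  qed
  have zero_set: "\<exists>p\<in>?T. x = real4_of (of_real (\<rho>\<^sup>2) * U p) (of_real \<rho> * (fst p * of_real (shell_root \<rho> (U p))))"
    if \<rho>: "0 < \<rho>" "norm x = \<rho>" and x: "G x = 0" and U: "zero_strands \<kappa> \<rho> U" for \<kappa> \<rho> x U
  proof -
    have "f (u_of x / of_real (\<rho>\<^sup>2)) (v_of x / of_real \<rho>) = 0" using norm_G[of x] \<rho> x by auto
    then obtain p where p: "p \<in> ?T" "u_of x / of_real (\<rho>\<^sup>2) = U p"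
      "v_of x / of_real \<rho> = fst p * of_real (shell_root \<rho> (U p))"
      using zero_strandsD(4)[OF U shell[OF \<rho>]] by auto
    have "x = real4_of (u_of x) (v_of x)" by simp
    also have "u_of x = of_real (\<rho>\<^sup>2) * U p" using p(2) \<rho>(1) by (auto simp: field_simps)
    also have "v_of x = of_real \<rho> * (fst p * of_real (shell_root \<rho> (U p)))" using p(3) \<rho>(1) by (auto simp: field_simps)
    finally show ?thesis using p(1) by blast
  qed
  show "weakly_isolated_singularity G 0"
  proof -
    obtain C where C: "0 < C" "\<And>x. x \<noteq> 0 \<Longrightarrow> norm x \<le> 1 \<Longrightarrow> norm (G x) \<le> C * (norm x)\<^sup>2"
      using extends_F_quadratic_bound[OF \<open>0 < s\<close> \<open>even r\<close> \<open>0 < r\<close> _ G] \<open>0 < a\<close> by auto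
    have "isCont G 0" using poly by (rule continuous_polymonial_function)
    note zero = singular_zero_of_quadratic_bound[OF this C]
    have "\<not> singular_point G y" if y: "norm y < \<rho>\<^sub>1" "y \<noteq> 0" "G y = 0" for y
    proof -
      define \<rho> where "\<rho> = norm y"
      have \<rho>: "0 < \<rho>" "\<rho> < \<rho>\<^sub>1" using y by (auto simp: \<rho>_def)
      obtain U where U: "zero_strands (d / 4) \<rho> U" using strands[OF \<rho>] by blast
      obtain m \<eta> where m: "0 < m" "0 < \<eta>" and lower: "\<And>p u. p \<in> ?T \<Longrightarrow> cmod (u - U p) < \<eta> \<Longrightarrow>
          \<rho> * cmod u < 1 \<and> m * cmod (u - U p) \<le> cmod (f u (fst p * of_real (shell_root \<rho> u)))"
        using zero_strandsD(5)[OF U] by blast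
      define X where "X = (\<lambda>(p::complex \<times> complex) u. real4_of (of_real (\<rho>\<^sup>2) * u) (of_real \<rho> * (fst p * of_real (shell_root \<rho> u))))"
      obtain p where p: "p \<in> ?T" "y = X p (U p)"
        using zero_set[OF \<rho>(1) \<rho>_def[symmetric] y(3) U] unfolding X_def by blast
      have "\<not> singular_point G (X p (U p))"
      proof (rule regular_point_of_slice)
        show "G differentiable at (X p (U p))" using poly by (rule differentiable_at_polynomial_function)
        have "(\<rho> * cmod (U p))\<^sup>2 < 1" using zero_strandsD(3)[OF U p(1)] \<rho>(1) by (simp add: abs_square_less_1)
        then show "X p differentiable at (U p)"
          unfolding X_def shell_root_def
          by (intro differentiable_real4_of differentiable_mult differentiable_const differentiable_ident
              differentiable_shell_root) (simp add: power_mult_distrib)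
        show "G (X p (U p)) = 0" using y p by simp
        show "0 < \<rho> ^ E * m" using \<rho> m by simp
        show "\<rho> ^ E * m * cmod (u - U p) \<le> norm (G (X p u))" if u: "cmod (u - U p) < \<eta>" for u
          using lower[OF p(1) u] norm_G_shell_point[OF \<rho>(1) _ T1(1)[OF p(1)], of u] \<rho>(1)
          by (simp add: X_def mult.assoc)
      qed (rule m)
      then show ?thesis using p by simp
    qed
    then show ?thesis
      unfolding weakly_isolated_singularity_def using zero \<rho>\<^sub>1
      by (intro conjI exI[of _ "ball 0 \<rho>\<^sub>1"]) auto
  qed
  define \<epsilon> where "\<epsilon> = min \<rho>\<^sub>1 (min (1 / B) (d / (16 * B\<^sup>2)))"
  have \<epsilon>: "0 < \<epsilon>" using \<rho>\<^sub>1 B d by (simp add: \<epsilon>_def)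
  show "\<exists>\<epsilon>>0. \<forall>\<rho>\<^sub>0. 0 < \<rho>\<^sub>0 \<and> \<rho>\<^sub>0 < \<epsilon> \<longrightarrow>
          (let K = (\<lambda>x. x /\<^sub>R \<rho>\<^sub>0) ` (sphere 0 \<rho>\<^sub>0 \<inter> {x. G x = 0}) in
           is_link K \<and>
           (\<forall>R. admissible_radius s r l a b R \<longrightarrow>
              ambient_isotopic_in (sphere 0 1) K (lemniscate_link s r l a b R)))"
    unfolding Let_def
  proof (intro exI[of _ \<epsilon>] conjI allI impI \<epsilon>)
    fix \<rho> assume "0 < \<rho> \<and> \<rho> < \<epsilon>"
    then have \<rho>: "0 < \<rho>" "\<rho> < \<rho>\<^sub>1" "\<rho> * B < 1" "16 * \<rho> * B\<^sup>2 \<le> d"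
      using B(1) by (auto simp: \<epsilon>_def field_simps)
    obtain U where strands_U: "zero_strands (d / 4) \<rho> U" using strands[OF \<rho>(1,2)] by blast
    note U = zero_strandsD[OF strands_U]
    let ?X = "\<lambda>p. real4_of (of_real (\<rho>\<^sup>2) * U p) (of_real \<rho> * (fst p * of_real (shell_root \<rho> (U p))))"
    have X: "?X p /\<^sub>R \<rho> = sphere_point (of_real \<rho> * U p) (fst p)" for p
    proof -
      have "sqrt (1 - (cmod (of_real \<rho> * U p))\<^sup>2) = shell_root \<rho> (U p)"
        by (simp add: shell_root_def norm_mult power_mult_distrib)
      then show ?thesis using \<rho>(1) unfolding sphere_point_def
        by (simp add: vec_eq_iff forall_4 real4_of_def power2_eq_square)
    qed
    have "sphere 0 \<rho> \<inter> {x. G x = 0} = ?X ` ?T"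
    proof (intro subset_antisym subsetI)
      fix x assume "x \<in> sphere 0 \<rho> \<inter> {x. G x = 0}"
      then show "x \<in> ?X ` ?T" using zero_set[OF \<rho>(1) _ _ strands_U, of x] by auto
    next
      fix x assume "x \<in> ?X ` ?T"
      then obtain p where p: "p \<in> ?T" "x = ?X p" by blast
      note norms = norm_shell_point[OF \<rho>(1) U(3)[OF p(1)] T1(1)[OF p(1)]]
        norm_G_shell_point[OF \<rho>(1) U(3)[OF p(1)] T1(1)[OF p(1)]]
      have "\<rho>\<^sup>2 * (cmod (U p))\<^sup>2 + (cmod (fst p * of_real (shell_root \<rho> (U p))))\<^sup>2 = 1"
        using shell[OF \<rho>(1) norms(1)] \<rho>(1) by simp
      then have "f (U p) (fst p * of_real (shell_root \<rho> (U p))) = 0" using U(4) p(1) by blast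
      then have "norm (G x) = 0" using norms(2) p(2) by simp
      then show "x \<in> sphere 0 \<rho> \<inter> {x. G x = 0}" using norms(1) p(2) by simp
    qed
    then have K: "(\<lambda>x. x /\<^sub>R \<rho>) ` (sphere 0 \<rho> \<inter> {x. G x = 0}) = closed_braid s r (\<lambda>p. of_real \<rho> * U p)"
      unfolding closed_braid_def by (simp only: image_image X)
    have d': "d \<le> cmod (\<zeta> t - \<zeta> t')" if "(w, t) \<in> ?T" "(w, t') \<in> ?T" "t \<noteq> t'" for w t t'
      using d(2)[OF that] by simp
    have "geometric_braid s r (\<lambda>p. of_real \<rho> * U p)"
      by (rule scaled_strands(3)[where \<zeta> = \<zeta> and d = d]; fact d' d(1) \<rho>(1) U(1,2,3))
    then show "is_link ((\<lambda>x. x /\<^sub>R \<rho>) ` (sphere 0 \<rho> \<inter> {x. G x = 0}))"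
      unfolding K by (rule is_link_closed_braid[OF s])
    fix R assume R: "admissible_radius s r l a b R"
    show "ambient_isotopic_in (sphere 0 1) ((\<lambda>x. x /\<^sub>R \<rho>) ` (sphere 0 \<rho> \<inter> {x. G x = 0})) (lemniscate_link s r l a b R)"
      unfolding K lemniscate_link_eq_closed_braid(1)[OF s R] \<zeta>_def[symmetric]
    proof (rule lemniscate_braid_isotopic_small_strands[where \<zeta> = \<zeta> and d = d and B = B])
      show "0 < R + Re (\<zeta> (snd p))" if "p \<in> ?T" for p
        using lemniscate_link_eq_closed_braid(2)[OF s R that] by (simp add: \<zeta>_def lissajous_def)
    qed (fact s continuous_\<zeta> d' d(1) B \<rho>(1,3,4) U(1,2,3))+
  qed
qed

end
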